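(* Let $R$ be a ring and let $G$ be a group. If the group ring $RG$ is unit-regular, then $R$ is a unit-regular ring, $G$ is a locally finite group, and the order of every element of $G$ is a unit in $R$. The converse is valid when $R$ is a ring with noetherian prime factors: that is, if $R/P$ is noetherian for every prime ideal $P$ of $R$, $R$ is unit-regular, $G$ is locally finite, and the order of every element of $G$ is a unit in $R$, then $RG$ is unit-regular.
   Context: Rings are associative with identity, not necessarily commutative. A ring $R$ is unit-regular if for every $a\in R$ there is a unit $u\in R$ with $a=aua$. A group is locally finite if each of its finitely generated subgroups is finite. "The order $n$ of $g$ is a unit in $R$" means that $n\cdot 1_R$ is invertible in $R$. "Noetherian" means left and right noetherian.
   Formalization: The ring R is assumed to be nonzero (1 ≠ 0): for R = 0 the group ring RG is zero, hence unit-regular, for every group G, including groups that are not locally finite, so the first implication would fail. *)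

theory Defs
  imports "HOL-Algebra.Algebra"
begin

definition gr_support :: "('a, 'm) ring_scheme \<Rightarrow> ('g, 'n) monoid_scheme \<Rightarrow> ('g \<Rightarrow> 'a) \<Rightarrow> 'g set"
  where "gr_support R G f = {g \<in> carrier G. f g \<noteq> \<zero>\<^bsub>R\<^esub>}"

text \<open>
  The element \<open>\<Sum>\<^sub>g f(g) g\<close> of the group ring is the finitely supported function \<open>f\<close>, made
  extensional (\<open>undefined\<close> off \<open>carrier G\<close>) so that it is determined by its coefficients.
  The coefficient of a product at \<open>x\<close> is the sum of \<open>f(g) f'(h)\<close> over all \<open>g h = x\<close>, that is,
  over \<open>h = g\<^sup>-\<^sup>1 x\<close>; \<open>g\<close> ranges over the support of \<open>f\<close> because \<open>finsum\<close> needs a finite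
  index set.
\<close>

definition group_ring :: "('a, 'm) ring_scheme \<Rightarrow> ('g, 'n) monoid_scheme \<Rightarrow> ('g \<Rightarrow> 'a) ring"
  where "group_ring R G =
    \<lparr> carrier = {f \<in> carrier G \<rightarrow>\<^sub>E carrier R. finite (gr_support R G f)},
      monoid.mult = (\<lambda>f f'. \<lambda>x\<in>carrier G.
                \<Oplus>\<^bsub>R\<^esub>g\<in>gr_support R G f. f g \<otimes>\<^bsub>R\<^esub> f' (inv\<^bsub>G\<^esub> g \<otimes>\<^bsub>G\<^esub> x)),
      one = (\<lambda>x\<in>carrier G. if x = \<one>\<^bsub>G\<^esub> then \<one>\<^bsub>R\<^esub> else \<zero>\<^bsub>R\<^esub>),
      ring.zero = (\<lambda>x\<in>carrier G. \<zero>\<^bsub>R\<^esub>),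
      add = (\<lambda>f f'. \<lambda>x\<in>carrier G. f x \<oplus>\<^bsub>R\<^esub> f' x) \<rparr>"

locale unit_regular_ring = ring R for R (structure) +
  assumes unit_regular: "a \<in> carrier R \<Longrightarrow> \<exists>u\<in>Units R. a = a \<otimes> u \<otimes> a"

locale locally_finite_group = group G for G (structure) +
  assumes finite_generate: "\<lbrakk>S \<subseteq> carrier G; finite S\<rbrakk> \<Longrightarrow> finite (generate G S)"

text \<open>
  The library's \<open>primeideal\<close> is confined to commutative rings and its \<open>noetherian_ring\<close> concerns
  two-sided ideals only, so the noncommutative notions are introduced here.
\<close>

locale nc_prime_ideal = ideal P R for P and R (structure) +
  assumes proper: "P \<noteq> carrier R"
    and prime: "\<lbrakk>ideal I R; ideal J R; I \<cdot> J \<subseteq> P\<rbrakk> \<Longrightarrow> I \<subseteq> P \<or> J \<subseteq> P"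

locale left_ideal = additive_subgroup L R + ring R for L and R (structure) +
  assumes left_closed: "\<lbrakk>a \<in> L; x \<in> carrier R\<rbrakk> \<Longrightarrow> x \<otimes> a \<in> L"

locale right_ideal = additive_subgroup L R + ring R for L and R (structure) +
  assumes right_closed: "\<lbrakk>a \<in> L; x \<in> carrier R\<rbrakk> \<Longrightarrow> a \<otimes> x \<in> L"

locale lr_noetherian_ring = ring R for R (structure) +
  assumes left_acc: "\<lbrakk>\<And>n::nat. left_ideal (L n) R; \<And>n. L n \<subseteq> L (Suc n)\<rbrakk> \<Longrightarrow> \<exists>N. \<forall>n\<ge>N. L n = L N"
    and right_acc: "\<lbrakk>\<And>n::nat. right_ideal (L n) R; \<And>n. L n \<subseteq> L (Suc n)\<rbrakk> \<Longrightarrow> \<exists>N. \<forall>n\<ge>N. L n = L N"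


context
  fixes R :: "('a, 'm) ring_scheme" (structure) and G :: "('g, 'n) monoid_scheme"
  assumes R: "ring R" and G: "group G"
begin

interpretation ring R by (rule R)
interpretation G: group G by (rule G)

lemma gr_finsum_swap:
  assumes "finite A" "finite B" "\<And>a b. a \<in> A \<Longrightarrow> b \<in> B \<Longrightarrow> f a b \<in> carrier R"
  shows "(\<Oplus>a\<in>A. \<Oplus>b\<in>B. f a b) = (\<Oplus>b\<in>B. \<Oplus>a\<in>A. f a b)"
  using assms(1,3)
proof (induction A rule: finite_induct)
  case empty
  then show ?case by (simp add: finsum_zero)
next
  case (insert a A)
  have 1: "(\<lambda>a. \<Oplus>b\<in>B. f a b) \<in> A \<rightarrow> carrier R" "(\<Oplus>b\<in>B. f a b) \<in> carrier R"
    using insert.prems by (auto intro!: finsum_closed)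
  have "(\<Oplus>b\<in>B. \<Oplus>a\<in>insert a A. f a b) = (\<Oplus>b\<in>B. f a b \<oplus> (\<Oplus>a\<in>A. f a b))"
  proof (rule finsum_cong')
    fix b assume "b \<in> B"
    then show "(\<Oplus>a\<in>insert a A. f a b) = f a b \<oplus> (\<Oplus>a\<in>A. f a b)"
      using insert.prems insert.hyps by (intro finsum_insert) auto
  qed (use insert.prems in \<open>auto intro!: finsum_closed add.m_closed\<close>)
  also have "\<dots> = (\<Oplus>b\<in>B. f a b) \<oplus> (\<Oplus>b\<in>B. \<Oplus>a\<in>A. f a b)"
    using insert.prems by (intro finsum_addf) (auto intro!: finsum_closed)
  finally show ?case
    using insert 1 by (simp add: finsum_insert)
qed

lemma gr_carrierD:
  assumes "f \<in> carrier (group_ring R G)"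
  shows "g \<in> carrier G \<Longrightarrow> f g \<in> carrier R" "finite (gr_support R G f)"
    "f \<in> extensional (carrier G)" "gr_support R G f \<subseteq> carrier G"
  using assms by (auto simp: group_ring_def gr_support_def PiE_def)

lemma gr_carrierI:
  assumes "\<And>g. g \<in> carrier G \<Longrightarrow> f g \<in> carrier R" "f \<in> extensional (carrier G)"
    "finite A" "\<And>g. g \<in> carrier G \<Longrightarrow> g \<notin> A \<Longrightarrow> f g = \<zero>"
  shows "f \<in> carrier (group_ring R G)"
proof -
  have "gr_support R G f \<subseteq> A" using assms(4) by (auto simp: gr_support_def)
  then show ?thesis
    using assms finite_subset by (auto simp: group_ring_def PiE_def)
qed

lemma gr_mult_eq:
  assumes f: "f \<in> carrier (group_ring R G)" and f': "f' \<in> carrier (group_ring R G)"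
    and A: "finite A" "gr_support R G f \<subseteq> A" "A \<subseteq> carrier G" and x: "x \<in> carrier G"
  shows "(f \<otimes>\<^bsub>group_ring R G\<^esub> f') x = (\<Oplus>g\<in>A. f g \<otimes> f' (inv\<^bsub>G\<^esub> g \<otimes>\<^bsub>G\<^esub> x))"
proof -
  have "(\<Oplus>g\<in>gr_support R G f. f g \<otimes> f' (inv\<^bsub>G\<^esub> g \<otimes>\<^bsub>G\<^esub> x)) = (\<Oplus>g\<in>A. f g \<otimes> f' (inv\<^bsub>G\<^esub> g \<otimes>\<^bsub>G\<^esub> x))"
  proof (rule add.finprod_mono_neutral_cong_left)
    fix g assume "g \<in> A - gr_support R G f"
    with A have "g \<in> carrier G" "f g = \<zero>" by (auto simp: gr_support_def)
    then show "f g \<otimes> f' (inv\<^bsub>G\<^esub> g \<otimes>\<^bsub>G\<^esub> x) = \<zero>"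
      using gr_carrierD(1)[OF f'] x by simp
  next
    show "(\<lambda>g. f g \<otimes> f' (inv\<^bsub>G\<^esub> g \<otimes>\<^bsub>G\<^esub> x)) \<in> A \<rightarrow> carrier R"
      using gr_carrierD(1)[OF f] gr_carrierD(1)[OF f'] x A(3) by (auto intro!: m_closed)
  qed (use A in auto)
  then show ?thesis using x by (simp add: group_ring_def)
qed

lemma gr_mult_closed:
  assumes f: "f \<in> carrier (group_ring R G)" and f': "f' \<in> carrier (group_ring R G)"
  shows "f \<otimes>\<^bsub>group_ring R G\<^esub> f' \<in> carrier (group_ring R G)"
proof (rule gr_carrierI)
  let ?A = "(\<lambda>(g, h). g \<otimes>\<^bsub>G\<^esub> h) ` (gr_support R G f \<times> gr_support R G f')"
  note c = gr_carrierD[OF f] and c' = gr_carrierD[OF f']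
  show "finite ?A" using c(2) c'(2) by simp
  show "f \<otimes>\<^bsub>group_ring R G\<^esub> f' \<in> extensional (carrier G)" by (simp add: group_ring_def)
  fix x assume x: "x \<in> carrier G"
  note eq = gr_mult_eq[OF f f' c(2) order_refl c(4) x]
  show "(f \<otimes>\<^bsub>group_ring R G\<^esub> f') x \<in> carrier R"
    unfolding eq using c c' x by (intro finsum_closed) (auto intro!: m_closed simp: gr_support_def)
  assume n: "x \<notin> ?A"
  show "(f \<otimes>\<^bsub>group_ring R G\<^esub> f') x = \<zero>"
    unfolding eq
  proof (rule add.finprod_one_eqI)
    fix g assume g: "g \<in> gr_support R G f"
    then have gc: "g \<in> carrier G" using c by auto
    have "x = g \<otimes>\<^bsub>G\<^esub> (inv\<^bsub>G\<^esub> g \<otimes>\<^bsub>G\<^esub> x)" using gc x by (simp add: G.m_assoc[symmetric])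
    with n g have "inv\<^bsub>G\<^esub> g \<otimes>\<^bsub>G\<^esub> x \<notin> gr_support R G f'" by force
    then have "f' (inv\<^bsub>G\<^esub> g \<otimes>\<^bsub>G\<^esub> x) = \<zero>" using gc x by (auto simp: gr_support_def)
    then show "f g \<otimes> f' (inv\<^bsub>G\<^esub> g \<otimes>\<^bsub>G\<^esub> x) = \<zero>" using c gc by simp
  qed
qed

lemma gr_add_closed:
  assumes f: "f \<in> carrier (group_ring R G)" and f': "f' \<in> carrier (group_ring R G)"
  shows "f \<oplus>\<^bsub>group_ring R G\<^esub> f' \<in> carrier (group_ring R G)"
  by (rule gr_carrierI[where A = "gr_support R G f \<union> gr_support R G f'"])
    (use gr_carrierD[OF f] gr_carrierD[OF f'] in \<open>auto simp: group_ring_def gr_support_def\<close>)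

lemma gr_one_closed: "\<one>\<^bsub>group_ring R G\<^esub> \<in> carrier (group_ring R G)"
  by (rule gr_carrierI[where A = "{\<one>\<^bsub>G\<^esub>}"]) (auto simp: group_ring_def)

lemma gr_zero_closed: "\<zero>\<^bsub>group_ring R G\<^esub> \<in> carrier (group_ring R G)"
  by (rule gr_carrierI[where A = "{}"]) (auto simp: group_ring_def)

lemma gr_ext:
  assumes "f \<in> carrier (group_ring R G)" "f' \<in> carrier (group_ring R G)"
    "\<And>x. x \<in> carrier G \<Longrightarrow> f x = f' x"
  shows "f = f'"
  using assms gr_carrierD(3) by (intro extensionalityI[of f "carrier G" f']) auto

lemma gr_add_apply: "x \<in> carrier G \<Longrightarrow> (f \<oplus>\<^bsub>group_ring R G\<^esub> f') x = f x \<oplus> f' x"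
  by (simp add: group_ring_def)

lemma gr_mult_assoc:
  assumes f: "f \<in> carrier (group_ring R G)" and g: "g \<in> carrier (group_ring R G)"
    and k: "k \<in> carrier (group_ring R G)"
  shows "f \<otimes>\<^bsub>group_ring R G\<^esub> g \<otimes>\<^bsub>group_ring R G\<^esub> k = f \<otimes>\<^bsub>group_ring R G\<^esub> (g \<otimes>\<^bsub>group_ring R G\<^esub> k)"
proof (rule gr_ext)
  note cf = gr_carrierD[OF f] and cg = gr_carrierD[OF g] and ck = gr_carrierD[OF k]
  note fg = gr_mult_closed[OF f g] and gk = gr_mult_closed[OF g k]
  fix x assume x: "x \<in> carrier G"
  let ?S = "gr_support R G f" and ?T = "gr_support R G g"
  let ?A = "(\<lambda>(g, h). g \<otimes>\<^bsub>G\<^esub> h) ` (?S \<times> ?T) \<union> gr_support R G (f \<otimes>\<^bsub>group_ring R G\<^esub> g)"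
  have A: "finite ?A" "?A \<subseteq> carrier G"
    using cf cg gr_carrierD[OF fg] by auto
  let ?t = "\<lambda>s y. f s \<otimes> (g (inv\<^bsub>G\<^esub> s \<otimes>\<^bsub>G\<^esub> y) \<otimes> k (inv\<^bsub>G\<^esub> y \<otimes>\<^bsub>G\<^esub> x))"
  have tc: "?t s y \<in> carrier R" if "s \<in> carrier G" "y \<in> carrier G" for s y
    using that cf(1) cg(1) ck(1) x by (auto intro!: m_closed)
  have "(f \<otimes>\<^bsub>group_ring R G\<^esub> g \<otimes>\<^bsub>group_ring R G\<^esub> k) x
      = (\<Oplus>y\<in>?A. (f \<otimes>\<^bsub>group_ring R G\<^esub> g) y \<otimes> k (inv\<^bsub>G\<^esub> y \<otimes>\<^bsub>G\<^esub> x))"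
    by (rule gr_mult_eq[OF fg k A(1) _ A(2) x]) auto
  also have "\<dots> = (\<Oplus>y\<in>?A. \<Oplus>s\<in>?S. ?t s y)"
  proof (rule finsum_cong')
    show "(\<lambda>y. \<Oplus>s\<in>?S. ?t s y) \<in> ?A \<rightarrow> carrier R"
      using tc cf(4) A(2) by (intro Pi_I finsum_closed) blast
    fix y assume "y \<in> ?A"
    then have y: "y \<in> carrier G" using A(2) by blast
    have "(f \<otimes>\<^bsub>group_ring R G\<^esub> g) y \<otimes> k (inv\<^bsub>G\<^esub> y \<otimes>\<^bsub>G\<^esub> x)
       = (\<Oplus>s\<in>?S. (f s \<otimes> g (inv\<^bsub>G\<^esub> s \<otimes>\<^bsub>G\<^esub> y)) \<otimes> k (inv\<^bsub>G\<^esub> y \<otimes>\<^bsub>G\<^esub> x))"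
      unfolding gr_mult_eq[OF f g cf(2) order_refl cf(4) y]
      using cf cg ck x y by (intro finsum_ldistr) (auto intro!: m_closed simp: gr_support_def)
    also have "\<dots> = (\<Oplus>s\<in>?S. ?t s y)"
    proof (rule finsum_cong')
      show "(\<lambda>s. ?t s y) \<in> ?S \<rightarrow> carrier R" using tc cf(4) y by blast
      fix s assume "s \<in> ?S"
      then have "s \<in> carrier G" using cf(4) by blast
      then show "(f s \<otimes> g (inv\<^bsub>G\<^esub> s \<otimes>\<^bsub>G\<^esub> y)) \<otimes> k (inv\<^bsub>G\<^esub> y \<otimes>\<^bsub>G\<^esub> x) = ?t s y"
        using cf(1) cg(1) ck(1) x y by (intro m_assoc) auto
    qed simp
    finally show "(f \<otimes>\<^bsub>group_ring R G\<^esub> g) y \<otimes> k (inv\<^bsub>G\<^esub> y \<otimes>\<^bsub>G\<^esub> x) = (\<Oplus>s\<in>?S. ?t s y)" .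
  qed simp
  also have "\<dots> = (\<Oplus>s\<in>?S. \<Oplus>y\<in>?A. ?t s y)"
    using A cf tc by (intro gr_finsum_swap) blast+
  also have "\<dots> = (\<Oplus>s\<in>?S. f s \<otimes> (g \<otimes>\<^bsub>group_ring R G\<^esub> k) (inv\<^bsub>G\<^esub> s \<otimes>\<^bsub>G\<^esub> x))"
  proof (rule finsum_cong')
    show "(\<lambda>s. f s \<otimes> (g \<otimes>\<^bsub>group_ring R G\<^esub> k) (inv\<^bsub>G\<^esub> s \<otimes>\<^bsub>G\<^esub> x)) \<in> ?S \<rightarrow> carrier R"
      using cf gr_carrierD(1)[OF gk] x by (auto intro!: m_closed simp: gr_support_def)
    fix s assume sS: "s \<in> ?S"
    then have s: "s \<in> carrier G" using cf(4) by blast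
    have sx: "inv\<^bsub>G\<^esub> s \<otimes>\<^bsub>G\<^esub> x \<in> carrier G" using s x by simp
    have inj: "inj_on (\<lambda>z. s \<otimes>\<^bsub>G\<^esub> z) ?T"
      by (rule inj_onI) (use s cg(4) in \<open>meson G.l_cancel subsetD\<close>)
    have "(\<Oplus>y\<in>?A. ?t s y) = (\<Oplus>y\<in>(\<lambda>z. s \<otimes>\<^bsub>G\<^esub> z) ` ?T. ?t s y)"
    proof (rule add.finprod_mono_neutral_cong_right)
      show "(\<lambda>z. s \<otimes>\<^bsub>G\<^esub> z) ` ?T \<subseteq> ?A" using sS by auto
      show "?t s \<in> ?A \<rightarrow> carrier R" using tc s A(2) by blast
      fix y assume y: "y \<in> ?A - (\<lambda>z. s \<otimes>\<^bsub>G\<^esub> z) ` ?T"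
      then have yc: "y \<in> carrier G" using A(2) by blast
      have "y = s \<otimes>\<^bsub>G\<^esub> (inv\<^bsub>G\<^esub> s \<otimes>\<^bsub>G\<^esub> y)" using s yc by (simp add: G.m_assoc[symmetric])
      with y have "inv\<^bsub>G\<^esub> s \<otimes>\<^bsub>G\<^esub> y \<notin> ?T" by blast
      then have "g (inv\<^bsub>G\<^esub> s \<otimes>\<^bsub>G\<^esub> y) = \<zero>" using s yc by (simp add: gr_support_def)
      then show "?t s y = \<zero>" using cf(1) ck(1) s yc x by simp
    qed (use A in auto)
    also have "\<dots> = (\<Oplus>z\<in>?T. ?t s (s \<otimes>\<^bsub>G\<^esub> z))"
      using tc s cg(4) by (intro finsum_reindex inj) blast
    also have "\<dots> = (\<Oplus>z\<in>?T. f s \<otimes> (g z \<otimes> k (inv\<^bsub>G\<^esub> z \<otimes>\<^bsub>G\<^esub> (inv\<^bsub>G\<^esub> s \<otimes>\<^bsub>G\<^esub> x))))"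
    proof (rule finsum_cong')
      show "(\<lambda>z. f s \<otimes> (g z \<otimes> k (inv\<^bsub>G\<^esub> z \<otimes>\<^bsub>G\<^esub> (inv\<^bsub>G\<^esub> s \<otimes>\<^bsub>G\<^esub> x)))) \<in> ?T \<rightarrow> carrier R"
        using cf(1) cg(1,4) ck(1) s sx by (auto intro!: m_closed simp: gr_support_def)
      fix z assume "z \<in> ?T"
      then have z: "z \<in> carrier G" using cg(4) by blast
      then show "?t s (s \<otimes>\<^bsub>G\<^esub> z) = f s \<otimes> (g z \<otimes> k (inv\<^bsub>G\<^esub> z \<otimes>\<^bsub>G\<^esub> (inv\<^bsub>G\<^esub> s \<otimes>\<^bsub>G\<^esub> x)))"
        using s x by (simp add: G.m_assoc[symmetric] G.inv_mult_group)
    qed simp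
    also have "\<dots> = f s \<otimes> (\<Oplus>z\<in>?T. g z \<otimes> k (inv\<^bsub>G\<^esub> z \<otimes>\<^bsub>G\<^esub> (inv\<^bsub>G\<^esub> s \<otimes>\<^bsub>G\<^esub> x)))"
      using cf(1) cg ck(1) s sx
      by (intro finsum_rdistr[symmetric]) (auto intro!: m_closed simp: gr_support_def)
    finally show "(\<Oplus>y\<in>?A. ?t s y) = f s \<otimes> (g \<otimes>\<^bsub>group_ring R G\<^esub> k) (inv\<^bsub>G\<^esub> s \<otimes>\<^bsub>G\<^esub> x)"
      unfolding gr_mult_eq[OF g k cg(2) order_refl cg(4) sx] .
  qed simp
  finally show "(f \<otimes>\<^bsub>group_ring R G\<^esub> g \<otimes>\<^bsub>group_ring R G\<^esub> k) x
      = (f \<otimes>\<^bsub>group_ring R G\<^esub> (g \<otimes>\<^bsub>group_ring R G\<^esub> k)) x"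
    unfolding gr_mult_eq[OF f gk cf(2) order_refl cf(4) x] .
qed (use assms gr_mult_closed in auto)

lemma ring_group_ring: "ring (group_ring R G)"
proof (rule ringI)
  let ?RG = "group_ring R G"
  show "abelian_group ?RG"
  proof (rule abelian_groupI)
    fix f assume f: "f \<in> carrier ?RG"
    have "(\<lambda>x\<in>carrier G. \<ominus> f x) \<in> carrier ?RG"
      by (rule gr_carrierI[where A = "gr_support R G f"])
        (use gr_carrierD[OF f] in \<open>auto simp: gr_support_def\<close>)
    moreover have "(\<lambda>x\<in>carrier G. \<ominus> f x) \<oplus>\<^bsub>?RG\<^esub> f = \<zero>\<^bsub>?RG\<^esub>"
      using gr_carrierD(1)[OF f] by (auto simp: group_ring_def l_neg)
    ultimately show "\<exists>y\<in>carrier ?RG. y \<oplus>\<^bsub>?RG\<^esub> f = \<zero>\<^bsub>?RG\<^esub>" by blast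
    show "\<zero>\<^bsub>?RG\<^esub> \<oplus>\<^bsub>?RG\<^esub> f = f"
      by (rule gr_ext[OF gr_add_closed])
        (use f gr_zero_closed gr_carrierD(1)[OF f] in \<open>auto simp: group_ring_def\<close>)
  next
    fix f g assume "f \<in> carrier ?RG" "g \<in> carrier ?RG"
    then show "f \<oplus>\<^bsub>?RG\<^esub> g = g \<oplus>\<^bsub>?RG\<^esub> f"
      by (intro gr_ext gr_add_closed) (auto simp: gr_add_apply gr_carrierD a_comm)
  next
    fix f g k assume "f \<in> carrier ?RG" "g \<in> carrier ?RG" "k \<in> carrier ?RG"
    then show "f \<oplus>\<^bsub>?RG\<^esub> g \<oplus>\<^bsub>?RG\<^esub> k = f \<oplus>\<^bsub>?RG\<^esub> (g \<oplus>\<^bsub>?RG\<^esub> k)"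
      by (intro gr_ext gr_add_closed) (auto simp: gr_add_apply gr_carrierD a_assoc)
  qed (auto intro: gr_add_closed gr_zero_closed)
  show "monoid ?RG"
  proof (rule monoidI)
    fix f assume f: "f \<in> carrier ?RG"
    note c = gr_carrierD[OF f]
    show "\<one>\<^bsub>?RG\<^esub> \<otimes>\<^bsub>?RG\<^esub> f = f"
    proof (rule gr_ext[OF gr_mult_closed[OF gr_one_closed f] f])
      fix x assume x: "x \<in> carrier G"
      have "(\<one>\<^bsub>?RG\<^esub> \<otimes>\<^bsub>?RG\<^esub> f) x = (\<Oplus>g\<in>{\<one>\<^bsub>G\<^esub>}. \<one>\<^bsub>?RG\<^esub> g \<otimes> f (inv\<^bsub>G\<^esub> g \<otimes>\<^bsub>G\<^esub> x))"
        by (rule gr_mult_eq[OF gr_one_closed f _ _ _ x]) (auto simp: group_ring_def gr_support_def)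
      also have "\<dots> = f x"
        using x c(1) by (simp add: finsum_insert group_ring_def)
      finally show "(\<one>\<^bsub>?RG\<^esub> \<otimes>\<^bsub>?RG\<^esub> f) x = f x" .
    qed
    show "f \<otimes>\<^bsub>?RG\<^esub> \<one>\<^bsub>?RG\<^esub> = f"
    proof (rule gr_ext[OF gr_mult_closed[OF f gr_one_closed] f])
      fix x assume x: "x \<in> carrier G"
      let ?A = "insert x (gr_support R G f)"
      have A: "finite ?A" "?A \<subseteq> carrier G" using c x by auto
      have "(f \<otimes>\<^bsub>?RG\<^esub> \<one>\<^bsub>?RG\<^esub>) x = (\<Oplus>g\<in>?A. f g \<otimes> \<one>\<^bsub>?RG\<^esub> (inv\<^bsub>G\<^esub> g \<otimes>\<^bsub>G\<^esub> x))"
        by (rule gr_mult_eq[OF f gr_one_closed A(1) _ A(2) x]) auto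
      also have "\<dots> = (\<Oplus>g\<in>?A. if x = g then f g else \<zero>)"
      proof (rule finsum_cong')
        show "(\<lambda>g. if x = g then f g else \<zero>) \<in> ?A \<rightarrow> carrier R" using c(1) x by auto
        fix g assume "g \<in> ?A"
        then have g: "g \<in> carrier G" using A by blast
        then have "inv\<^bsub>G\<^esub> g \<otimes>\<^bsub>G\<^esub> x = \<one>\<^bsub>G\<^esub> \<longleftrightarrow> x = g"
          using x G.inv_solve_left[of "\<one>\<^bsub>G\<^esub>" g x] by auto
        then show "f g \<otimes> \<one>\<^bsub>?RG\<^esub> (inv\<^bsub>G\<^esub> g \<otimes>\<^bsub>G\<^esub> x) = (if x = g then f g else \<zero>)"
          using g x c(1) by (simp add: group_ring_def)
      qed simp
      also have "\<dots> = f x"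
        using A c(1) by (intro finsum_singleton) auto
      finally show "(f \<otimes>\<^bsub>?RG\<^esub> \<one>\<^bsub>?RG\<^esub>) x = f x" .
    qed
  qed (auto intro: gr_mult_closed gr_one_closed gr_mult_assoc)
next
  let ?RG = "group_ring R G"
  fix f g k assume f: "f \<in> carrier ?RG" and g: "g \<in> carrier ?RG" and k: "k \<in> carrier ?RG"
  note cf = gr_carrierD[OF f] and cg = gr_carrierD[OF g] and ck = gr_carrierD[OF k]
  have fg: "f \<oplus>\<^bsub>?RG\<^esub> g \<in> carrier ?RG" by (rule gr_add_closed[OF f g])
  show "(f \<oplus>\<^bsub>?RG\<^esub> g) \<otimes>\<^bsub>?RG\<^esub> k = f \<otimes>\<^bsub>?RG\<^esub> k \<oplus>\<^bsub>?RG\<^esub> g \<otimes>\<^bsub>?RG\<^esub> k"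
  proof (rule gr_ext)
    fix x assume x: "x \<in> carrier G"
    let ?A = "gr_support R G f \<union> gr_support R G g \<union> gr_support R G (f \<oplus>\<^bsub>?RG\<^esub> g)"
    have A: "finite ?A" "?A \<subseteq> carrier G" using cf cg gr_carrierD[OF fg] by auto
    have cl: "\<And>s h. s \<in> ?A \<Longrightarrow> h \<in> carrier ?RG \<Longrightarrow> h s \<otimes> k (inv\<^bsub>G\<^esub> s \<otimes>\<^bsub>G\<^esub> x) \<in> carrier R"
      by (intro m_closed gr_carrierD(1)[of k] gr_carrierD(1) k G.m_closed G.inv_closed x)
        (use A(2) in blast)+
    have "((f \<oplus>\<^bsub>?RG\<^esub> g) \<otimes>\<^bsub>?RG\<^esub> k) x = (\<Oplus>s\<in>?A. (f \<oplus>\<^bsub>?RG\<^esub> g) s \<otimes> k (inv\<^bsub>G\<^esub> s \<otimes>\<^bsub>G\<^esub> x))"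
      by (rule gr_mult_eq[OF fg k A(1) _ A(2) x]) auto
    also have "\<dots> = (\<Oplus>s\<in>?A. f s \<otimes> k (inv\<^bsub>G\<^esub> s \<otimes>\<^bsub>G\<^esub> x) \<oplus> g s \<otimes> k (inv\<^bsub>G\<^esub> s \<otimes>\<^bsub>G\<^esub> x))"
    proof (rule finsum_cong')
      show "(\<lambda>s. f s \<otimes> k (inv\<^bsub>G\<^esub> s \<otimes>\<^bsub>G\<^esub> x) \<oplus> g s \<otimes> k (inv\<^bsub>G\<^esub> s \<otimes>\<^bsub>G\<^esub> x)) \<in> ?A \<rightarrow> carrier R"
        using cl f g by (intro Pi_I add.m_closed) blast+
      fix s assume "s \<in> ?A"
      then have "s \<in> carrier G" using A by blast
      then show "(f \<oplus>\<^bsub>?RG\<^esub> g) s \<otimes> k (inv\<^bsub>G\<^esub> s \<otimes>\<^bsub>G\<^esub> x)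
        = f s \<otimes> k (inv\<^bsub>G\<^esub> s \<otimes>\<^bsub>G\<^esub> x) \<oplus> g s \<otimes> k (inv\<^bsub>G\<^esub> s \<otimes>\<^bsub>G\<^esub> x)"
        using cf(1) cg(1) ck(1) x by (simp add: gr_add_apply l_distr)
    qed simp
    also have "\<dots> = (\<Oplus>s\<in>?A. f s \<otimes> k (inv\<^bsub>G\<^esub> s \<otimes>\<^bsub>G\<^esub> x)) \<oplus> (\<Oplus>s\<in>?A. g s \<otimes> k (inv\<^bsub>G\<^esub> s \<otimes>\<^bsub>G\<^esub> x))"
      using cl f g by (intro finsum_addf Pi_I) blast+
    also have "(\<Oplus>s\<in>?A. f s \<otimes> k (inv\<^bsub>G\<^esub> s \<otimes>\<^bsub>G\<^esub> x)) = (f \<otimes>\<^bsub>?RG\<^esub> k) x"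
      by (rule gr_mult_eq[OF f k A(1) _ A(2) x, symmetric]) auto
    also have "(\<Oplus>s\<in>?A. g s \<otimes> k (inv\<^bsub>G\<^esub> s \<otimes>\<^bsub>G\<^esub> x)) = (g \<otimes>\<^bsub>?RG\<^esub> k) x"
      by (rule gr_mult_eq[OF g k A(1) _ A(2) x, symmetric]) auto
    finally show "((f \<oplus>\<^bsub>?RG\<^esub> g) \<otimes>\<^bsub>?RG\<^esub> k) x = (f \<otimes>\<^bsub>?RG\<^esub> k \<oplus>\<^bsub>?RG\<^esub> g \<otimes>\<^bsub>?RG\<^esub> k) x"
      using x by (simp add: gr_add_apply)
  qed (use f g k gr_mult_closed gr_add_closed in auto)
  show "k \<otimes>\<^bsub>?RG\<^esub> (f \<oplus>\<^bsub>?RG\<^esub> g) = k \<otimes>\<^bsub>?RG\<^esub> f \<oplus>\<^bsub>?RG\<^esub> k \<otimes>\<^bsub>?RG\<^esub> g"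
  proof (rule gr_ext)
    fix x assume x: "x \<in> carrier G"
    let ?A = "gr_support R G k"
    have cl: "\<And>s h. s \<in> ?A \<Longrightarrow> h \<in> carrier ?RG \<Longrightarrow> k s \<otimes> h (inv\<^bsub>G\<^esub> s \<otimes>\<^bsub>G\<^esub> x) \<in> carrier R"
      by (intro m_closed gr_carrierD(1)[of k] gr_carrierD(1) k G.m_closed G.inv_closed x)
        (use ck(4) in blast)+
    have "(k \<otimes>\<^bsub>?RG\<^esub> (f \<oplus>\<^bsub>?RG\<^esub> g)) x = (\<Oplus>s\<in>?A. k s \<otimes> (f \<oplus>\<^bsub>?RG\<^esub> g) (inv\<^bsub>G\<^esub> s \<otimes>\<^bsub>G\<^esub> x))"
      by (rule gr_mult_eq[OF k fg ck(2) order_refl ck(4) x])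
    also have "\<dots> = (\<Oplus>s\<in>?A. k s \<otimes> f (inv\<^bsub>G\<^esub> s \<otimes>\<^bsub>G\<^esub> x) \<oplus> k s \<otimes> g (inv\<^bsub>G\<^esub> s \<otimes>\<^bsub>G\<^esub> x))"
    proof (rule finsum_cong')
      show "(\<lambda>s. k s \<otimes> f (inv\<^bsub>G\<^esub> s \<otimes>\<^bsub>G\<^esub> x) \<oplus> k s \<otimes> g (inv\<^bsub>G\<^esub> s \<otimes>\<^bsub>G\<^esub> x)) \<in> ?A \<rightarrow> carrier R"
        using cl f g by (intro Pi_I add.m_closed) blast+
      fix s assume "s \<in> ?A"
      then have "s \<in> carrier G" using ck by blast
      then show "k s \<otimes> (f \<oplus>\<^bsub>?RG\<^esub> g) (inv\<^bsub>G\<^esub> s \<otimes>\<^bsub>G\<^esub> x)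
        = k s \<otimes> f (inv\<^bsub>G\<^esub> s \<otimes>\<^bsub>G\<^esub> x) \<oplus> k s \<otimes> g (inv\<^bsub>G\<^esub> s \<otimes>\<^bsub>G\<^esub> x)"
        using cf(1) cg(1) ck(1) x by (simp add: gr_add_apply r_distr)
    qed simp
    also have "\<dots> = (\<Oplus>s\<in>?A. k s \<otimes> f (inv\<^bsub>G\<^esub> s \<otimes>\<^bsub>G\<^esub> x)) \<oplus> (\<Oplus>s\<in>?A. k s \<otimes> g (inv\<^bsub>G\<^esub> s \<otimes>\<^bsub>G\<^esub> x))"
      using cl f g by (intro finsum_addf Pi_I) blast+
    finally show "(k \<otimes>\<^bsub>?RG\<^esub> (f \<oplus>\<^bsub>?RG\<^esub> g)) x = (k \<otimes>\<^bsub>?RG\<^esub> f \<oplus>\<^bsub>?RG\<^esub> k \<otimes>\<^bsub>?RG\<^esub> g) x"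
      using x gr_mult_eq[OF k f ck(2) order_refl ck(4) x] gr_mult_eq[OF k g ck(2) order_refl ck(4) x]
      by (simp add: gr_add_apply)
  qed (use f g k gr_mult_closed gr_add_closed in auto)
qed

end

end

theory Submission
  imports Defs
begin

text \<open>
  If \<open>RG\<close> is regular and \<open>S \<subseteq> G\<close> is finite, successive multiplication by elements \<open>1 - y z\<close> with
  \<open>z y z = z\<close> produces an element of augmentation \<open>1\<close> fixed by left multiplication with \<open>S\<close>. It is
  constant on the cosets of \<open>\<langle>S\<rangle>\<close>; finiteness of its support makes \<open>\<langle>S\<rangle>\<close> finite, and for \<open>S = {g}\<close>
  the augmentation is a multiple of the order of \<open>g\<close>.

  For the converse one may take \<open>G\<close> finite with invertible order. McCoy's lemma and averaging over \<open>G\<close>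
  make \<open>RG\<close> von Neumann regular. A prime ideal of \<open>RG\<close> contracts to a prime ideal of \<open>R\<close>, so the
  prime factors of \<open>RG\<close> are noetherian and contain no infinite sequence of nonzero orthogonal
  idempotents. This alone forces unit-regularity: if \<open>a\<close> is not unit-regular, pass to the quotient \<open>T\<close>
  by an ideal maximal among those modulo which \<open>a\<close> still fails. Then \<open>T\<close> has no nontrivial central idempotents.
  Splitting off isomorphic copies of smaller and smaller idempotents must stop, since otherwise a
  prime ideal avoiding them all would contradict the hypothesis; where it stops one finds central
  idempotents inside every nonzero ideal, so \<open>T\<close> is simple. In \<open>T\<close> one extends \<open>a\<close> by orthogonal
  pieces until it becomes one-sided, hence two-sided, invertible.
\<close>

section \<open>Regular rings whose prime factors have no infinite orthogonal families\<close>

text \<open>A prime ideal can be found that avoids a decreasing sequence of nonzero idempotents,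
  whereas the finiteness hypothesis speaks of orthogonal sequences. Splitting off copies links the
  two: if \<open>x y\<close> is the piece split off and \<open>y x\<close> the idempotent kept, then
  \<open>y x = y (x y) x\<close>, so a piece inside \<open>P\<close> would drag the kept idempotent
  into \<open>P\<close>.

  The splitting process is run twice. Started at \<open>1\<close>, its end state provides an
  idempotent whose corner has only central idempotents. Started at such an idempotent, its end state
  provides central covers: every piece is a copy of a subidempotent of the start, so an idempotent
  \<open>h\<close> below the last one can be transported to each piece, and on \<open>R h\<close>
  the sum of the pieces acts like the sum of the transported copies.

  Maximality of the ideal excludes central idempotents because a nontrivial one would split
  \<open>T\<close> into two proper quotients; the unit inner inverses of \<open>a\<close> in them
  glue. Averaging over the group is forced since McCoy's lemma yields an inner inverse that is
  linear over \<open>R\<close> only, not over \<open>RG\<close>.\<close>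

locale vn_regular_ring = ring R for R (structure) +
  assumes vn_regular: "a \<in> carrier R \<Longrightarrow> \<exists>b\<in>carrier R. a \<otimes> b \<otimes> a = a"

text \<open>Idempotence and orthogonality are demanded for elements of \<open>R\<close> modulo
  \<open>P\<close>. In this form the condition passes to quotients by pulling the prime ideal back,
  without lifting idempotents.\<close>

locale orth_finite_vn_regular_ring = vn_regular_ring R for R (structure) +
  assumes orth_finite: "\<lbrakk>nc_prime_ideal P R; \<And>n::nat. h n \<in> carrier R; \<And>n. h n \<otimes> h n \<ominus> h n \<in> P;
    \<And>m n. m \<noteq> n \<Longrightarrow> h m \<otimes> h n \<in> P\<rbrakk> \<Longrightarrow> \<exists>n. h n \<in> P"

section \<open>Idempotents and orthogonal sequences\<close>

context ring
begin

lemma minus_self [simp]: "a \<in> carrier R \<Longrightarrow> a \<ominus> a = \<zero>"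
  by (simp add: minus_eq r_neg)

lemma minus_zero_eq [simp]: "a \<in> carrier R \<Longrightarrow> a \<ominus> \<zero> = a"
  by (simp add: minus_eq)

lemma minus_eq_zero_iff: "\<lbrakk>a \<in> carrier R; b \<in> carrier R\<rbrakk> \<Longrightarrow> a \<ominus> b = \<zero> \<longleftrightarrow> a = b"
  by (metis r_right_minus_eq)

lemma l_distr_minus: "\<lbrakk>a \<in> carrier R; b \<in> carrier R; c \<in> carrier R\<rbrakk> \<Longrightarrow> (a \<ominus> b) \<otimes> c = a \<otimes> c \<ominus> b \<otimes> c"
  by (simp add: minus_eq l_distr l_minus)

lemma r_distr_minus: "\<lbrakk>a \<in> carrier R; b \<in> carrier R; c \<in> carrier R\<rbrakk> \<Longrightarrow> c \<otimes> (a \<ominus> b) = c \<otimes> a \<ominus> c \<otimes> b"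
  by (simp add: minus_eq r_distr r_minus)

lemmas nc_distr = l_distr r_distr l_distr_minus r_distr_minus

definition idem :: "'a \<Rightarrow> bool" where "idem f \<longleftrightarrow> f \<in> carrier R \<and> f \<otimes> f = f"

definition below :: "'a \<Rightarrow> 'a \<Rightarrow> bool"
  where "below f e \<longleftrightarrow> idem f \<and> f \<otimes> e = f \<and> e \<otimes> f = f"

lemma idem_closed: "idem f \<Longrightarrow> f \<in> carrier R" by (simp add: idem_def)

lemma below_trans:
  assumes "below a b" "below b c" "c \<in> carrier R"
  shows "below a c"
proof -
  have a: "a \<in> carrier R" "b \<in> carrier R" using assms by (auto simp: below_def idem_def)
  have "a \<otimes> c = a \<otimes> b \<otimes> c" using assms by (simp add: below_def)
  also have "\<dots> = a" using assms a by (metis below_def m_assoc)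
  finally have 1: "a \<otimes> c = a" .
  have "c \<otimes> a = c \<otimes> (b \<otimes> a)" using assms by (simp add: below_def)
  also have "\<dots> = a" using assms a by (metis below_def m_assoc)
  finally show ?thesis using 1 assms by (simp add: below_def)
qed

lemma below_refl: "idem e \<Longrightarrow> below e e" by (simp add: below_def idem_def)

lemma idem_compl:
  assumes "idem e" "idem f" "e \<otimes> f = \<zero>" "f \<otimes> e = \<zero>"
  shows "idem (\<one> \<ominus> e \<ominus> f)"
  using assms by (simp add: idem_def nc_distr)

text \<open>The partial sum \<open>s n\<close> acts as a two-sided identity on all earlier
  increments, so \<open>h n h m = h n (s n h m) = 0\<close> for \<open>m < n\<close>. Orthogonality
  of a whole sequence is thereby reduced to orthogonality of each term to the sum before it.\<close>

lemma orthogonal_increments: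
  assumes s: "\<And>n::nat. s n \<in> carrier R" and h: "\<And>n. h n \<in> carrier R" "\<And>n. h n \<otimes> h n = h n"
    and S: "\<And>n. s (Suc n) = s n \<oplus> h n" and z: "\<And>n. s n \<otimes> h n = \<zero>" "\<And>n. h n \<otimes> s n = \<zero>"
    and mn: "m \<noteq> n"
  shows "h m \<otimes> h n = \<zero>"
proof -
  have 1: "s n \<otimes> h m = h m \<and> h m \<otimes> s n = h m" if "m < n" for m n
    using that
  proof (induction n)
    case (Suc n)
    show ?case
    proof (cases "m = n")
      case True
      then show ?thesis using s h z by (simp add: S l_distr r_distr)
    next
      case False
      with Suc have IH: "s n \<otimes> h m = h m" "h m \<otimes> s n = h m" by auto
      have "h n \<otimes> h m = \<zero>" using IH(1) s h z by (metis m_assoc l_null)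
      moreover have "h m \<otimes> h n = \<zero>" using IH(2) s h z by (metis m_assoc r_null)
      ultimately show ?thesis using IH s h by (simp add: S l_distr r_distr)
    qed
  qed simp
  show ?thesis
  proof (cases "m < n")
    case True
    then show ?thesis using 1[OF True] s h z by (metis m_assoc r_null)
  next
    case False
    then show ?thesis using 1[of n m] mn s h z by (metis linorder_neqE_nat m_assoc l_null)
  qed
qed

section \<open>Prime ideals avoiding a sequence, and annihilator ideals\<close>

lemma Union_chain_ideal:
  assumes "\<C> \<noteq> {}" "subset.chain {I. ideal I R} \<C>"
  shows "ideal (\<Union>\<C>) R"
  using chain_Union_is_ideal[OF assms(2)] assms(1) by simp

text \<open>An ideal maximal among those avoiding all \<open>F n\<close> is prime. The decreasing
  idempotents replace the multiplicative set of the commutative argument.\<close>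

lemma prime_avoiding:
  assumes F: "\<And>n::nat. idem (F n)" "\<And>n. F n \<noteq> \<zero>" "\<And>n. below (F (Suc n)) (F n)"
  shows "\<exists>P. nc_prime_ideal P R \<and> (\<forall>n. F n \<notin> P)"
proof -
  have Fc: "F n \<in> carrier R" for n using F(1) idem_closed by blast
  have dec: "below (F (m + k)) (F m)" for m k
  proof (induction k)
    case 0
    then show ?case using F(1) by (simp add: below_refl)
  next
    case (Suc k)
    then show ?case using F(3)[of "m + k"] below_trans[OF _ _ Fc] by simp
  qed
  define \<A> where "\<A> = {I. ideal I R \<and> (\<forall>n. F n \<notin> I)}"
  have "\<exists>M\<in>\<A>. \<forall>K\<in>\<A>. M \<subseteq> K \<longrightarrow> K = M"
  proof (rule subset_Zorn_nonempty)
    show "\<A> \<noteq> {}" using zeroideal F(2) by (auto simp: \<A>_def)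
    fix \<C> assume C: "\<C> \<noteq> {}" "subset.chain \<A> \<C>"
    then have "subset.chain {I. ideal I R} \<C>" by (auto simp: subset.chain_def \<A>_def)
    with C show "\<Union>\<C> \<in> \<A>" using Union_chain_ideal[OF C(1)] by (auto simp: subset.chain_def \<A>_def)
  qed
  then obtain P where P: "ideal P R" "\<And>n. F n \<notin> P"
    and max: "\<And>K. ideal K R \<Longrightarrow> (\<And>n. F n \<notin> K) \<Longrightarrow> P \<subseteq> K \<Longrightarrow> K = P" by (auto simp: \<A>_def)
  interpret P: ideal P R by (rule P(1))
  have big: "\<exists>n. \<exists>p\<in>P. \<exists>i\<in>I. F n = p \<oplus> i" if I: "ideal I R" "\<not> I \<subseteq> P" for I
  proof -
    interpret I: ideal I R by (rule I(1))
    have "ideal (P <+> I) R" using P(1) I(1) by (rule add_ideals)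
    moreover have "P \<subseteq> P <+> I"
    proof
      fix p assume p: "p \<in> P"
      then have "p = p \<oplus> \<zero>" using P.Icarr by simp
      then show "p \<in> P <+> I" using p I.zero_closed unfolding set_add_def' by blast
    qed
    moreover have "P <+> I \<noteq> P"
    proof
      assume eq: "P <+> I = P"
      obtain i where i: "i \<in> I" "i \<notin> P" using I by blast
      have "i = \<zero> \<oplus> i" using i I.Icarr by simp
      then have "i \<in> P <+> I" using i P.zero_closed unfolding set_add_def' by blast
      then show False using eq i by simp
    qed
    ultimately obtain n where "F n \<in> P <+> I" using max by blast
    then show ?thesis unfolding set_add_def' by auto
  qed
  have "nc_prime_ideal P R"
  proof (unfold_locales)
    show "P \<noteq> carrier R" using P(2) Fc by blast
    fix I J assume I: "ideal I R" and J: "ideal J R" and IJ: "I \<cdot> J \<subseteq> P"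
    show "I \<subseteq> P \<or> J \<subseteq> P"
    proof (rule ccontr)
      assume "\<not> ?thesis"
      then obtain m p i n q j where m: "p \<in> P" "i \<in> I" "F m = p \<oplus> i" and n: "q \<in> P" "j \<in> J" "F n = q \<oplus> j"
        using big[OF I] big[OF J] by blast
      interpret I: ideal I R by (rule I)
      interpret J: ideal J R by (rule J)
      have c: "p \<in> carrier R" "i \<in> carrier R" "q \<in> carrier R" "j \<in> carrier R"
        using m n P.Icarr I.Icarr J.Icarr by auto
      \<comment> \<open>A common lower bound of \<open>F m\<close> and \<open>F n\<close>:
        multiplying \<open>F m F n\<close> by it on both sides gives it back, so it would lie in
        \<open>P\<close>.\<close>
      let ?k = "F (m + n)"
      have k: "?k \<otimes> F m = ?k" "F n \<otimes> ?k = ?k" "?k \<otimes> ?k = ?k"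
        using dec[of m n] dec[of n m, unfolded Groups.add.commute[of n m]] F(1)[of "m + n"]
        unfolding below_def idem_def by blast+
      have "i \<otimes> j \<in> P" using ideal_prod.prod[OF m(2) n(2), of R] IJ by blast
      moreover have "F m \<otimes> F n = p \<otimes> (q \<oplus> j) \<oplus> (i \<otimes> q \<oplus> i \<otimes> j)"
        unfolding m(3) n(3) using c by (simp add: nc_distr a_ac)
      ultimately have "F m \<otimes> F n \<in> P"
        using P.I_r_closed[OF m(1), of "q \<oplus> j"] P.I_l_closed[OF n(1) c(2)] c by (simp add: P.a_closed)
      then have "?k \<otimes> (F m \<otimes> F n) \<otimes> ?k \<in> P" using Fc P.I_l_closed P.I_r_closed by simp
      moreover have "?k \<otimes> (F m \<otimes> F n) \<otimes> ?k = (?k \<otimes> F m) \<otimes> (F n \<otimes> ?k)"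
        using Fc by (simp add: m_assoc)
      ultimately show False using k P(2) by simp
    qed
  qed
  with P show ?thesis by blast
qed

lemma idealI_closed:
  assumes "I \<subseteq> carrier R" "\<zero> \<in> I" "\<And>a b. a \<in> I \<Longrightarrow> b \<in> I \<Longrightarrow> a \<oplus> b \<in> I"
    "\<And>a x. a \<in> I \<Longrightarrow> x \<in> carrier R \<Longrightarrow> x \<otimes> a \<in> I" "\<And>a x. a \<in> I \<Longrightarrow> x \<in> carrier R \<Longrightarrow> a \<otimes> x \<in> I"
  shows "ideal I R"
proof (rule idealI[OF ring_axioms])
  show "subgroup I (add_monoid R)"
  proof (rule add.subgroupI)
    fix a assume a: "a \<in> I"
    have "\<ominus> \<one> \<otimes> a = \<ominus> a" using a assms(1) by (simp add: l_minus subsetD)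
    then show "\<ominus> a \<in> I" using assms(4)[OF a, of "\<ominus> \<one>"] by simp
  qed (use assms in auto)
qed (use assms in auto)

text \<open>The free factor \<open>t\<close> in the middle makes the annihilator two-sided. Hence
  \<open>a R h = 0\<close> for a single \<open>h\<close> extends to the whole ideal generated by
  \<open>h\<close>.\<close>

lemma ideal_middle_annihilator:
  assumes "a \<in> carrier R"
  shows "ideal {z \<in> carrier R. \<forall>t\<in>carrier R. a \<otimes> t \<otimes> z = \<zero>} R"
proof (rule idealI_closed)
  let ?I = "{z \<in> carrier R. \<forall>t\<in>carrier R. a \<otimes> t \<otimes> z = \<zero>}"
  fix z x assume z: "z \<in> ?I" and x: "x \<in> carrier R"
  then have zc: "z \<in> carrier R" by simp
  have "a \<otimes> t \<otimes> (x \<otimes> z) = \<zero>" if t: "t \<in> carrier R" for t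
  proof -
    have "a \<otimes> t \<otimes> (x \<otimes> z) = a \<otimes> (t \<otimes> x) \<otimes> z" using assms t x zc by (simp add: m_assoc)
    then show ?thesis using z t x by simp
  qed
  then show "x \<otimes> z \<in> ?I" using zc x by simp
  have "a \<otimes> t \<otimes> (z \<otimes> x) = \<zero>" if t: "t \<in> carrier R" for t
  proof -
    have "a \<otimes> t \<otimes> (z \<otimes> x) = a \<otimes> t \<otimes> z \<otimes> x" using assms t x zc by (simp add: m_assoc)
    then show ?thesis using z t x by simp
  qed
  then show "z \<otimes> x \<in> ?I" using zc x by simp
qed (use assms in \<open>auto simp: r_distr\<close>)

section \<open>Splitting off copies of idempotents, and central covers\<close>

text \<open>In a state \<open>(f, s)\<close> the idempotent \<open>s\<close> is the sum of the orthogonal idempotents split off so far and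
  \<open>f\<close> is orthogonal to \<open>s\<close>. A step splits off \<open>x y\<close> and shrinks \<open>f\<close> to the isomorphic idempotent \<open>y x\<close>.\<close>

definition split_step :: "'a \<Rightarrow> 'a \<Rightarrow> 'a \<Rightarrow> 'a \<Rightarrow> bool"
  where "split_step f s x y \<longleftrightarrow> x \<in> carrier R \<and> y \<in> carrier R \<and> x \<otimes> y \<otimes> x = x \<and> y \<otimes> x \<otimes> y = y \<and> x \<noteq> \<zero> \<and>
    below (y \<otimes> x) f \<and> s \<otimes> (x \<otimes> y) = \<zero> \<and> x \<otimes> y \<otimes> s = \<zero> \<and>
    x \<otimes> y \<otimes> (y \<otimes> x) = \<zero> \<and> y \<otimes> x \<otimes> (x \<otimes> y) = \<zero>"

text \<open>A nonzero element of some corner \<open>(1 - s - f') R f'\<close> is exactly the raw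
  material for a further step; here all these corners vanish.\<close>

definition terminal :: "'a \<Rightarrow> 'a \<Rightarrow> bool"
  where "terminal f s \<longleftrightarrow> (\<forall>f' t. below f' f \<longrightarrow> t \<in> carrier R \<longrightarrow> (\<one> \<ominus> s \<ominus> f') \<otimes> t \<otimes> f' = \<zero>)"

text \<open>Applied to \<open>f\<close> and to \<open>e - f\<close>, the condition says that every
  idempotent of the corner ring \<open>e R e\<close> is central in it.\<close>

definition abelian_idem :: "'a \<Rightarrow> bool"
  where "abelian_idem e \<longleftrightarrow> idem e \<and> (\<forall>f t. below f e \<longrightarrow> t \<in> carrier R \<longrightarrow> (e \<ominus> f) \<otimes> t \<otimes> f = \<zero>)"

inductive reach :: "'a \<Rightarrow> 'a \<Rightarrow> 'a \<Rightarrow> bool" for e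
  where base: "reach e e \<zero>"
  | step: "\<lbrakk>reach e f s; split_step f s x y\<rbrakk> \<Longrightarrow> reach e (y \<otimes> x) (s \<oplus> x \<otimes> y)"

lemma split_step_idem:
  assumes "split_step f s x y"
  shows "x \<otimes> y \<in> carrier R" "x \<otimes> y \<otimes> (x \<otimes> y) = x \<otimes> y" "y \<otimes> x \<in> carrier R" "y \<otimes> x \<otimes> (y \<otimes> x) = y \<otimes> x"
    "y \<otimes> x \<noteq> \<zero>"
proof -
  have c: "x \<in> carrier R" "y \<in> carrier R" "x \<otimes> y \<otimes> x = x" "y \<otimes> x \<otimes> y = y" "x \<noteq> \<zero>"
    using assms by (auto simp: split_step_def)
  show "x \<otimes> y \<in> carrier R" "y \<otimes> x \<in> carrier R" using c by auto
  show "x \<otimes> y \<otimes> (x \<otimes> y) = x \<otimes> y" using c by (metis m_assoc m_closed)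
  show "y \<otimes> x \<otimes> (y \<otimes> x) = y \<otimes> x" using c by (metis m_assoc m_closed)
  show "y \<otimes> x \<noteq> \<zero>" using c by (metis m_assoc r_null)
qed

lemma reach_state:
  assumes "reach e f s" "idem e" "e \<noteq> \<zero>"
  shows "below f e \<and> f \<noteq> \<zero> \<and> idem s \<and> s \<otimes> f = \<zero> \<and> f \<otimes> s = \<zero>"
  using assms
proof (induction rule: reach.induct)
  case base
  then show ?case by (simp add: below_refl) (simp add: idem_def)
next
  case (step f s x y)
  note st = split_step_idem[OF step.hyps(2)]
  have IH: "below f e" "idem s" "s \<otimes> f = \<zero>" "f \<otimes> s = \<zero>" using step by auto
  have b: "below (y \<otimes> x) f" "s \<otimes> (x \<otimes> y) = \<zero>" "x \<otimes> y \<otimes> s = \<zero>"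
    "x \<otimes> y \<otimes> (y \<otimes> x) = \<zero>" "y \<otimes> x \<otimes> (x \<otimes> y) = \<zero>"
    using step.hyps(2) by (auto simp: split_step_def)
  have c: "f \<in> carrier R" "s \<in> carrier R" "e \<in> carrier R" "s \<otimes> s = s"
    using IH step.prems by (auto simp: below_def idem_def)
  have fy: "y \<otimes> x = f \<otimes> (y \<otimes> x)" "y \<otimes> x = y \<otimes> x \<otimes> f" using b(1) by (auto simp: below_def)
  have 1: "s \<otimes> (y \<otimes> x) = \<zero>" "y \<otimes> x \<otimes> s = \<zero>"
    using fy IH(3,4) c st(3) by (metis m_assoc l_null, metis m_assoc r_null)
  show ?case
    using below_trans[OF b(1) IH(1) c(3)] st 1 b c unfolding idem_def
    by (simp only: l_distr r_distr m_closed a_closed r_zero l_zero zero_closed simp_thms)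
qed

text \<open>Each piece split off is isomorphic to a subidempotent of \<open>e\<close> that lies
  above \<open>h\<close>, so it contains a copy of \<open>h\<close>. The element \<open>g\<close> is
  the sum of these copies; it lies in the ideal of \<open>h\<close> and agrees with \<open>s\<close>
  on \<open>R h\<close>.\<close>

lemma reach_cover:
  assumes "reach e f s" "abelian_idem e" "e \<noteq> \<zero>" "below h f"
  shows "\<exists>g\<in>Idl {h}. \<forall>t\<in>carrier R. (s \<ominus> g) \<otimes> t \<otimes> h = \<zero>"
  using assms
proof (induction arbitrary: h rule: reach.induct)
  case base
  then have "h \<in> carrier R" by (simp add: below_def idem_def)
  then show ?case
    using genideal_ideal[of "{h}"] by (intro bexI[of _ "\<zero>"]) (auto simp: ideal_def additive_subgroup.zero_closed)
next
  case (step f s x y)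
  note st = split_step_idem[OF step.hyps(2)]
  have e: "idem e" "e \<in> carrier R" using step.prems by (auto simp: abelian_idem_def idem_def)
  have s: "below f e" "f \<in> carrier R" "s \<in> carrier R"
    using reach_state[OF step.hyps(1) e(1) step.prems(2)] by (auto simp: below_def idem_def)
  have x: "x \<in> carrier R" "y \<in> carrier R" "x \<otimes> y \<otimes> x = x" "below (y \<otimes> x) f"
    using step.hyps(2) by (auto simp: split_step_def)
  have h: "h \<in> carrier R" "y \<otimes> x \<otimes> h = h" using step.prems(3) by (auto simp: below_def idem_def)
  have hf: "below h f" using below_trans[OF step.prems(3) x(4) s(2)] .
  have he: "below h e" using below_trans[OF hf s(1) e(2)] .
  have ye: "y \<otimes> x \<otimes> e = y \<otimes> x" using below_trans[OF x(4) s(1) e(2)] by (simp add: below_def)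
  interpret J: ideal "Idl {h}" R using genideal_ideal h by simp
  obtain g where g: "g \<in> Idl {h}" "\<And>t. t \<in> carrier R \<Longrightarrow> (s \<ominus> g) \<otimes> t \<otimes> h = \<zero>"
    using step.IH[OF step.prems(1,2) hf] by blast
  have gc: "g \<in> carrier R" using g J.Icarr by blast
  have "h \<in> Idl {h}" using genideal_self' h by blast
  \<comment> \<open>The new piece \<open>x y\<close> contributes the copy \<open>x h y\<close>. The
    difference \<open>x (y x - h) y\<close> annihilates \<open>R h\<close>, because
    \<open>y x - h\<close> has the right factor \<open>e - h\<close> and \<open>e\<close> is
    abelian.\<close>
  then have "g \<oplus> x \<otimes> h \<otimes> y \<in> Idl {h}" using g x J.I_l_closed J.I_r_closed J.a_closed by simp
  moreover have "(s \<oplus> x \<otimes> y \<ominus> (g \<oplus> x \<otimes> h \<otimes> y)) \<otimes> t \<otimes> h = \<zero>" if t: "t \<in> carrier R" for t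
  proof -
    have z: "(e \<ominus> h) \<otimes> (y \<otimes> t) \<otimes> h = \<zero>"
      using step.prems(1) he t x by (simp add: abelian_idem_def)
    have "y \<otimes> x \<ominus> h = y \<otimes> x \<otimes> (e \<ominus> h)" using st e h x ye by (simp add: r_distr_minus)
    then have "(y \<otimes> x \<ominus> h) \<otimes> (y \<otimes> t) \<otimes> h = y \<otimes> x \<otimes> ((e \<ominus> h) \<otimes> (y \<otimes> t) \<otimes> h)"
      using st e h x t by (simp add: m_assoc)
    then have z2: "(y \<otimes> x \<ominus> h) \<otimes> (y \<otimes> t) \<otimes> h = \<zero>" using z st by simp
    have "x \<otimes> y = x \<otimes> (y \<otimes> x) \<otimes> y" using x by (metis m_assoc m_closed)
    then have "s \<oplus> x \<otimes> y \<ominus> (g \<oplus> x \<otimes> h \<otimes> y) = (s \<ominus> g) \<oplus> x \<otimes> (y \<otimes> x \<ominus> h) \<otimes> y"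
      using s gc x h by (simp add: nc_distr) algebra
    then have "(s \<oplus> x \<otimes> y \<ominus> (g \<oplus> x \<otimes> h \<otimes> y)) \<otimes> t \<otimes> h
        = (s \<ominus> g) \<otimes> t \<otimes> h \<oplus> x \<otimes> ((y \<otimes> x \<ominus> h) \<otimes> (y \<otimes> t) \<otimes> h)"
      using s gc x h t by (simp add: l_distr m_assoc)
    then show ?thesis using z2 g t x by simp
  qed
  ultimately show ?case by blast
qed

end

context vn_regular_ring
begin

text \<open>Regularity inside a corner: cutting an inner inverse of \<open>x\<close> down by
  \<open>f\<close> and \<open>p\<close> does not disturb \<open>x\<close>, and yields an isomorphism
  between an idempotent below \<open>p\<close> and one below \<open>f\<close>.\<close>

lemma corner_split:
  assumes p: "idem p" and f: "idem f" and t: "t \<in> carrier R" and nz: "p \<otimes> t \<otimes> f \<noteq> \<zero>"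
  obtains x y where "x \<in> carrier R" "y \<in> carrier R" "x \<otimes> y \<otimes> x = x" "y \<otimes> x \<otimes> y = y" "x \<noteq> \<zero>"
    "p \<otimes> x = x" "x \<otimes> f = x" "f \<otimes> y = y" "y \<otimes> p = y" "x = p \<otimes> t \<otimes> f"
proof -
  define x where "x = p \<otimes> t \<otimes> f"
  have c: "p \<in> carrier R" "f \<in> carrier R" "p \<otimes> p = p" "f \<otimes> f = f" using p f by (auto simp: idem_def)
  then have x: "x \<in> carrier R" "p \<otimes> x = x" "x \<otimes> f = x"
    using t unfolding x_def by (auto simp: m_assoc) (simp add: m_assoc[symmetric])
  obtain b where b: "b \<in> carrier R" "x \<otimes> b \<otimes> x = x" using vn_regular x by blast
  define z where "z = f \<otimes> b \<otimes> p"
  have z: "z \<in> carrier R" "f \<otimes> z = z" "z \<otimes> p = z"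
    using c b unfolding z_def by (auto simp: m_assoc) (simp add: m_assoc[symmetric])
  have "x \<otimes> z \<otimes> x = (x \<otimes> f) \<otimes> b \<otimes> (p \<otimes> x)"
    using c(1,2) b(1) x(1) unfolding z_def by (simp add: m_assoc)
  then have xzx: "x \<otimes> z \<otimes> x = x" using x b by simp
  \<comment> \<open>Passing from \<open>z\<close> to \<open>z x z\<close> makes \<open>x\<close> and
    \<open>y\<close> inner inverses of each other.\<close>
  define y where "y = z \<otimes> x \<otimes> z"
  have y: "y \<in> carrier R" "f \<otimes> y = y"
    using x(1) z c unfolding y_def by (auto simp: m_assoc[of z, symmetric]) (metis m_assoc m_closed)
  have yp: "y \<otimes> p = y" using x z c unfolding y_def by (simp add: m_assoc)
  have xy: "x \<otimes> y = x \<otimes> z" using x z xzx unfolding y_def by (metis m_assoc m_closed)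
  have xyx: "x \<otimes> y \<otimes> x = x" using xy xzx by simp
  have "y \<otimes> x \<otimes> y = z \<otimes> (x \<otimes> z \<otimes> x) \<otimes> y" using x z y unfolding y_def by (simp add: m_assoc)
  then have yxy: "y \<otimes> x \<otimes> y = y" using xzx xy x z y y_def by (metis m_assoc)
  have "x \<noteq> \<zero>" using nz x_def by simp
  from that[OF x(1) y(1) xyx yxy this x(2,3) y(2) yp x_def] show thesis .
qed

text \<open>A nonzero element of \<open>(1 - s - g) R g\<close> gives \<open>x y\<close> below
  \<open>1 - s - g\<close> and \<open>y x\<close> below \<open>g\<close>. Since
  \<open>1 - s - g\<close> is orthogonal to both \<open>s\<close> and \<open>g\<close>, all
  orthogonality relations of a step follow.\<close>

lemma not_terminal_split_step:
  assumes f: "idem f" and s: "idem s" and o: "s \<otimes> f = \<zero>" "f \<otimes> s = \<zero>" and nt: "\<not> terminal f s"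
  shows "\<exists>x y. split_step f s x y"
proof -
  obtain g t where g: "below g f" "t \<in> carrier R" "(\<one> \<ominus> s \<ominus> g) \<otimes> t \<otimes> g \<noteq> \<zero>"
    using nt by (auto simp: terminal_def)
  have c: "f \<in> carrier R" "s \<in> carrier R" "g \<in> carrier R" "s \<otimes> s = s" "g \<otimes> g = g" "idem g" "g \<otimes> f = g" "f \<otimes> g = g"
    using f s g by (auto simp: idem_def below_def)
  have sg: "s \<otimes> g = \<zero>" "g \<otimes> s = \<zero>" using o c by (metis m_assoc l_null, metis m_assoc r_null)
  let ?p = "\<one> \<ominus> s \<ominus> g"
  have p: "idem ?p" using idem_compl[OF s c(6) sg] .
  obtain x y where x: "x \<in> carrier R" "y \<in> carrier R" "x \<otimes> y \<otimes> x = x" "y \<otimes> x \<otimes> y = y" "x \<noteq> \<zero>"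
    "?p \<otimes> x = x" "x \<otimes> g = x" "g \<otimes> y = y" "y \<otimes> ?p = y"
    by (rule corner_split[OF p c(6) g(2,3)], rule that)
  have pz: "s \<otimes> ?p = \<zero>" "?p \<otimes> s = \<zero>" "g \<otimes> ?p = \<zero>" "?p \<otimes> g = \<zero>"
    using c sg by (simp_all add: nc_distr)
  have pc: "?p \<in> carrier R" using c by simp
  have "s \<otimes> x = \<zero>" using pz(1) x pc c by (metis m_assoc l_null)
  then have 1: "s \<otimes> (x \<otimes> y) = \<zero>" using x c by (metis m_assoc l_null)
  have "y \<otimes> s = \<zero>" using pz(2) x pc c by (metis m_assoc r_null)
  then have 2: "x \<otimes> y \<otimes> s = \<zero>" using x c by (metis m_assoc r_null)
  have "y \<otimes> y = y \<otimes> (?p \<otimes> g) \<otimes> y" using x pc c by (metis m_assoc m_closed)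
  then have yy: "y \<otimes> y = \<zero>" using pz x by simp
  then have 3: "x \<otimes> y \<otimes> (y \<otimes> x) = \<zero>" using x by (metis m_assoc m_closed l_null r_null)
  have "x \<otimes> x = x \<otimes> (g \<otimes> ?p) \<otimes> x" using x pc c by (metis m_assoc m_closed)
  then have xx: "x \<otimes> x = \<zero>" using pz x by simp
  then have 4: "y \<otimes> x \<otimes> (x \<otimes> y) = \<zero>" using x by (metis m_assoc m_closed l_null r_null)
  have "y \<otimes> x \<otimes> (y \<otimes> x) = y \<otimes> x" "y \<otimes> x \<otimes> g = y \<otimes> x" "g \<otimes> (y \<otimes> x) = y \<otimes> x"
    using x c by (metis m_assoc m_closed)+
  then have "below (y \<otimes> x) g" using x by (simp add: below_def idem_def)
  then have "below (y \<otimes> x) f" using below_trans g(1) c(1) by blast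
  then have "split_step f s x y" using x 1 2 3 4 unfolding split_step_def by (intro conjI)
  then show ?thesis by blast
qed

text \<open>A central idempotent covering \<open>h\<close>: it is a left identity of the ideal generated by \<open>h\<close>, and
  by regularity also a right identity.\<close>

lemma central_cover:
  assumes e: "abelian_idem e" "e \<noteq> \<zero>" and r: "reach e f s" and t: "terminal f s" and h: "below h f"
  shows "\<exists>c\<in>Idl {h}. c \<otimes> h = h \<and> c \<otimes> c = c \<and> (\<forall>t\<in>carrier R. c \<otimes> t = t \<otimes> c)"
proof -
  have hc: "h \<in> carrier R" using h by (simp add: below_def idem_def)
  have sc: "s \<in> carrier R" using reach_state[OF r _ e(2)] e by (simp add: abelian_idem_def idem_def)
  interpret J: ideal "Idl {h}" R using genideal_ideal hc by simp
  obtain g where g: "g \<in> Idl {h}" "\<And>t. t \<in> carrier R \<Longrightarrow> (s \<ominus> g) \<otimes> t \<otimes> h = \<zero>"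
    using reach_cover[OF r e h] by blast
  \<comment> \<open>Terminality gives \<open>(1 - s - h) R h = 0\<close> and the choice of
    \<open>g\<close> gives \<open>(s - g) R h = 0\<close>; adding them yields
    \<open>(1 - c) R h = 0\<close>.\<close>
  define c where "c = g \<oplus> h"
  have hI: "h \<in> Idl {h}" using genideal_self' hc by blast
  have c: "c \<in> Idl {h}" using g hI J.a_closed by (simp add: c_def)
  have gc: "g \<in> carrier R" and cc: "c \<in> carrier R" using g c J.Icarr by auto
  have z: "(\<one> \<ominus> c) \<otimes> t \<otimes> h = \<zero>" if tc: "t \<in> carrier R" for t
  proof -
    have "\<one> \<ominus> c = (\<one> \<ominus> s \<ominus> h) \<oplus> (s \<ominus> g)" unfolding c_def using sc gc hc by algebra
    then have "(\<one> \<ominus> c) \<otimes> t \<otimes> h = (\<one> \<ominus> s \<ominus> h) \<otimes> t \<otimes> h \<oplus> (s \<ominus> g) \<otimes> t \<otimes> h"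
      using sc gc hc tc by (simp add: l_distr)
    then show ?thesis using g(2)[OF tc] t h tc by (simp add: terminal_def)
  qed
  have "Idl {h} \<subseteq> {z \<in> carrier R. \<forall>t\<in>carrier R. (\<one> \<ominus> c) \<otimes> t \<otimes> z = \<zero>}"
    using z hc cc by (intro genideal_minimal ideal_middle_annihilator) auto
  then have "(\<one> \<ominus> c) \<otimes> \<one> \<otimes> z = \<zero>" if "z \<in> Idl {h}" for z using that by blast
  then have l0: "(\<one> \<ominus> c) \<otimes> z = \<zero>" if "z \<in> Idl {h}" for z using that cc by (metis minus_closed one_closed r_one)
  have l: "c \<otimes> z = z" if z: "z \<in> Idl {h}" for z
    using l0[OF z] J.Icarr[OF z] cc by (simp add: nc_distr minus_eq_zero_iff)
  \<comment> \<open>With \<open>w = z (1 - c)\<close> and an inner inverse \<open>b\<close> of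
    \<open>w\<close>, the product \<open>w b w = z (1 - c) (b w)\<close> vanishes because
    \<open>c\<close> is a left identity for \<open>b w\<close>; so \<open>w = 0\<close>.\<close>
  have r: "z \<otimes> c = z" if z: "z \<in> Idl {h}" for z
  proof -
    have zc: "z \<in> carrier R" using z J.Icarr by blast
    let ?w = "z \<otimes> (\<one> \<ominus> c)"
    have w: "?w \<in> Idl {h}" "?w \<in> carrier R" using z zc cc J.I_r_closed by auto
    obtain b where b: "b \<in> carrier R" "?w \<otimes> b \<otimes> ?w = ?w" using vn_regular w by blast
    have "b \<otimes> ?w \<in> Idl {h}" using b w J.I_l_closed by simp
    then have "(\<one> \<ominus> c) \<otimes> (b \<otimes> ?w) = \<zero>" by (rule l0)
    moreover have "?w \<otimes> b \<otimes> ?w = z \<otimes> ((\<one> \<ominus> c) \<otimes> (b \<otimes> ?w))" using b zc cc by (simp only: m_assoc m_closed minus_closed one_closed)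
    ultimately have "?w = \<zero>" using b zc by simp
    then show ?thesis using zc cc by (simp add: nc_distr minus_eq_zero_iff)
  qed
  have "c \<otimes> t = t \<otimes> c" if tc: "t \<in> carrier R" for t
  proof -
    have "c \<otimes> t = c \<otimes> t \<otimes> c" using r[of "c \<otimes> t"] c tc J.I_r_closed by simp
    also have "\<dots> = c \<otimes> (t \<otimes> c)" using tc cc by (simp add: m_assoc)
    also have "\<dots> = t \<otimes> c" using l[of "t \<otimes> c"] c tc J.I_l_closed by simp
    finally show ?thesis .
  qed
  then show ?thesis using c l hI by blast
qed

end

text \<open>This permits computing in the factor cut out by a central idempotent \<open>c\<close>
  without forming that factor as a ring.\<close>

lemma (in ring) central_mult_cong:
  assumes c: "c \<in> carrier R" "\<forall>t\<in>carrier R. c \<otimes> t = t \<otimes> c"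
    and u: "u \<in> carrier R" "u' \<in> carrier R" "v \<in> carrier R" "v' \<in> carrier R"
    and eq: "c \<otimes> u = c \<otimes> u'" "c \<otimes> v = c \<otimes> v'"
  shows "c \<otimes> (u \<otimes> v) = c \<otimes> (u' \<otimes> v')"
proof -
  have "c \<otimes> (u \<otimes> v) = u' \<otimes> (c \<otimes> v)" using c u eq(1) by (metis m_assoc)
  also have "\<dots> = c \<otimes> (u' \<otimes> v')" using c u eq(2) by (metis m_assoc)
  finally show ?thesis .
qed

section \<open>Termination of the splitting, and simple rings\<close>

context orth_finite_vn_regular_ring
begin

text \<open>An endless run produces nonzero decreasing idempotents \<open>F n\<close> together with
  an orthogonal sequence of pieces \<open>U n V n\<close>, and these two sequences make
  contradictory demands on a prime ideal avoiding the \<open>F n\<close>.\<close>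

lemma ex_reach_terminal:
  assumes e: "idem e" "e \<noteq> \<zero>"
  shows "\<exists>f s. reach e f s \<and> terminal f s"
proof (rule ccontr)
  assume no: "\<not> ?thesis"
  have st: "\<exists>x y. split_step f s x y" if "reach e f s" for f s
    using reach_state[OF that e] no that not_terminal_split_step[of f s] by (auto simp: below_def)
  \<comment> \<open>A term of the sequence carries the split to be performed next, so that
    consecutive terms are linked by equations.\<close>
  let ?P = "\<lambda>(f, s, x, y). reach e f s \<and> split_step f s x y"
  let ?Q = "\<lambda>(f, s, x, y) (f', s', x', y'). f' = y \<otimes> x \<and> s' = s \<oplus> x \<otimes> y"
  have "\<exists>\<sigma>. \<forall>n::nat. ?P (\<sigma> n) \<and> ?Q (\<sigma> n) (\<sigma> (Suc n))"
  proof (rule dependent_nat_choice)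
    show "\<exists>z. ?P z" using st[OF reach.base] reach.base by auto
    fix z assume z: "?P z"
    obtain f s x y where zz: "z = (f, s, x, y)" by (cases z)
    have "reach e (y \<otimes> x) (s \<oplus> x \<otimes> y)" using z zz reach.step by auto
    then show "\<exists>z'. ?P z' \<and> ?Q z z'" using st unfolding zz by (auto intro!: exI[of _ "y \<otimes> x"])
  qed
  then obtain \<sigma> where "\<forall>n::nat. ?P (\<sigma> n) \<and> ?Q (\<sigma> n) (\<sigma> (Suc n))" ..
  then have \<sigma>: "?P (\<sigma> n)" "?Q (\<sigma> n) (\<sigma> (Suc n))" for n by simp_all
  define F S U V where "F n = fst (\<sigma> n)" and "S n = fst (snd (\<sigma> n))"
    and "U n = fst (snd (snd (\<sigma> n)))" and "V n = snd (snd (snd (\<sigma> n)))" for n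
  have r: "reach e (F n) (S n)" and sp: "split_step (F n) (S n) (U n) (V n)" for n
    using \<sigma>(1)[of n] by (auto simp: F_def S_def U_def V_def split: prod.splits)
  have Fs: "F (Suc n) = V n \<otimes> U n" and Ss: "S (Suc n) = S n \<oplus> U n \<otimes> V n" for n
    using \<sigma>(2)[of n] by (auto simp: F_def S_def U_def V_def split: prod.splits)
  have F: "idem (F n)" "F n \<noteq> \<zero>" and Sc: "S n \<in> carrier R" for n
    using reach_state[OF r e, of n] by (auto simp: below_def idem_def)
  have sp': "U n \<in> carrier R" "V n \<in> carrier R" "U n \<otimes> V n \<otimes> U n = U n" "below (V n \<otimes> U n) (F n)"
    "S n \<otimes> (U n \<otimes> V n) = \<zero>" "U n \<otimes> V n \<otimes> S n = \<zero>" for n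
    using sp[of n] by (auto simp: split_step_def)
  obtain P where P: "nc_prime_ideal P R" "\<And>n. F n \<notin> P"
    using prime_avoiding[of F] F sp'(4) Fs by auto
  interpret P: nc_prime_ideal P R by (rule P(1))
  have orth: "U m \<otimes> V m \<otimes> (U n \<otimes> V n) = \<zero>" if "m \<noteq> n" for m n
    by (rule orthogonal_increments[of S "\<lambda>n. U n \<otimes> V n", OF Sc _ _ Ss sp'(5,6) that])
      (use split_step_idem[OF sp] in auto)
  have "\<exists>n. U n \<otimes> V n \<in> P"
    by (rule orth_finite[OF P(1)]) (use orth split_step_idem[OF sp] in \<open>auto simp: P.zero_closed\<close>)
  then obtain n where n: "U n \<otimes> V n \<in> P" by blast
  \<comment> \<open>The piece in \<open>P\<close> is isomorphic to the idempotent kept in the next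
    state, which therefore lies in \<open>P\<close> as well.\<close>
  have "V n \<otimes> (U n \<otimes> V n) \<otimes> U n \<in> P" using n sp'(1,2) by (simp add: P.I_l_closed P.I_r_closed)
  moreover have "V n \<otimes> (U n \<otimes> V n) \<otimes> U n = F (Suc n)" using sp'(1,2,3) Fs by (metis m_assoc m_closed)
  ultimately show False using P(2) by simp
qed

text \<open>At a terminal state reached from \<open>1\<close>, orthogonality of \<open>f\<close> and
  \<open>s\<close> gives \<open>f - g = f (1 - s - g)\<close> for \<open>g\<close> below
  \<open>f\<close>, so the vanishing of the outer corner forces that of the corner inside
  \<open>f\<close>.\<close>

lemma ex_abelian_idem:
  assumes "\<one> \<noteq> \<zero>"
  shows "\<exists>e. abelian_idem e \<and> e \<noteq> \<zero>"
proof -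
  have 1: "idem \<one>" by (simp add: idem_def)
  obtain f s where fs: "reach \<one> f s" "terminal f s" using ex_reach_terminal[OF 1 assms] by blast
  have f: "idem f" "f \<noteq> \<zero>" "s \<in> carrier R" "f \<otimes> s = \<zero>"
    using reach_state[OF fs(1) 1 assms] by (auto simp: below_def idem_def)
  have fc: "f \<in> carrier R" "f \<otimes> f = f" using f by (auto simp: idem_def)
  have "(f \<ominus> g) \<otimes> t \<otimes> g = \<zero>" if g: "below g f" and t: "t \<in> carrier R" for g t
  proof -
    have gc: "g \<in> carrier R" "f \<otimes> g = g" using g by (auto simp: below_def idem_def)
    have "f \<ominus> g = f \<otimes> (\<one> \<ominus> s \<ominus> g)" using f fc gc by (simp add: r_distr_minus)
    then have "(f \<ominus> g) \<otimes> t \<otimes> g = f \<otimes> ((\<one> \<ominus> s \<ominus> g) \<otimes> t \<otimes> g)" using f fc gc t by (simp add: m_assoc)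
    then show ?thesis using fs(2) g t fc by (simp add: terminal_def)
  qed
  then show ?thesis using f by (auto simp: abelian_idem_def)
qed

text \<open>A central cover of a nonzero idempotent below \<open>f\<close> must be \<open>1\<close>,
  so each such idempotent generates the unit ideal. It remains to find one of them inside
  \<open>I\<close>.\<close>

lemma indecomposable_imp_simple:
  assumes nz: "\<one> \<noteq> \<zero>"
    and indec: "\<And>c. \<lbrakk>c \<in> carrier R; c \<otimes> c = c; \<And>t. t \<in> carrier R \<Longrightarrow> c \<otimes> t = t \<otimes> c\<rbrakk> \<Longrightarrow> c = \<zero> \<or> c = \<one>"
    and I: "ideal I R" "I \<noteq> {\<zero>}"
  shows "\<one> \<in> I"
proof -
  interpret I: ideal I R by (rule I)
  obtain e where e: "abelian_idem e" "e \<noteq> \<zero>" using ex_abelian_idem[OF nz] by blast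
  then have ei: "idem e" by (simp add: abelian_idem_def)
  obtain f s where fs: "reach e f s" "terminal f s" using ex_reach_terminal[OF ei e(2)] by blast
  have f: "idem f" "f \<noteq> \<zero>" using reach_state[OF fs(1) ei e(2)] by (auto simp: below_def)
  have fc: "f \<in> carrier R" "f \<otimes> f = f" using f by (auto simp: idem_def)
  have full: "\<one> \<in> Idl {h}" if h: "below h f" "h \<noteq> \<zero>" for h
  proof -
    have hc: "h \<in> carrier R" using h by (simp add: below_def idem_def)
    obtain c where c: "c \<in> Idl {h}" "c \<otimes> h = h" "c \<otimes> c = c" "\<And>t. t \<in> carrier R \<Longrightarrow> c \<otimes> t = t \<otimes> c"
      using central_cover[OF e fs h(1)] by blast
    have cc: "c \<in> carrier R" using c(1) genideal_ideal[of "{h}"] hc ideal.Icarr by fastforce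
    then have "c \<noteq> \<zero>" using c(2) h(2) hc by auto
    then show ?thesis using indec[OF cc c(3,4)] c(1) by auto
  qed
  have annih: "x = \<zero>" if x: "x \<in> carrier R" and z: "\<And>t. t \<in> carrier R \<Longrightarrow> x \<otimes> t \<otimes> f = \<zero>" for x
  proof -
    have "Idl {f} \<subseteq> {z \<in> carrier R. \<forall>t\<in>carrier R. x \<otimes> t \<otimes> z = \<zero>}"
      using z x fc by (intro genideal_minimal ideal_middle_annihilator) auto
    then have "x \<otimes> \<one> \<otimes> \<one> = \<zero>" using full[OF below_refl[OF f(1)] f(2)] by blast
    then show ?thesis using x by simp
  qed
  have "\<exists>x\<in>I. f \<otimes> x \<otimes> f \<noteq> \<zero>"
  proof (rule ccontr)
    assume "\<not> ?thesis"
    then have z: "f \<otimes> x \<otimes> f = \<zero>" if "x \<in> I" for x using that by blast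
    have fx: "f \<otimes> x = \<zero>" if x: "x \<in> I" for x
      using annih[of "f \<otimes> x"] z[OF I.I_r_closed[OF x]] I.Icarr[OF x] fc by (simp add: m_assoc)
    have "x = \<zero>" if x: "x \<in> I" for x
    proof (rule annih)
      show xc: "x \<in> carrier R" using I.Icarr[OF x] .
      fix t assume t: "t \<in> carrier R"
      have c: "x \<otimes> t \<otimes> f \<in> carrier R" using xc t fc by simp
      obtain b where b: "b \<in> carrier R" "x \<otimes> t \<otimes> f \<otimes> b \<otimes> (x \<otimes> t \<otimes> f) = x \<otimes> t \<otimes> f"
        using vn_regular[OF c] by blast
      \<comment> \<open>Regularity of \<open>x t f\<close> brings in the factor
        \<open>f (b x)\<close>, and \<open>b x\<close> lies in \<open>I\<close>, on which left
        multiplication by \<open>f\<close> is already zero.\<close>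
      have "x \<otimes> t \<otimes> f \<otimes> b \<otimes> (x \<otimes> t \<otimes> f) = x \<otimes> t \<otimes> (f \<otimes> (b \<otimes> x) \<otimes> (t \<otimes> f))"
        using xc t fc b(1) by (simp add: m_assoc)
      also have "f \<otimes> (b \<otimes> x) = \<zero>" using fx I.I_l_closed[OF x b(1)] by simp
      finally show "x \<otimes> t \<otimes> f = \<zero>" using b xc t fc by simp
    qed
    then show False using I(2) I.zero_closed by blast
  qed
  then obtain x where x: "x \<in> I" "f \<otimes> x \<otimes> f \<noteq> \<zero>" by blast
  have xc: "x \<in> carrier R" using x I.Icarr by blast
  obtain u v where u: "u \<in> carrier R" "v \<in> carrier R" "u \<otimes> v \<otimes> u = u" "u \<noteq> \<zero>" "u \<otimes> f = u" "f \<otimes> v = v"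
    "u = f \<otimes> x \<otimes> f" by (rule corner_split[OF f(1) f(1) xc x(2)], rule that)
  have "below (v \<otimes> u) f" using u fc unfolding below_def idem_def by (metis m_assoc m_closed)
  moreover have "v \<otimes> u \<noteq> \<zero>" using u by (metis m_assoc r_null)
  ultimately have "\<one> \<in> Idl {v \<otimes> u}" by (rule full)
  moreover have "v \<otimes> u \<in> I" unfolding u(7) using x fc u by (simp add: I.I_l_closed I.I_r_closed)
  ultimately show ?thesis using genideal_minimal[OF I(1), of "{v \<otimes> u}"] by blast
qed

text \<open>In a simple ring the zero ideal is prime, so the ring itself has no infinite sequence of
  nonzero orthogonal idempotents. This makes one-sided inverses two-sided, and it stops the
  enlargement of \<open>a\<close>.\<close>

lemma simple_imp_unit_regular:
  assumes nz: "\<one> \<noteq> \<zero>" and simple: "\<And>I. ideal I R \<Longrightarrow> I \<noteq> {\<zero>} \<Longrightarrow> \<one> \<in> I"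
    and a: "a \<in> carrier R"
  shows "\<exists>u\<in>Units R. a = a \<otimes> u \<otimes> a"
proof -
  have p0: "nc_prime_ideal {\<zero>} R"
  proof (intro nc_prime_ideal.intro zeroideal nc_prime_ideal_axioms.intro)
    show "{\<zero>} \<noteq> carrier R" using nz by (metis one_closed singletonD)
    fix I J assume I: "ideal I R" and J: "ideal J R" and IJ: "I \<cdot> J \<subseteq> {\<zero>}"
    show "I \<subseteq> {\<zero>} \<or> J \<subseteq> {\<zero>}"
    proof (rule ccontr)
      assume "\<not> ?thesis"
      then have "\<one> \<in> I" "\<one> \<in> J" using simple I J by auto
      then have "\<one> \<otimes> \<one> \<in> I \<cdot> J" by (rule ideal_prod.prod)
      then show False using IJ nz by auto
    qed
  qed
  have noseq: False if "\<And>n::nat. s n \<in> carrier R" "\<And>n. h n \<in> carrier R" "\<And>n. h n \<otimes> h n = h n"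
    "\<And>n. s (Suc n) = s n \<oplus> h n" "\<And>n. s n \<otimes> h n = \<zero>" "\<And>n. h n \<otimes> s n = \<zero>" "\<And>n. h n \<noteq> \<zero>" for s h
  proof -
    have "h m \<otimes> h n = \<zero>" if "m \<noteq> n" for m n by (rule orthogonal_increments[of s h]) fact+
    then have "\<exists>n. h n \<in> {\<zero>}" using that(2,3) by (intro orth_finite[OF p0]) auto
    then show False using that(7) by blast
  qed
  \<comment> \<open>Jacobson's construction: if \<open>p q = 1\<close> and
    \<open>q p \<noteq> 1\<close>, the idempotents \<open>q^n (1 - q p) p^n\<close> are nonzero and
    orthogonal, with partial sums \<open>1 - q^n p^n\<close>.\<close>
  have dedekind: "q \<otimes> p = \<one>" if pq: "p \<in> carrier R" "q \<in> carrier R" "p \<otimes> q = \<one>" for p q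
  proof (rule ccontr)
    assume n: "q \<otimes> p \<noteq> \<one>"
    let ?c = "\<one> \<ominus> q \<otimes> p"
    let ?P = "\<lambda>n::nat. p [^] n" and ?Q = "\<lambda>n::nat. q [^] n"
    have PQ: "?P n \<otimes> ?Q n = \<one>" for n
    proof (induction n)
      case (Suc n)
      have "?P (Suc n) \<otimes> ?Q (Suc n) = ?P n \<otimes> (p \<otimes> q) \<otimes> ?Q n"
        using pq(1,2) nat_pow_Suc2[of q n] by (simp add: m_assoc)
      then show ?case using pq Suc by simp
    qed simp
    have c: "?c \<in> carrier R" "?c \<otimes> ?c = ?c" "?c \<noteq> \<zero>"
    proof -
      have "q \<otimes> p \<otimes> (q \<otimes> p) = q \<otimes> p" using pq by (metis m_assoc m_closed r_one)
      then show "?c \<otimes> ?c = ?c" using pq(1,2) by (simp add: nc_distr)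
      show "?c \<noteq> \<zero>" using n pq by (metis minus_eq_zero_iff m_closed one_closed)
    qed (use pq in simp)
    have PQ': "?P n \<otimes> (?Q n \<otimes> z) = z" if "z \<in> carrier R" for n z
      using PQ[of n] pq that by (metis l_one m_assoc nat_pow_closed)
    show False
    proof (rule noseq)
      let ?s = "\<lambda>n. \<one> \<ominus> ?Q n \<otimes> ?P n" and ?h = "\<lambda>n. ?Q n \<otimes> ?c \<otimes> ?P n"
      fix n
      show "?s n \<in> carrier R" "?h n \<in> carrier R" using pq by auto
      show "?h n \<otimes> ?h n = ?h n"
      proof -
        have "?h n \<otimes> ?h n = ?Q n \<otimes> (?c \<otimes> ?c) \<otimes> ?P n" using pq(1,2) c(1) PQ' by (simp add: m_assoc)
        then show ?thesis using c by simp
      qed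
      have hn: "?h n = ?Q n \<otimes> ?P n \<ominus> ?Q (Suc n) \<otimes> ?P (Suc n)"
        using pq(1,2) nat_pow_Suc2[of p n] by (simp add: nc_distr m_assoc)
      have tel: "\<one> \<ominus> v = \<one> \<ominus> u \<oplus> (u \<ominus> v)" if "u \<in> carrier R" "v \<in> carrier R" for u v
        using that by algebra
      show "?s (Suc n) = ?s n \<oplus> ?h n" unfolding hn by (rule tel) (intro m_closed nat_pow_closed pq)+
      show "?s n \<otimes> ?h n = \<zero>" using pq(1,2) c(1) PQ' by (simp add: l_distr_minus m_assoc)
      show "?h n \<otimes> ?s n = \<zero>" using pq(1,2) c(1) PQ PQ' by (simp add: r_distr_minus m_assoc)
      have "?P n \<otimes> ?h n \<otimes> ?Q n = ?c" using pq(1,2) c(1) PQ PQ' by (simp add: m_assoc)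
      then have "?h n = \<zero> \<Longrightarrow> ?c = \<zero>" using pq(1,2) by (simp del: nat_pow_Suc)
      then show "?h n \<noteq> \<zero>" using c(3) by blast
    qed
  qed
  obtain b0 where b0: "b0 \<in> carrier R" "a \<otimes> b0 \<otimes> a = a" using vn_regular[OF a] by blast
  define b where "b = b0 \<otimes> a \<otimes> b0"
  have b: "b \<in> carrier R" "a \<otimes> b \<otimes> a = a" "b \<otimes> a \<otimes> b = b"
    using a b0 unfolding b_def by (metis m_assoc m_closed)+
  define g where "g = b \<otimes> a"
  have g: "g \<in> carrier R" "a \<otimes> g = a" "g \<otimes> g = g" using a b unfolding g_def by (metis m_assoc m_closed)+
  \<comment> \<open>Enlarging \<open>\<alpha>\<close> by \<open>x\<close> and its quasi-inverse \<open>\<beta>\<close> by \<open>y\<close> keeps \<open>\<alpha> g = a\<close>; once \<open>\<alpha>\<close> is a unit, \<open>\<beta>\<close> is a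
    unit inner inverse of \<open>a\<close>.\<close>
  define good where "good \<alpha> \<beta> \<longleftrightarrow> \<alpha> \<in> carrier R \<and> \<beta> \<in> carrier R \<and> \<alpha> \<otimes> \<beta> \<otimes> \<alpha> = \<alpha> \<and> \<beta> \<otimes> \<alpha> \<otimes> \<beta> = \<beta> \<and>
    \<alpha> \<otimes> g = a \<and> \<beta> \<otimes> \<alpha> \<otimes> g = g" for \<alpha> \<beta>
  define ext where "ext \<alpha> \<beta> x y \<longleftrightarrow> x \<in> carrier R \<and> y \<in> carrier R \<and> x \<otimes> y \<otimes> x = x \<and> y \<otimes> x \<otimes> y = y \<and> x \<noteq> \<zero> \<and>
    \<beta> \<otimes> x = \<zero> \<and> x \<otimes> \<beta> = \<zero> \<and> \<alpha> \<otimes> y = \<zero> \<and> y \<otimes> \<alpha> = \<zero> \<and> x \<otimes> g = \<zero>" for \<alpha> \<beta> x y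
  have goodab: "good a b" using a b g unfolding good_def by (simp add: g_def[symmetric])
  have good_ext: "good (\<alpha> \<oplus> x) (\<beta> \<oplus> y)" if gd: "good \<alpha> \<beta>" and ex: "ext \<alpha> \<beta> x y" for \<alpha> \<beta> x y
  proof -
    have c: "\<alpha> \<in> carrier R" "\<beta> \<in> carrier R" "x \<in> carrier R" "y \<in> carrier R"
      and z: "\<beta> \<otimes> x = \<zero>" "x \<otimes> \<beta> = \<zero>" "\<alpha> \<otimes> y = \<zero>" "y \<otimes> \<alpha> = \<zero>" "x \<otimes> g = \<zero>"
      and e: "\<alpha> \<otimes> \<beta> \<otimes> \<alpha> = \<alpha>" "\<beta> \<otimes> \<alpha> \<otimes> \<beta> = \<beta>" "\<alpha> \<otimes> g = a" "\<beta> \<otimes> \<alpha> \<otimes> g = g" "x \<otimes> y \<otimes> x = x" "y \<otimes> x \<otimes> y = y"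
      using gd ex by (auto simp: good_def ext_def)
    have 1: "(\<alpha> \<oplus> x) \<otimes> (\<beta> \<oplus> y) = \<alpha> \<otimes> \<beta> \<oplus> x \<otimes> y" "(\<beta> \<oplus> y) \<otimes> (\<alpha> \<oplus> x) = \<beta> \<otimes> \<alpha> \<oplus> y \<otimes> x"
      using c z by (simp_all add: nc_distr)
    have 2: "\<alpha> \<otimes> \<beta> \<otimes> x = \<zero>" "x \<otimes> y \<otimes> \<alpha> = \<zero>" "\<beta> \<otimes> \<alpha> \<otimes> y = \<zero>" "y \<otimes> x \<otimes> \<beta> = \<zero>" "y \<otimes> x \<otimes> g = \<zero>"
      using c z g(1) by (simp_all add: m_assoc)
    show ?thesis unfolding good_def 1 using c z e g(1) 2 a by (simp add: nc_distr)
  qed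
  \<comment> \<open>If no nonzero element links the two complements
    \<open>1 - \<alpha> \<beta>\<close> and \<open>1 - \<beta> \<alpha>\<close>, simplicity makes
    one of them zero, and then both vanish because one-sided inverses are two-sided.\<close>
  have unit: "\<exists>u\<in>Units R. a = a \<otimes> u \<otimes> a"
    if gd: "good \<alpha> \<beta>" and t: "\<And>t. t \<in> carrier R \<Longrightarrow> (\<one> \<ominus> \<alpha> \<otimes> \<beta>) \<otimes> t \<otimes> (\<one> \<ominus> \<beta> \<otimes> \<alpha>) = \<zero>" for \<alpha> \<beta>
  proof -
    have c: "\<alpha> \<in> carrier R" "\<beta> \<in> carrier R" "\<alpha> \<otimes> g = a" "\<beta> \<otimes> \<alpha> \<otimes> g = g" using gd by (auto simp: good_def)
    have "\<alpha> \<otimes> \<beta> = \<one> \<or> \<beta> \<otimes> \<alpha> = \<one>"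
    proof (rule ccontr)
      assume n: "\<not> ?thesis"
      let ?I = "{z \<in> carrier R. \<forall>t\<in>carrier R. (\<one> \<ominus> \<alpha> \<otimes> \<beta>) \<otimes> t \<otimes> z = \<zero>}"
      have "\<one> \<ominus> \<beta> \<otimes> \<alpha> \<in> ?I" using t c by simp
      moreover have "\<one> \<ominus> \<beta> \<otimes> \<alpha> \<noteq> \<zero>" using n c by (metis minus_eq_zero_iff m_closed one_closed)
      ultimately have "?I \<noteq> {\<zero>}" by blast
      then have "\<one> \<in> ?I" using c by (intro simple ideal_middle_annihilator) auto
      then have "(\<one> \<ominus> \<alpha> \<otimes> \<beta>) \<otimes> \<one> \<otimes> \<one> = \<zero>" by blast
      then have "\<one> \<ominus> \<alpha> \<otimes> \<beta> = \<zero>" using c by simp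
      then show False using n c by (metis minus_eq_zero_iff m_closed one_closed)
    qed
    then have u: "\<alpha> \<otimes> \<beta> = \<one>" "\<beta> \<otimes> \<alpha> = \<one>" using dedekind c by blast+
    then have "\<beta> \<in> Units R" using c by (auto simp: Units_def)
    moreover have "a \<otimes> \<beta> \<otimes> a = \<alpha> \<otimes> (g \<otimes> (\<beta> \<otimes> \<alpha> \<otimes> g))"
      unfolding c(3)[symmetric] using c(1,2) g(1) by (simp only: m_assoc m_closed)
    then have "a = a \<otimes> \<beta> \<otimes> a" using c g by simp
    ultimately show ?thesis by blast
  qed
  show ?thesis
  proof (rule ccontr)
    assume neg: "\<not> ?thesis"
    \<comment> \<open>A nonzero element between the complements supplies the next piece. It kills
      \<open>g\<close> on the right since \<open>(1 - \<beta> \<alpha>) g = 0\<close>, which is why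
      \<open>\<alpha> g = a\<close> survives.\<close>
    have ex: "\<exists>x y. ext \<alpha> \<beta> x y" if gd: "good \<alpha> \<beta>" for \<alpha> \<beta>
    proof -
      have c: "\<alpha> \<in> carrier R" "\<beta> \<in> carrier R" "\<alpha> \<otimes> \<beta> \<otimes> \<alpha> = \<alpha>" "\<beta> \<otimes> \<alpha> \<otimes> \<beta> = \<beta>" "\<beta> \<otimes> \<alpha> \<otimes> g = g"
        using gd by (auto simp: good_def)
      obtain t where t: "t \<in> carrier R" "(\<one> \<ominus> \<alpha> \<otimes> \<beta>) \<otimes> t \<otimes> (\<one> \<ominus> \<beta> \<otimes> \<alpha>) \<noteq> \<zero>"
        using unit[OF gd] neg by blast
      let ?p = "\<one> \<ominus> \<alpha> \<otimes> \<beta>" and ?q = "\<one> \<ominus> \<beta> \<otimes> \<alpha>"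
      have "\<alpha> \<otimes> \<beta> \<otimes> (\<alpha> \<otimes> \<beta>) = \<alpha> \<otimes> \<beta>" "\<beta> \<otimes> \<alpha> \<otimes> (\<beta> \<otimes> \<alpha>) = \<beta> \<otimes> \<alpha>" using c by (metis m_assoc m_closed)+
      then have pq: "idem ?p" "idem ?q" using c(1,2) by (simp_all add: idem_def nc_distr)
      obtain x y where x: "x \<in> carrier R" "y \<in> carrier R" "x \<otimes> y \<otimes> x = x" "y \<otimes> x \<otimes> y = y" "x \<noteq> \<zero>"
        "?p \<otimes> x = x" "x \<otimes> ?q = x" "?q \<otimes> y = y" "y \<otimes> ?p = y"
        by (rule corner_split[OF pq t], rule that)
      have pc: "?p \<in> carrier R" "?q \<in> carrier R" using c by auto
      have z: "\<beta> \<otimes> ?p = \<zero>" "?q \<otimes> \<beta> = \<zero>" "\<alpha> \<otimes> ?q = \<zero>" "?p \<otimes> \<alpha> = \<zero>" "?q \<otimes> g = \<zero>"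
        using c g(1) by (simp_all add: nc_distr m_assoc[symmetric])
      have "\<beta> \<otimes> x = \<zero>" using z(1) x c pc by (metis m_assoc l_null)
      moreover have "x \<otimes> \<beta> = \<zero>" using z(2) x c pc by (metis m_assoc r_null)
      moreover have "\<alpha> \<otimes> y = \<zero>" using z(3) x c pc by (metis m_assoc l_null)
      moreover have "y \<otimes> \<alpha> = \<zero>" using z(4) x c pc by (metis m_assoc r_null)
      moreover have "x \<otimes> g = \<zero>" using z(5) x c pc g by (metis m_assoc r_null)
      ultimately show ?thesis using x unfolding ext_def by blast
    qed
    let ?P = "\<lambda>(\<alpha>, \<beta>, x, y). good \<alpha> \<beta> \<and> ext \<alpha> \<beta> x y"
    let ?Q = "\<lambda>(\<alpha>, \<beta>, x, y) (\<alpha>', \<beta>', x', y'). \<alpha>' = \<alpha> \<oplus> x \<and> \<beta>' = \<beta> \<oplus> y"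
    have "\<exists>\<sigma>. \<forall>n::nat. ?P (\<sigma> n) \<and> ?Q (\<sigma> n) (\<sigma> (Suc n))"
    proof (rule dependent_nat_choice)
      show "\<exists>z. ?P z" using ex[OF goodab] goodab by auto
      fix z assume z: "?P z"
      obtain \<alpha> \<beta> x y where zz: "z = (\<alpha>, \<beta>, x, y)" by (cases z)
      have gd: "good (\<alpha> \<oplus> x) (\<beta> \<oplus> y)" using z zz good_ext by auto
      then obtain x' y' where "ext (\<alpha> \<oplus> x) (\<beta> \<oplus> y) x' y'" using ex by blast
      then show "\<exists>z'. ?P z' \<and> ?Q z z'" using gd unfolding zz
        by (intro exI[of _ "(\<alpha> \<oplus> x, \<beta> \<oplus> y, x', y')"]) simp
    qed
    then obtain \<sigma> where "\<forall>n::nat. ?P (\<sigma> n) \<and> ?Q (\<sigma> n) (\<sigma> (Suc n))" ..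
  then have \<sigma>: "?P (\<sigma> n)" "?Q (\<sigma> n) (\<sigma> (Suc n))" for n by simp_all
    define A B U V where "A n = fst (\<sigma> n)" and "B n = fst (snd (\<sigma> n))"
      and "U n = fst (snd (snd (\<sigma> n)))" and "V n = snd (snd (snd (\<sigma> n)))" for n
    have gd: "good (A n) (B n)" and ext: "ext (A n) (B n) (U n) (V n)"
      and As: "A (Suc n) = A n \<oplus> U n" and Bs: "B (Suc n) = B n \<oplus> V n" for n
      using \<sigma>(1)[of n] \<sigma>(2)[of n] by (auto simp: A_def B_def U_def V_def split: prod.splits)
    show False
    \<comment> \<open>The idempotents \<open>B n A n\<close> act as partial sums: the mixed products
      vanish, so each enlargement adds precisely \<open>V n U n\<close>.\<close>
    proof (rule noseq[of "\<lambda>n. B n \<otimes> A n" "\<lambda>n. V n \<otimes> U n"])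
      fix n
      have c: "A n \<in> carrier R" "B n \<in> carrier R" using gd[of n] by (auto simp: good_def)
      have x: "U n \<in> carrier R" "V n \<in> carrier R" "U n \<otimes> V n \<otimes> U n = U n" "U n \<noteq> \<zero>"
        "B n \<otimes> U n = \<zero>" "U n \<otimes> B n = \<zero>" "A n \<otimes> V n = \<zero>" "V n \<otimes> A n = \<zero>"
        using ext[of n] by (auto simp: ext_def)
      show "B n \<otimes> A n \<in> carrier R" "V n \<otimes> U n \<in> carrier R" using c x by auto
      show "V n \<otimes> U n \<otimes> (V n \<otimes> U n) = V n \<otimes> U n" using x by (metis m_assoc m_closed)
      show "B (Suc n) \<otimes> A (Suc n) = B n \<otimes> A n \<oplus> V n \<otimes> U n" unfolding As Bs using c x by (simp add: nc_distr)
      have "B n \<otimes> A n \<otimes> (V n \<otimes> U n) = B n \<otimes> (A n \<otimes> V n) \<otimes> U n" using c x(1,2) by (simp add: m_assoc)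
      then show "B n \<otimes> A n \<otimes> (V n \<otimes> U n) = \<zero>" using c x by simp
      have "V n \<otimes> U n \<otimes> (B n \<otimes> A n) = V n \<otimes> (U n \<otimes> B n) \<otimes> A n" using c x(1,2) by (simp add: m_assoc)
      then show "V n \<otimes> U n \<otimes> (B n \<otimes> A n) = \<zero>" using c x by simp
      show "V n \<otimes> U n \<noteq> \<zero>" using x by (metis m_assoc r_null)
    qed
  qed
qed

text \<open>Either a nontrivial central idempotent splits the ring into two factors, each a quotient
  by a nonzero ideal where the assumption applies, or the ring is indecomposable and hence
  simple.\<close>

lemma unit_regular_if_modulo_nonzero_ideals:
  assumes a: "a \<in> carrier R"
    and mod: "\<And>J. \<lbrakk>ideal J R; J \<noteq> {\<zero>}\<rbrakk> \<Longrightarrow> \<exists>u\<in>carrier R. \<exists>v\<in>carrier R.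
      u \<otimes> v \<ominus> \<one> \<in> J \<and> v \<otimes> u \<ominus> \<one> \<in> J \<and> a \<otimes> u \<otimes> a \<ominus> a \<in> J"
  shows "\<exists>u\<in>Units R. a = a \<otimes> u \<otimes> a"
proof (cases "\<one> = \<zero>")
  case True
  then have "a = \<zero>" using a by (metis l_null l_one)
  then show ?thesis by (intro bexI[of _ \<one>]) auto
next
  case nz: False
  show ?thesis
  proof (cases "\<exists>c\<in>carrier R. c \<otimes> c = c \<and> (\<forall>t\<in>carrier R. c \<otimes> t = t \<otimes> c) \<and> c \<noteq> \<zero> \<and> c \<noteq> \<one>")
    case True
    then obtain c where c: "c \<in> carrier R" "c \<otimes> c = c" "\<And>t. t \<in> carrier R \<Longrightarrow> c \<otimes> t = t \<otimes> c" "c \<noteq> \<zero>" "c \<noteq> \<one>"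
      by blast
    define d where "d = \<one> \<ominus> c"
    have "d \<otimes> t = t \<otimes> d" if "t \<in> carrier R" for t
      using c(1) c(3)[OF that] that unfolding d_def by (simp add: nc_distr)
    moreover have "c \<oplus> d = \<one>" using c(1) unfolding d_def by algebra
    moreover have "d \<in> carrier R" "d \<otimes> d = d" "c \<otimes> d = \<zero>" "d \<otimes> c = \<zero>" "d \<noteq> \<zero>"
      using c(1,2,5) minus_eq_zero_iff[of \<one> c] unfolding d_def by (auto simp: nc_distr)
    ultimately have d: "d \<in> carrier R" "d \<otimes> d = d" "c \<otimes> d = \<zero>" "d \<otimes> c = \<zero>" "d \<noteq> \<zero>" "c \<oplus> d = \<one>"
      "\<And>t. t \<in> carrier R \<Longrightarrow> d \<otimes> t = t \<otimes> d" by blast+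
    have ker: "ideal {z \<in> carrier R. e \<otimes> z = \<zero>} R"
      if e: "e \<in> carrier R" "\<And>t. t \<in> carrier R \<Longrightarrow> e \<otimes> t = t \<otimes> e" for e
    proof (rule idealI_closed)
      fix z x assume z: "z \<in> {z \<in> carrier R. e \<otimes> z = \<zero>}" and x: "x \<in> carrier R"
      have "e \<otimes> (x \<otimes> z) = x \<otimes> (e \<otimes> z)" using e x z by (metis (no_types, lifting) m_assoc mem_Collect_eq)
      then show "x \<otimes> z \<in> {z \<in> carrier R. e \<otimes> z = \<zero>}" using z x by simp
      have "e \<otimes> (z \<otimes> x) = e \<otimes> z \<otimes> x" using e(1) x z by (simp add: m_assoc[symmetric])
      then show "z \<otimes> x \<in> {z \<in> carrier R. e \<otimes> z = \<zero>}" using z x by simp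
    qed (use e(1) in \<open>auto simp: r_distr\<close>)
    have "c \<in> {z \<in> carrier R. d \<otimes> z = \<zero>}" "d \<in> {z \<in> carrier R. c \<otimes> z = \<zero>}" using c(1) d(1,3,4) by auto
    then have ne: "{z \<in> carrier R. d \<otimes> z = \<zero>} \<noteq> {\<zero>}" "{z \<in> carrier R. c \<otimes> z = \<zero>} \<noteq> {\<zero>}"
      using c d by blast+
    obtain u1 v1 where 1: "u1 \<in> carrier R" "v1 \<in> carrier R" "c \<otimes> (u1 \<otimes> v1 \<ominus> \<one>) = \<zero>" "c \<otimes> (v1 \<otimes> u1 \<ominus> \<one>) = \<zero>"
      "c \<otimes> (a \<otimes> u1 \<otimes> a \<ominus> a) = \<zero>" using mod[OF ker[OF c(1,3)] ne(2)] by auto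
    obtain u2 v2 where 2: "u2 \<in> carrier R" "v2 \<in> carrier R" "d \<otimes> (u2 \<otimes> v2 \<ominus> \<one>) = \<zero>" "d \<otimes> (v2 \<otimes> u2 \<ominus> \<one>) = \<zero>"
      "d \<otimes> (a \<otimes> u2 \<otimes> a \<ominus> a) = \<zero>" using mod[OF ker[OF d(1,7)] ne(1)] by auto
    have e1: "c \<otimes> (u1 \<otimes> v1) = c" "c \<otimes> (v1 \<otimes> u1) = c" "c \<otimes> (a \<otimes> u1 \<otimes> a) = c \<otimes> a"
      using 1 c(1) a by (simp_all add: r_distr_minus minus_eq_zero_iff)
    have e2: "d \<otimes> (u2 \<otimes> v2) = d" "d \<otimes> (v2 \<otimes> u2) = d" "d \<otimes> (a \<otimes> u2 \<otimes> a) = d \<otimes> a"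
      using 2 d(1) a by (simp_all add: r_distr_minus minus_eq_zero_iff)
    \<comment> \<open>Working modulo the annihilator of \<open>c\<close> is working in the factor
      \<open>c R\<close>, and likewise for \<open>d\<close>. The componentwise sum of the two
      solutions solves the problem in the whole ring.\<close>
    define u v where "u = c \<otimes> u1 \<oplus> d \<otimes> u2" and "v = c \<otimes> v1 \<oplus> d \<otimes> v2"
    have uv: "u \<in> carrier R" "v \<in> carrier R" using 1 2 c(1) d(1) unfolding u_def v_def by auto
    have cu: "c \<otimes> u = c \<otimes> u1" "d \<otimes> u = d \<otimes> u2" "c \<otimes> v = c \<otimes> v1" "d \<otimes> v = d \<otimes> v2"
      using c(1,2) d(1-4) 1(1,2) 2(1,2) unfolding u_def v_def by (simp_all add: r_distr m_assoc[symmetric])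
    have glue: "z = z'" if z: "z \<in> carrier R" "z' \<in> carrier R" "c \<otimes> z = c \<otimes> z'" "d \<otimes> z = d \<otimes> z'" for z z'
    proof -
      have "(c \<oplus> d) \<otimes> z = (c \<oplus> d) \<otimes> z'" using z c(1) d(1) by (simp add: l_distr)
      then show ?thesis using d(6) z by simp
    qed
    have central: "\<forall>t\<in>carrier R. c \<otimes> t = t \<otimes> c" "\<forall>t\<in>carrier R. d \<otimes> t = t \<otimes> d" using c(3) d(7) by blast+
    note cc = central_mult_cong[OF c(1) central(1)] and dc = central_mult_cong[OF d(1) central(2)]
    have "u \<otimes> v = \<one>"
      using cc[OF uv(1) 1(1) uv(2) 1(2) cu(1,3)] dc[OF uv(1) 2(1) uv(2) 2(2) cu(2,4)] e1 e2 uv c(1) d(1)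
      by - (rule glue, auto)
    moreover have "v \<otimes> u = \<one>"
      using cc[OF uv(2) 1(2) uv(1) 1(1) cu(3,1)] dc[OF uv(2) 2(2) uv(1) 2(1) cu(4,2)] e1 e2 uv c(1) d(1)
      by - (rule glue, auto)
    moreover have "a \<otimes> u \<otimes> a = a"
    proof (rule glue)
      have "c \<otimes> (a \<otimes> u) = c \<otimes> (a \<otimes> u1)" using cc[OF a a uv(1) 1(1) refl cu(1)] .
      then show "c \<otimes> (a \<otimes> u \<otimes> a) = c \<otimes> a" using cc[of "a \<otimes> u" "a \<otimes> u1" a a] e1 a uv 1 by simp
      have "d \<otimes> (a \<otimes> u) = d \<otimes> (a \<otimes> u2)" using dc[OF a a uv(1) 2(1) refl cu(2)] .
      then show "d \<otimes> (a \<otimes> u \<otimes> a) = d \<otimes> a" using dc[of "a \<otimes> u" "a \<otimes> u2" a a] e2 a uv 2 by simp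
    qed (use a uv in auto)
    ultimately show ?thesis using uv by (intro bexI[of _ u]) (auto simp: Units_def)
  next
    case False
    then have "\<And>I. ideal I R \<Longrightarrow> I \<noteq> {\<zero>} \<Longrightarrow> \<one> \<in> I" by (intro indecomposable_imp_simple nz) blast+
    then show ?thesis by (rule simple_imp_unit_regular[OF nz _ a])
  qed
qed

end

section \<open>Passage to quotients\<close>

lemma (in ideal) rcos_carrier: "carrier (R Quot I) = (+>) I ` carrier R"
  by (auto simp: FactRing_def A_RCOSETS_def' )

lemma (in ideal) rcos_eq_iff: "\<lbrakk>a \<in> carrier R; b \<in> carrier R\<rbrakk> \<Longrightarrow> I +> a = I +> b \<longleftrightarrow> a \<ominus> b \<in> I"
  using quotient_eq_iff_same_a_r_cos[OF is_ideal] by simp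

lemma (in ideal) rcos_minus:
  assumes "a \<in> carrier R" "b \<in> carrier R"
  shows "I +> (a \<ominus> b) = (I +> a) \<ominus>\<^bsub>R Quot I\<^esub> (I +> b)"
proof -
  interpret h: ring_hom_ring R "R Quot I" "(+>) I" by (rule rcos_ring_hom_ring)
  show ?thesis using assms by (simp add: minus_eq h.S.minus_eq)
qed

text \<open>The quotient map sends ideals to ideals, so a product of ideals inside the preimage
  becomes a product of ideals inside \<open>P\<close>.\<close>

lemma (in ideal) nc_prime_vimage:
  assumes "nc_prime_ideal P (R Quot I)"
  shows "nc_prime_ideal {r \<in> carrier R. I +> r \<in> P} R"
proof -
  interpret h: ring_hom_ring R "R Quot I" "(+>) I" by (rule rcos_ring_hom_ring)
  interpret P: nc_prime_ideal P "R Quot I" by (rule assms)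
  let ?V = "{r \<in> carrier R. I +> r \<in> P}"
  show ?thesis
  proof (intro nc_prime_ideal.intro h.ideal_vimage P.is_ideal nc_prime_ideal_axioms.intro)
    show "?V \<noteq> carrier R"
    proof
      assume "?V = carrier R"
      then have "P = carrier (R Quot I)" using P.Icarr by (auto simp: rcos_carrier)
      then show False using P.proper by simp
    qed
    fix J K assume J: "ideal J R" and K: "ideal K R" and JK: "J \<cdot> K \<subseteq> ?V"
    interpret J: ideal J R by (rule J)
    interpret K: ideal K R by (rule K)
    have "x \<in> P" if "x \<in> ((+>) I ` J) \<cdot>\<^bsub>R Quot I\<^esub> ((+>) I ` K)" for x
      using that
    proof (induction rule: ideal_prod.induct)
      case (prod a b)
      then obtain j k where jk: "j \<in> J" "k \<in> K" "a = I +> j" "b = I +> k" by blast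
      then have "I +> (j \<otimes> k) \<in> P" using ideal_prod.prod[OF jk(1,2), of R] JK by blast
      then show ?case using jk J.Icarr K.Icarr by simp
    next
      case (sum a b)
      then show ?case by (simp add: P.a_closed)
    qed
    then have "(+>) I ` J \<subseteq> P \<or> (+>) I ` K \<subseteq> P"
      using P.prime[OF ring_ideal_imp_quot_ideal[OF is_ideal J] ring_ideal_imp_quot_ideal[OF is_ideal K]] by blast
    then show "J \<subseteq> ?V \<or> K \<subseteq> ?V" using J.Icarr K.Icarr by blast
  qed
qed

lemma (in ideal) quot_orth_finite_vn_regular:
  assumes "orth_finite_vn_regular_ring R"
  shows "orth_finite_vn_regular_ring (R Quot I)"
proof -
  interpret h: ring_hom_ring R "R Quot I" "(+>) I" by (rule rcos_ring_hom_ring)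
  interpret V: orth_finite_vn_regular_ring R by (rule assms)
  show ?thesis
  proof (intro orth_finite_vn_regular_ring.intro vn_regular_ring.intro vn_regular_ring_axioms.intro
      orth_finite_vn_regular_ring_axioms.intro quotient_is_ring)
    fix a assume "a \<in> carrier (R Quot I)"
    then obtain r where r: "r \<in> carrier R" "a = I +> r" by (auto simp: rcos_carrier)
    obtain b where "b \<in> carrier R" "r \<otimes> b \<otimes> r = r" using V.vn_regular[OF r(1)] by blast
    then show "\<exists>b\<in>carrier (R Quot I). a \<otimes>\<^bsub>R Quot I\<^esub> b \<otimes>\<^bsub>R Quot I\<^esub> a = a"
      using r by (intro bexI[of _ "I +> b"]) (auto simp flip: h.hom_mult)
  next
    fix P and h :: "nat \<Rightarrow> 'a set"
    assume P: "nc_prime_ideal P (R Quot I)" and h: "\<And>n. h n \<in> carrier (R Quot I)"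
      "\<And>n. h n \<otimes>\<^bsub>R Quot I\<^esub> h n \<ominus>\<^bsub>R Quot I\<^esub> h n \<in> P" "\<And>m n. m \<noteq> n \<Longrightarrow> h m \<otimes>\<^bsub>R Quot I\<^esub> h n \<in> P"
    have "\<forall>n. \<exists>r\<in>carrier R. h n = I +> r" using h(1) by (auto simp: rcos_carrier)
    then obtain k where k: "\<And>n. k n \<in> carrier R" "\<And>n. h n = I +> k n" by metis
    have "\<exists>n. k n \<in> {r \<in> carrier R. I +> r \<in> P}"
    proof (rule V.orth_finite[OF nc_prime_vimage[OF P]])
      fix n
      show "k n \<in> carrier R" by (rule k)
      show "k n \<otimes> k n \<ominus> k n \<in> {r \<in> carrier R. I +> r \<in> P}" using h(2)[of n] k by (simp add: rcos_minus)
      fix m assume "m \<noteq> n"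
      then show "k m \<otimes> k n \<in> {r \<in> carrier R. I +> r \<in> P}" using h(3)[of m n] k by simp
    qed
    then show "\<exists>n. h n \<in> P" using k by auto
  qed
qed

text \<open>Failure of \<open>a = a u a\<close> modulo an ideal is preserved under unions of chains of ideals,
  because its negation involves only finitely many elements.\<close>

theorem (in orth_finite_vn_regular_ring) is_unit_regular: "unit_regular_ring R"
proof (unfold_locales, rule ccontr)
  fix a assume a: "a \<in> carrier R" and neg: "\<not> (\<exists>u\<in>Units R. a = a \<otimes> u \<otimes> a)"
  \<comment> \<open>The inverse \<open>v\<close> belongs to the data because a unit modulo
    \<open>I\<close> need not lift to a unit of \<open>R\<close>.\<close>
  define good where "good I \<longleftrightarrow> (\<exists>u\<in>carrier R. \<exists>v\<in>carrier R.
      u \<otimes> v \<ominus> \<one> \<in> I \<and> v \<otimes> u \<ominus> \<one> \<in> I \<and> a \<otimes> u \<otimes> a \<ominus> a \<in> I)" for I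
  define \<A> where "\<A> = {I. ideal I R \<and> \<not> good I}"
  have "\<not> good {\<zero>}"
  proof
    assume "good {\<zero>}"
    then obtain u v where u: "u \<in> carrier R" "v \<in> carrier R" "u \<otimes> v = \<one>" "v \<otimes> u = \<one>" "a \<otimes> u \<otimes> a = a"
      using a by (auto simp: good_def minus_eq_zero_iff)
    then have "u \<in> Units R" by (auto simp: Units_def)
    then show False using neg u by metis
  qed
  then have "\<A> \<noteq> {}" using zeroideal by (auto simp: \<A>_def)
  then have "\<exists>M\<in>\<A>. \<forall>K\<in>\<A>. M \<subseteq> K \<longrightarrow> K = M"
  proof (rule subset_Zorn_nonempty)
    fix \<C> assume C: "\<C> \<noteq> {}" "subset.chain \<A> \<C>"
    have "subset.chain {I. ideal I R} \<C>" using C by (auto simp: \<A>_def subset.chain_def)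
    then have "ideal (\<Union>\<C>) R" using C by (intro Union_chain_ideal)
    moreover have "\<not> good (\<Union>\<C>)"
    proof
      assume "good (\<Union>\<C>)"
      then obtain u v I J K where u: "u \<in> carrier R" "v \<in> carrier R" "I \<in> \<C>" "J \<in> \<C>" "K \<in> \<C>"
        "u \<otimes> v \<ominus> \<one> \<in> I" "v \<otimes> u \<ominus> \<one> \<in> J" "a \<otimes> u \<otimes> a \<ominus> a \<in> K" unfolding good_def by blast
      have tot: "A \<subseteq> B \<or> B \<subseteq> A" if "A \<in> \<C>" "B \<in> \<C>" for A B using C(2) that by (auto simp: subset.chain_def)
      obtain L where L: "L \<in> \<C>" "I \<subseteq> L" "J \<subseteq> L" "K \<subseteq> L"
        using tot[OF u(3,4)] tot[OF u(3,5)] tot[OF u(4,5)] u(3-5) by blast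
      then have "u \<otimes> v \<ominus> \<one> \<in> L \<and> v \<otimes> u \<ominus> \<one> \<in> L \<and> a \<otimes> u \<otimes> a \<ominus> a \<in> L" using u by blast
      then have "good L" unfolding good_def using u(1,2) by (intro bexI)
      moreover have "L \<in> \<A>" using L(1) C(2) by (auto simp: subset.chain_def)
      ultimately show False by (simp add: \<A>_def)
    qed
    ultimately show "\<Union>\<C> \<in> \<A>" by (simp add: \<A>_def)
  qed
  then obtain M where M: "ideal M R" "\<not> good M" and max: "\<And>K. \<lbrakk>ideal K R; M \<subset> K\<rbrakk> \<Longrightarrow> good K"
    unfolding \<A>_def by blast
  interpret M: ideal M R by (rule M(1))
  interpret h: ring_hom_ring R "R Quot M" "(+>) M" by (rule M.rcos_ring_hom_ring)
  interpret Q: orth_finite_vn_regular_ring "R Quot M" by (rule M.quot_orth_finite_vn_regular) unfold_locales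
  have "\<exists>u\<in>Units (R Quot M). M +> a = (M +> a) \<otimes>\<^bsub>R Quot M\<^esub> u \<otimes>\<^bsub>R Quot M\<^esub> (M +> a)"
  proof (rule Q.unit_regular_if_modulo_nonzero_ideals)
    show "M +> a \<in> carrier (R Quot M)" using a by simp
    fix J assume J: "ideal J (R Quot M)" "J \<noteq> {\<zero>\<^bsub>R Quot M\<^esub>}"
    interpret J: ideal J "R Quot M" by (rule J(1))
    let ?K = "{r \<in> carrier R. M +> r \<in> J}"
    have zero: "M +> x = \<zero>\<^bsub>R Quot M\<^esub> \<longleftrightarrow> x \<in> M" if "x \<in> carrier R" for x
      using M.rcos_eq_iff[OF that zero_closed] that by simp
    have "M \<subseteq> ?K"
    proof
      fix x assume "x \<in> M"
      then have "x \<in> carrier R" "M +> x = \<zero>\<^bsub>R Quot M\<^esub>" using zero M.Icarr by auto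
      then show "x \<in> ?K" using J.zero_closed by simp
    qed
    moreover have "M \<noteq> ?K"
    proof
      assume eq: "M = ?K"
      have "j = \<zero>\<^bsub>R Quot M\<^esub>" if j: "j \<in> J" for j
      proof -
        obtain r where r: "r \<in> carrier R" "j = M +> r" using J.Icarr[OF j] by (auto simp: M.rcos_carrier)
        then have "r \<in> M" using j eq by auto
        then show ?thesis using zero r by simp
      qed
      then show False using J(2) J.zero_closed by blast
    qed
    \<comment> \<open>A nonzero ideal of the quotient pulls back to an ideal strictly above
      \<open>M\<close>, where maximality of \<open>M\<close> applies.\<close>
    ultimately have "good ?K" using max[OF h.ideal_vimage[OF J(1)]] by blast
    then obtain u v where u: "u \<in> carrier R" "v \<in> carrier R" "M +> (u \<otimes> v \<ominus> \<one>) \<in> J"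
      "M +> (v \<otimes> u \<ominus> \<one>) \<in> J" "M +> (a \<otimes> u \<otimes> a \<ominus> a) \<in> J" unfolding good_def by blast
    then show "\<exists>u\<in>carrier (R Quot M). \<exists>v\<in>carrier (R Quot M).
        u \<otimes>\<^bsub>R Quot M\<^esub> v \<ominus>\<^bsub>R Quot M\<^esub> \<one>\<^bsub>R Quot M\<^esub> \<in> J \<and> v \<otimes>\<^bsub>R Quot M\<^esub> u \<ominus>\<^bsub>R Quot M\<^esub> \<one>\<^bsub>R Quot M\<^esub> \<in> J \<and>
        (M +> a) \<otimes>\<^bsub>R Quot M\<^esub> u \<otimes>\<^bsub>R Quot M\<^esub> (M +> a) \<ominus>\<^bsub>R Quot M\<^esub> (M +> a) \<in> J"
      using a by (intro bexI[of _ "M +> u"] bexI[of _ "M +> v"]) (simp_all add: M.rcos_minus)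
  qed
  then obtain U V where U: "U \<in> carrier (R Quot M)" "V \<in> carrier (R Quot M)" "U \<otimes>\<^bsub>R Quot M\<^esub> V = \<one>\<^bsub>R Quot M\<^esub>"
    "V \<otimes>\<^bsub>R Quot M\<^esub> U = \<one>\<^bsub>R Quot M\<^esub>" "M +> a = (M +> a) \<otimes>\<^bsub>R Quot M\<^esub> U \<otimes>\<^bsub>R Quot M\<^esub> (M +> a)"
    by (auto simp: Units_def)
  then obtain u v where u: "u \<in> carrier R" "v \<in> carrier R" "U = M +> u" "V = M +> v"
    by (auto simp: M.rcos_carrier)
  have "M +> (u \<otimes> v) = M +> \<one>" "M +> (v \<otimes> u) = M +> \<one>" "M +> (a \<otimes> u \<otimes> a) = M +> a"
    using U u a by simp_all
  then have "u \<otimes> v \<ominus> \<one> \<in> M \<and> v \<otimes> u \<ominus> \<one> \<in> M \<and> a \<otimes> u \<otimes> a \<ominus> a \<in> M"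
    using M.rcos_eq_iff[of "u \<otimes> v" \<one>] M.rcos_eq_iff[of "v \<otimes> u" \<one>] M.rcos_eq_iff[of "a \<otimes> u \<otimes> a" a] u(1,2) a
    by blast
  then have "good M" unfolding good_def using u(1,2) by blast
  then show False using M(2) by simp
qed

section \<open>Group rings and the augmentation\<close>

lemma (in ring) nat_multiple_eq:
  fixes n :: nat
  assumes "r \<in> carrier R"
  shows "[n] \<cdot> r = ([n] \<cdot> \<one>) \<otimes> r" "[n] \<cdot> r = r \<otimes> ([n] \<cdot> \<one>)"
  using assms add_pow_ldistr[of \<one> r n] add_pow_rdistr[of r \<one> n] by simp_all

locale group_ring_setup = ring R + G: group G
  for R :: "('a, 'm) ring_scheme" (structure) and G :: "('g, 'n) monoid_scheme"
begin

abbreviation RG :: "('g \<Rightarrow> 'a) ring" where "RG \<equiv> group_ring R G"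

sublocale RG: ring RG
  by (rule ring_group_ring[OF ring_axioms G.is_group])

lemmas RG_D = gr_carrierD[OF ring_axioms G.is_group]
lemmas RG_I = gr_carrierI[OF ring_axioms G.is_group]
lemmas RG_ext = gr_ext[OF ring_axioms G.is_group]
lemmas RG_mult_eq = gr_mult_eq[OF ring_axioms G.is_group]
lemmas RG_add_apply = gr_add_apply[OF ring_axioms G.is_group]

definition single :: "'a \<Rightarrow> 'g \<Rightarrow> 'g \<Rightarrow> 'a"
  where "single r g = (\<lambda>x\<in>carrier G. if x = g then r else \<zero>)"

lemma single_apply: "x \<in> carrier G \<Longrightarrow> single r g x = (if x = g then r else \<zero>)"
  by (simp add: single_def)

lemma single_closed [simp, intro]:
  "\<lbrakk>r \<in> carrier R; g \<in> carrier G\<rbrakk> \<Longrightarrow> single r g \<in> carrier RG"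
  by (rule RG_I[where A = "{g}"]) (auto simp: single_def)

lemma zero_apply: "x \<in> carrier G \<Longrightarrow> \<zero>\<^bsub>RG\<^esub> x = \<zero>"
  by (simp add: group_ring_def)

lemma one_eq_single: "\<one>\<^bsub>RG\<^esub> = single \<one> \<one>\<^bsub>G\<^esub>"
  by (simp add: group_ring_def single_def)

lemma zero_eq_single: "\<zero>\<^bsub>RG\<^esub> = single \<zero> g"
  by (auto simp: group_ring_def single_def)

lemma single_add:
  "\<lbrakk>r \<in> carrier R; s \<in> carrier R; g \<in> carrier G\<rbrakk> \<Longrightarrow> single (r \<oplus> s) g = single r g \<oplus>\<^bsub>RG\<^esub> single s g"
  by (rule RG_ext) (auto simp: RG_add_apply single_apply)

lemma uminus_apply:
  assumes "f \<in> carrier RG" "x \<in> carrier G"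
  shows "(\<ominus>\<^bsub>RG\<^esub> f) x = \<ominus> f x"
proof -
  have "(\<ominus>\<^bsub>RG\<^esub> f \<oplus>\<^bsub>RG\<^esub> f) x = \<zero>" using assms by (simp add: RG.l_neg zero_apply)
  then have "(\<ominus>\<^bsub>RG\<^esub> f) x \<oplus> f x = \<zero>" using assms by (simp add: RG_add_apply)
  then show ?thesis using RG_D(1)[of f] RG_D(1)[of "\<ominus>\<^bsub>RG\<^esub> f"] assms by (simp add: minus_equality)
qed

lemma single_mult_apply:
  assumes "r \<in> carrier R" "g \<in> carrier G" "f \<in> carrier RG" "x \<in> carrier G"
  shows "(single r g \<otimes>\<^bsub>RG\<^esub> f) x = r \<otimes> f (inv\<^bsub>G\<^esub> g \<otimes>\<^bsub>G\<^esub> x)"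
proof -
  have "(single r g \<otimes>\<^bsub>RG\<^esub> f) x = (\<Oplus>h\<in>{g}. single r g h \<otimes> f (inv\<^bsub>G\<^esub> h \<otimes>\<^bsub>G\<^esub> x))"
    by (rule RG_mult_eq) (use assms in \<open>auto simp: gr_support_def single_apply split: if_splits\<close>)
  also have "\<dots> = r \<otimes> f (inv\<^bsub>G\<^esub> g \<otimes>\<^bsub>G\<^esub> x)"
    using assms RG_D(1)[OF assms(3)] by (simp add: finsum_insert single_apply)
  finally show ?thesis .
qed

lemma single_mult_single:
  assumes "r \<in> carrier R" "g \<in> carrier G" "s \<in> carrier R" "h \<in> carrier G"
  shows "single r g \<otimes>\<^bsub>RG\<^esub> single s h = single (r \<otimes> s) (g \<otimes>\<^bsub>G\<^esub> h)"
proof (rule RG_ext)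
  fix x assume x: "x \<in> carrier G"
  have "inv\<^bsub>G\<^esub> g \<otimes>\<^bsub>G\<^esub> x = h \<longleftrightarrow> x = g \<otimes>\<^bsub>G\<^esub> h" using assms x by (metis G.inv_solve_left')
  then show "(single r g \<otimes>\<^bsub>RG\<^esub> single s h) x = single (r \<otimes> s) (g \<otimes>\<^bsub>G\<^esub> h) x"
    using assms x by (simp add: single_mult_apply single_apply)
qed (use assms in auto)

lemma single_one_mult_apply:
  "\<lbrakk>g \<in> carrier G; f \<in> carrier RG; x \<in> carrier G\<rbrakk> \<Longrightarrow> (single \<one> g \<otimes>\<^bsub>RG\<^esub> f) x = f (inv\<^bsub>G\<^esub> g \<otimes>\<^bsub>G\<^esub> x)"
  using RG_D(1)[of f] by (simp add: single_mult_apply)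

text \<open>The last case concerns only the coefficients of the given \<open>f\<close>, so
  hypotheses known just for these coefficients can be used in the induction.\<close>

lemma sum_of_singles_induct [consumes 1, case_names zero add single]:
  assumes f: "f \<in> carrier RG" and zero: "P \<zero>\<^bsub>RG\<^esub>"
    and add: "\<And>a b. \<lbrakk>a \<in> carrier RG; b \<in> carrier RG; P a; P b\<rbrakk> \<Longrightarrow> P (a \<oplus>\<^bsub>RG\<^esub> b)"
    and single: "\<And>g. g \<in> carrier G \<Longrightarrow> P (single (f g) g)"
  shows "P f"
proof -
  note c = RG_D[OF f]
  define t where "t A = (\<lambda>x\<in>carrier G. if x \<in> A then f x else \<zero>)" for A
  have tc: "t A \<in> carrier RG" if "finite A" for A
    by (rule RG_I[OF _ _ that]) (use c in \<open>auto simp: t_def\<close>)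
  have "P (t A)" if "finite A" "A \<subseteq> carrier G" for A
    using that
  proof (induction A rule: finite_induct)
    case empty
    have "t {} = \<zero>\<^bsub>RG\<^esub>" by (rule RG_ext[OF tc]) (auto simp: t_def zero_apply)
    then show ?case using zero by simp
  next
    case (insert a A)
    have s: "single (f a) a \<in> carrier RG" using insert c by auto
    have "t (insert a A) = single (f a) a \<oplus>\<^bsub>RG\<^esub> t A"
    proof (rule RG_ext)
      fix x assume x: "x \<in> carrier G"
      then show "t (insert a A) x = (single (f a) a \<oplus>\<^bsub>RG\<^esub> t A) x"
        using insert c(1)[OF x] by (auto simp: RG_add_apply single_apply t_def)
    qed (use tc insert s in auto)
    then show ?case using insert add[OF s tc] single by auto
  qed
  moreover have "t (gr_support R G f) = f"
    by (rule RG_ext[OF tc[OF c(2)] f]) (auto simp: t_def gr_support_def)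
  ultimately show ?thesis using c by metis
qed

definition aug :: "('g \<Rightarrow> 'a) \<Rightarrow> 'a"
  where "aug f = (\<Oplus>g\<in>gr_support R G f. f g)"

lemma aug_eq:
  assumes f: "f \<in> carrier RG" and A: "finite A" "gr_support R G f \<subseteq> A" "A \<subseteq> carrier G"
  shows "aug f = (\<Oplus>g\<in>A. f g)"
  unfolding aug_def
  by (rule add.finprod_mono_neutral_cong_left) (use A RG_D(1)[OF f] in \<open>auto simp: gr_support_def\<close>)

lemma aug_closed [simp]: "f \<in> carrier RG \<Longrightarrow> aug f \<in> carrier R"
  unfolding aug_def using RG_D by (intro finsum_closed) blast

lemma aug_single [simp]:
  assumes "r \<in> carrier R" "g \<in> carrier G"
  shows "aug (single r g) = r"
proof -
  have "aug (single r g) = (\<Oplus>h\<in>{g}. single r g h)"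
    by (rule aug_eq) (use assms in \<open>auto simp: gr_support_def single_apply split: if_splits\<close>)
  then show ?thesis using assms by (simp add: single_apply finsum_insert)
qed

lemma aug_add:
  assumes f: "f \<in> carrier RG" and k: "k \<in> carrier RG"
  shows "aug (f \<oplus>\<^bsub>RG\<^esub> k) = aug f \<oplus> aug k"
proof -
  let ?A = "gr_support R G f \<union> gr_support R G k"
  note cf = RG_D[OF f] and ck = RG_D[OF k]
  have A: "finite ?A" "?A \<subseteq> carrier G" using cf ck by auto
  have "gr_support R G (f \<oplus>\<^bsub>RG\<^esub> k) \<subseteq> ?A"
    using cf ck by (auto simp: gr_support_def RG_add_apply)
  then have "aug (f \<oplus>\<^bsub>RG\<^esub> k) = (\<Oplus>g\<in>?A. (f \<oplus>\<^bsub>RG\<^esub> k) g)" using A f k by (intro aug_eq) auto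
  also have "\<dots> = (\<Oplus>g\<in>?A. f g \<oplus> k g)"
    using A cf(1) ck(1) by (intro finsum_cong') (auto simp: RG_add_apply subset_iff)
  also have "\<dots> = (\<Oplus>g\<in>?A. f g) \<oplus> (\<Oplus>g\<in>?A. k g)"
    using A(2) cf(1) ck(1) by (intro finsum_addf) (auto simp: subset_iff)
  also have "\<dots> = aug f \<oplus> aug k" using aug_eq[OF f A(1) _ A(2)] aug_eq[OF k A(1) _ A(2)] by simp
  finally show ?thesis .
qed

lemma aug_single_mult:
  assumes r: "r \<in> carrier R" and g: "g \<in> carrier G" and f: "f \<in> carrier RG"
  shows "aug (single r g \<otimes>\<^bsub>RG\<^esub> f) = r \<otimes> aug f"
proof -
  note c = RG_D[OF f]
  let ?S = "gr_support R G f" and ?A = "(\<lambda>x. g \<otimes>\<^bsub>G\<^esub> x) ` gr_support R G f"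
  have inj: "inj_on (\<lambda>x. g \<otimes>\<^bsub>G\<^esub> x) ?S"
    by (rule inj_onI) (use g c(4) in \<open>meson G.l_cancel subsetD\<close>)
  have A: "finite ?A" "?A \<subseteq> carrier G" using c g by auto
  have "x \<in> ?A" if x: "x \<in> gr_support R G (single r g \<otimes>\<^bsub>RG\<^esub> f)" for x
  proof -
    have xc: "x \<in> carrier G" and nz: "r \<otimes> f (inv\<^bsub>G\<^esub> g \<otimes>\<^bsub>G\<^esub> x) \<noteq> \<zero>"
      using x r g f by (auto simp: gr_support_def single_mult_apply)
    then have "inv\<^bsub>G\<^esub> g \<otimes>\<^bsub>G\<^esub> x \<in> ?S" using r g by (auto simp: gr_support_def)
    moreover have "x = g \<otimes>\<^bsub>G\<^esub> (inv\<^bsub>G\<^esub> g \<otimes>\<^bsub>G\<^esub> x)" using g xc by (simp add: G.m_assoc[symmetric])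
    ultimately show ?thesis by blast
  qed
  then have "aug (single r g \<otimes>\<^bsub>RG\<^esub> f) = (\<Oplus>x\<in>?A. (single r g \<otimes>\<^bsub>RG\<^esub> f) x)"
    using A r g f by (intro aug_eq) auto
  also have "\<dots> = (\<Oplus>x\<in>?S. (single r g \<otimes>\<^bsub>RG\<^esub> f) (g \<otimes>\<^bsub>G\<^esub> x))"
    by (rule finsum_reindex[OF _ inj]) (use A RG_D(1)[of "single r g \<otimes>\<^bsub>RG\<^esub> f"] r g f in blast)
  also have "\<dots> = (\<Oplus>x\<in>?S. r \<otimes> f x)"
    using c r g f by (intro finsum_cong') (auto simp: single_mult_apply G.m_assoc[symmetric] subset_iff)
  also have "\<dots> = r \<otimes> aug f" unfolding aug_def using c r by (intro finsum_rdistr[symmetric]) auto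
  finally show ?thesis .
qed

lemma aug_mult:
  assumes f: "f \<in> carrier RG" and k: "k \<in> carrier RG"
  shows "aug (f \<otimes>\<^bsub>RG\<^esub> k) = aug f \<otimes> aug k"
  using f
proof (induction rule: sum_of_singles_induct)
  case zero
  have "aug \<zero>\<^bsub>RG\<^esub> = \<zero>" using aug_single[of \<zero> "\<one>\<^bsub>G\<^esub>"] zero_eq_single[of "\<one>\<^bsub>G\<^esub>"] by simp
  then show ?case using k by simp
next
  case (add a b)
  then show ?case using k by (simp add: RG.l_distr aug_add l_distr)
next
  case (single g)
  then show ?case using k RG_D(1)[OF f] by (simp add: aug_single_mult)
qed

lemma aug_hom: "aug \<in> ring_hom RG R"
  by (rule ring_hom_memI) (auto simp: aug_add aug_mult one_eq_single)

sublocale aug: ring_hom_ring RG R aug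
  by (rule ring_hom_ringI2[OF RG.ring_axioms ring_axioms aug_hom])

text \<open>The augmentation is a ring homomorphism that fixes coefficients placed at the identity;
  it carries units and the equation \<open>a = a u a\<close> down to \<open>R\<close>.\<close>

lemma unit_regular_coefficients:
  assumes "unit_regular_ring RG"
  shows "unit_regular_ring R"
proof (unfold_locales)
  interpret U: unit_regular_ring RG by (rule assms)
  fix a assume a: "a \<in> carrier R"
  then have s: "single a \<one>\<^bsub>G\<^esub> \<in> carrier RG" by simp
  obtain u where u: "u \<in> Units RG" "single a \<one>\<^bsub>G\<^esub> = single a \<one>\<^bsub>G\<^esub> \<otimes>\<^bsub>RG\<^esub> u \<otimes>\<^bsub>RG\<^esub> single a \<one>\<^bsub>G\<^esub>"
    using U.unit_regular[OF s] by blast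
  then obtain v where v: "u \<in> carrier RG" "v \<in> carrier RG" "u \<otimes>\<^bsub>RG\<^esub> v = \<one>\<^bsub>RG\<^esub>" "v \<otimes>\<^bsub>RG\<^esub> u = \<one>\<^bsub>RG\<^esub>"
    by (auto simp: Units_def)
  have "aug u \<otimes> aug v = \<one>" "aug v \<otimes> aug u = \<one>" using v by (simp_all flip: aug.hom_mult)
  then have "aug u \<in> Units R" using v by (auto simp: Units_def)
  moreover have "a = a \<otimes> aug u \<otimes> a" using arg_cong[OF u(2), of aug] s v a by simp
  ultimately show "\<exists>u\<in>Units R. a = a \<otimes> u \<otimes> a" by blast
qed

section \<open>Invariant elements of a regular group ring\<close>

text \<open>With \<open>z = s a - a\<close> and \<open>w = 1 - y z\<close> one has
  \<open>z w = 0\<close>, so \<open>a w\<close> is fixed by \<open>s\<close>. Right multiplication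
  by \<open>w\<close> keeps the invariance already achieved, and \<open>z\<close> has augmentation
  \<open>0\<close>, so that of \<open>w\<close> is \<open>1\<close>.\<close>

lemma ex_invariant:
  assumes reg: "vn_regular_ring RG" and S: "finite S" "S \<subseteq> carrier G"
  shows "\<exists>a\<in>carrier RG. aug a = \<one> \<and> (\<forall>s\<in>S. single \<one> s \<otimes>\<^bsub>RG\<^esub> a = a)"
  using S
proof (induction S rule: finite_induct)
  case empty
  then show ?case by (intro bexI[of _ "\<one>\<^bsub>RG\<^esub>"]) auto
next
  case (insert s S)
  interpret V: vn_regular_ring RG by (rule reg)
  obtain a where a: "a \<in> carrier RG" "aug a = \<one>" "\<And>s. s \<in> S \<Longrightarrow> single \<one> s \<otimes>\<^bsub>RG\<^esub> a = a"
    using insert by auto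
  have s: "s \<in> carrier G" and S: "S \<subseteq> carrier G" using insert by auto
  define z where "z = single \<one> s \<otimes>\<^bsub>RG\<^esub> a \<ominus>\<^bsub>RG\<^esub> a"
  have z: "z \<in> carrier RG" "aug z = \<zero>" using a s unfolding z_def by (auto simp: RG.minus_eq r_neg)
  obtain y where y: "y \<in> carrier RG" "z \<otimes>\<^bsub>RG\<^esub> y \<otimes>\<^bsub>RG\<^esub> z = z" using V.vn_regular[OF z(1)] by blast
  define w where "w = \<one>\<^bsub>RG\<^esub> \<ominus>\<^bsub>RG\<^esub> y \<otimes>\<^bsub>RG\<^esub> z"
  have w: "w \<in> carrier RG" "aug w = \<one>" using y z unfolding w_def by (auto simp: RG.minus_eq)
  have "z \<otimes>\<^bsub>RG\<^esub> w = z \<ominus>\<^bsub>RG\<^esub> z \<otimes>\<^bsub>RG\<^esub> y \<otimes>\<^bsub>RG\<^esub> z"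
    using y(1) z unfolding w_def by (simp add: RG.r_distr_minus RG.m_assoc)
  then have zw: "z \<otimes>\<^bsub>RG\<^esub> w = \<zero>\<^bsub>RG\<^esub>" using y z by simp
  have "z \<otimes>\<^bsub>RG\<^esub> w = single \<one> s \<otimes>\<^bsub>RG\<^esub> (a \<otimes>\<^bsub>RG\<^esub> w) \<ominus>\<^bsub>RG\<^esub> a \<otimes>\<^bsub>RG\<^esub> w"
    unfolding z_def using a s w by (simp add: RG.l_distr_minus RG.m_assoc)
  then have "single \<one> s \<otimes>\<^bsub>RG\<^esub> (a \<otimes>\<^bsub>RG\<^esub> w) \<ominus>\<^bsub>RG\<^esub> a \<otimes>\<^bsub>RG\<^esub> w = \<zero>\<^bsub>RG\<^esub>" using zw by simp
  then have "single \<one> s \<otimes>\<^bsub>RG\<^esub> (a \<otimes>\<^bsub>RG\<^esub> w) = a \<otimes>\<^bsub>RG\<^esub> w"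
    by (subst (asm) RG.minus_eq_zero_iff) (use a s w in auto)
  moreover have "single \<one> t \<otimes>\<^bsub>RG\<^esub> (a \<otimes>\<^bsub>RG\<^esub> w) = a \<otimes>\<^bsub>RG\<^esub> w" if "t \<in> S" for t
  proof -
    have "t \<in> carrier G" using that S by blast
    then have "single \<one> t \<otimes>\<^bsub>RG\<^esub> (a \<otimes>\<^bsub>RG\<^esub> w) = single \<one> t \<otimes>\<^bsub>RG\<^esub> a \<otimes>\<^bsub>RG\<^esub> w" using a w by (simp add: RG.m_assoc)
    then show ?thesis using a(3)[OF that] by simp
  qed
  moreover have "aug (a \<otimes>\<^bsub>RG\<^esub> w) = \<one>" using a w by simp
  ultimately show ?case using a w by (intro bexI[of _ "a \<otimes>\<^bsub>RG\<^esub> w"]) auto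
qed

lemma invariant_generate:
  assumes a: "a \<in> carrier RG" and S: "S \<subseteq> carrier G" and inv: "\<And>s. s \<in> S \<Longrightarrow> single \<one> s \<otimes>\<^bsub>RG\<^esub> a = a"
    and h: "h \<in> generate G S"
  shows "single \<one> h \<otimes>\<^bsub>RG\<^esub> a = a"
  using h
proof (induction rule: generate.induct)
  case one
  then show ?case using a by (simp flip: one_eq_single)
next
  case (incl h)
  then show ?case by (rule inv)
next
  case (inv h)
  then have h: "h \<in> carrier G" using S by auto
  have "single \<one> (inv\<^bsub>G\<^esub> h) \<otimes>\<^bsub>RG\<^esub> a = single \<one> (inv\<^bsub>G\<^esub> h) \<otimes>\<^bsub>RG\<^esub> (single \<one> h \<otimes>\<^bsub>RG\<^esub> a)"
    using assms(3)[OF inv] by simp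
  also have "\<dots> = single \<one> (inv\<^bsub>G\<^esub> h) \<otimes>\<^bsub>RG\<^esub> single \<one> h \<otimes>\<^bsub>RG\<^esub> a" using h a by (simp add: RG.m_assoc)
  also have "\<dots> = a" using h a by (simp add: single_mult_single flip: one_eq_single)
  finally show ?case .
next
  case (eng h k)
  have hk: "h \<in> carrier G" "k \<in> carrier G" using eng.hyps G.generate_in_carrier[OF S] by auto
  have "single \<one> (h \<otimes>\<^bsub>G\<^esub> k) = single \<one> h \<otimes>\<^bsub>RG\<^esub> single \<one> k" using hk by (simp add: single_mult_single)
  then show ?case using eng.IH hk a by (simp add: RG.m_assoc)
qed

text \<open>If \<open>a x\<close> is nonzero, invariance gives \<open>a (h x) = a x\<close>, so
  \<open>h \<mapsto> h x\<close> embeds \<open>H\<close> into the finite support of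
  \<open>a\<close>.\<close>

lemma invariant_finite:
  assumes a: "a \<in> carrier RG" "a \<noteq> \<zero>\<^bsub>RG\<^esub>" and H: "H \<subseteq> carrier G"
    and inv: "\<And>h. h \<in> H \<Longrightarrow> single \<one> h \<otimes>\<^bsub>RG\<^esub> a = a"
  shows "finite H"
proof -
  obtain x where x: "x \<in> carrier G" "a x \<noteq> \<zero>"
    using RG_ext[OF a(1) RG.zero_closed] a(2) by (auto simp: zero_apply)
  have "inj_on (\<lambda>h. h \<otimes>\<^bsub>G\<^esub> x) H" by (rule inj_onI) (use H x in \<open>meson G.r_cancel subsetD\<close>)
  moreover have "(\<lambda>h. h \<otimes>\<^bsub>G\<^esub> x) ` H \<subseteq> gr_support R G a"
  proof (rule image_subsetI)
    fix h assume h: "h \<in> H"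
    then have hc: "h \<in> carrier G" using H by blast
    have "a (h \<otimes>\<^bsub>G\<^esub> x) = (single \<one> h \<otimes>\<^bsub>RG\<^esub> a) (h \<otimes>\<^bsub>G\<^esub> x)" using inv[OF h] by simp
    also have "\<dots> = a x" using hc x a by (simp add: single_one_mult_apply G.m_assoc[symmetric])
    finally show "h \<otimes>\<^bsub>G\<^esub> x \<in> gr_support R G a" using x hc by (simp add: gr_support_def)
  qed
  ultimately show ?thesis using RG_D(2)[OF a(1)] finite_subset finite_imageD by metis
qed

lemma locally_finite_if_vn_regular:
  assumes reg: "vn_regular_ring RG" and nz: "\<one> \<noteq> \<zero>"
  shows "locally_finite_group G"
proof unfold_locales
  fix S assume S: "S \<subseteq> carrier G" "finite S"
  obtain a where a: "a \<in> carrier RG" "aug a = \<one>" "\<And>s. s \<in> S \<Longrightarrow> single \<one> s \<otimes>\<^bsub>RG\<^esub> a = a"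
    using ex_invariant[OF reg S(2,1)] by blast
  have "a \<noteq> \<zero>\<^bsub>RG\<^esub>" using a nz by auto
  then show "finite (generate G S)"
    using invariant_finite[OF a(1) _ _ invariant_generate[OF a(1) S(1) a(3)]] G.generate_incl[OF S(1)] by blast
qed

text \<open>The coset \<open>H x\<close> contributes \<open>|H| a(x)\<close> to the augmentation of an \<open>H\<close>-invariant element \<open>a\<close>.\<close>

lemma invariant_sum_multiple:
  assumes H: "subgroup H G" "finite H" and A: "finite A" "A \<subseteq> carrier G"
    "\<And>h x. \<lbrakk>h \<in> H; x \<in> A\<rbrakk> \<Longrightarrow> h \<otimes>\<^bsub>G\<^esub> x \<in> A"
    and a: "\<And>x. x \<in> A \<Longrightarrow> a x \<in> carrier R" "\<And>h x. \<lbrakk>h \<in> H; x \<in> A\<rbrakk> \<Longrightarrow> a (h \<otimes>\<^bsub>G\<^esub> x) = a x"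
  shows "\<exists>r\<in>carrier R. (\<Oplus>x\<in>A. a x) = [card H] \<cdot> r"
  using A a
proof (induction A rule: finite_psubset_induct)
  case (psubset A)
  interpret H: subgroup H G by (rule H(1))
  show ?case
  proof (cases "A = {}")
    case True
    then show ?thesis by (intro bexI[of _ \<zero>]) auto
  next
    case False
    then obtain x where x: "x \<in> A" by blast
    then have xc: "x \<in> carrier G" using psubset by blast
    let ?C = "(\<lambda>h. h \<otimes>\<^bsub>G\<^esub> x) ` H"
    have C: "?C \<subseteq> A" "x \<in> ?C" using psubset.prems(2) x xc H.one_closed by (auto intro!: image_eqI[of _ _ "\<one>\<^bsub>G\<^esub>"])
    have Hc: "h \<in> carrier G" if "h \<in> H" for h using that H.subset by blast
    have cl: "h \<otimes>\<^bsub>G\<^esub> y \<notin> ?C" if h: "h \<in> H" and y: "y \<in> A - ?C" for h y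
    proof
      have yc: "y \<in> carrier G" using y psubset.prems(1) by blast
      assume "h \<otimes>\<^bsub>G\<^esub> y \<in> ?C"
      then obtain k where k: "k \<in> H" "h \<otimes>\<^bsub>G\<^esub> y = k \<otimes>\<^bsub>G\<^esub> x" by blast
      have "y = inv\<^bsub>G\<^esub> h \<otimes>\<^bsub>G\<^esub> (h \<otimes>\<^bsub>G\<^esub> y)" using h yc Hc by (simp add: G.m_assoc[symmetric])
      also have "\<dots> = inv\<^bsub>G\<^esub> h \<otimes>\<^bsub>G\<^esub> k \<otimes>\<^bsub>G\<^esub> x" using k h xc Hc by (simp add: G.m_assoc)
      finally show False using y k h H.m_closed H.m_inv_closed by blast
    qed
    have "A - ?C \<subset> A" using C x by blast
    then have "\<exists>r\<in>carrier R. (\<Oplus>x\<in>A - ?C. a x) = [card H] \<cdot> r"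
      by (rule psubset.IH) (use C psubset.prems cl in auto)
    then obtain r where r: "r \<in> carrier R" "(\<Oplus>x\<in>A - ?C. a x) = [card H] \<cdot> r" by blast
    have inj: "inj_on (\<lambda>h. h \<otimes>\<^bsub>G\<^esub> x) H" by (rule inj_onI) (use Hc xc in \<open>meson G.r_cancel\<close>)
    have "(\<Oplus>y\<in>?C. a y) = (\<Oplus>h\<in>H. a (h \<otimes>\<^bsub>G\<^esub> x))"
      using C psubset.prems by (intro finsum_reindex inj) auto
    also have "\<dots> = (\<Oplus>h\<in>H. a x)" using x psubset.prems by (intro finsum_cong') auto
    also have "\<dots> = [card H] \<cdot> a x" using x psubset.prems by (intro add.finprod_const) auto
    finally have e: "(\<Oplus>y\<in>?C. a y) = [card H] \<cdot> a x" .
    have "(\<Oplus>y\<in>A. a y) = (\<Oplus>y\<in>?C \<union> (A - ?C). a y)" using C by (simp add: Un_absorb1)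
    also have "\<dots> = (\<Oplus>y\<in>?C. a y) \<oplus> (\<Oplus>y\<in>A - ?C. a y)"
      using C psubset.prems psubset.hyps H(2) by (intro finsum_Un_disjoint) auto
    also have "\<dots> = [card H] \<cdot> (a x \<oplus> r)" using e r x psubset.prems by (simp add: add.nat_pow_distrib)
    finally show ?thesis using r x psubset.prems by blast
  qed
qed

text \<open>The augmentation \<open>1\<close> of an element invariant under the finite group
  generated by \<open>g\<close> is \<open>ord g\<close> times some \<open>r\<close>; multiples of
  \<open>1\<close> are central, so \<open>r\<close> is a two-sided inverse.\<close>

lemma order_unit_if_vn_regular:
  assumes reg: "vn_regular_ring RG" and nz: "\<one> \<noteq> \<zero>" and g: "g \<in> carrier G"
  shows "[G.ord g] \<cdot> \<one> \<in> Units R"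
proof -
  let ?H = "generate G {g}"
  interpret L: locally_finite_group G by (rule locally_finite_if_vn_regular[OF reg nz])
  have H: "subgroup ?H G" "finite ?H" using g G.generate_is_subgroup L.finite_generate by auto
  obtain a where a: "a \<in> carrier RG" "aug a = \<one>" "single \<one> g \<otimes>\<^bsub>RG\<^esub> a = a"
    using ex_invariant[OF reg, of "{g}"] g by auto
  have inv: "single \<one> h \<otimes>\<^bsub>RG\<^esub> a = a" if "h \<in> ?H" for h
    using invariant_generate[OF a(1) _ _ that] g a(3) by auto
  have eq: "a (h \<otimes>\<^bsub>G\<^esub> x) = a x" if "h \<in> ?H" "x \<in> carrier G" for h x
  proof -
    have "h \<in> carrier G" using that H(1) subgroup.subset by blast
    then show ?thesis
      using arg_cong[OF inv[OF that(1)], of "\<lambda>f. f (h \<otimes>\<^bsub>G\<^esub> x)"] that a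
      by (simp add: single_one_mult_apply G.m_assoc[symmetric])
  qed
  note c = RG_D[OF a(1)]
  have Hc: "?H \<subseteq> carrier G" using H(1) subgroup.subset by blast
  have "\<exists>r\<in>carrier R. (\<Oplus>x\<in>gr_support R G a. a x) = [card ?H] \<cdot> r"
    by (rule invariant_sum_multiple[OF H c(2,4)]) (use c eq Hc in \<open>auto simp: gr_support_def\<close>)
  then obtain r where r: "r \<in> carrier R" "\<one> = [G.ord g] \<cdot> r"
    using a(2) G.generate_pow_card[OF g] by (auto simp: aug_def)
  then have "([G.ord g] \<cdot> \<one>) \<otimes> r = \<one>" "r \<otimes> ([G.ord g] \<cdot> \<one>) = \<one>" using nat_multiple_eq[of r "G.ord g"] by simp_all
  then show ?thesis using r(1) by (auto simp: Units_def)
qed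

end

lemma (in unit_regular_ring) is_vn_regular: "vn_regular_ring R"
proof unfold_locales
  fix a assume "a \<in> carrier R"
  then show "\<exists>b\<in>carrier R. a \<otimes> b \<otimes> a = a" using unit_regular by (metis Units_closed)
qed

section \<open>Finite groups: von Neumann regularity\<close>

lemma (in ideal) finsum_mem:
  assumes "finite A" "\<And>a. a \<in> A \<Longrightarrow> f a \<in> I"
  shows "(\<Oplus>a\<in>A. f a) \<in> I"
  using assms
proof (induction A rule: finite_induct)
  case empty
  then show ?case using zero_closed by simp
next
  case (insert a A)
  then show ?case using Icarr by (subst finsum_insert) (auto intro: a_closed)
qed

lemma (in ring) left_idealI_closed:
  assumes "I \<subseteq> carrier R" "\<zero> \<in> I" "\<And>a b. a \<in> I \<Longrightarrow> b \<in> I \<Longrightarrow> a \<oplus> b \<in> I"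
    "\<And>a x. a \<in> I \<Longrightarrow> x \<in> carrier R \<Longrightarrow> x \<otimes> a \<in> I"
  shows "left_ideal I R"
proof (intro left_ideal.intro additive_subgroup.intro ring_axioms left_ideal_axioms.intro)
  show "subgroup I (add_monoid R)"
  proof (rule add.subgroupI)
    fix a assume a: "a \<in> I"
    have "\<ominus> \<one> \<otimes> a = \<ominus> a" using a assms(1) by (simp add: l_minus subsetD)
    then show "\<ominus> a \<in> I" using assms(4)[OF a, of "\<ominus> \<one>"] by simp
  qed (use assms in auto)
qed (use assms in auto)

text \<open>A left ideal containing \<open>I\<close> is determined by its image in the
  quotient.\<close>

lemma (in ideal) left_acc_containing:
  assumes N: "lr_noetherian_ring (R Quot I)" and L: "\<And>n::nat. left_ideal (L n) R" "\<And>n. I \<subseteq> L n"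
    "\<And>n. L n \<subseteq> L (Suc n)"
  shows "\<exists>N. \<forall>n\<ge>N. L n = L N"
proof -
  interpret h: ring_hom_ring R "R Quot I" "(+>) I" by (rule rcos_ring_hom_ring)
  interpret N: lr_noetherian_ring "R Quot I" by (rule N)
  let ?C = "\<lambda>n. (+>) I ` L n"
  have "left_ideal (?C n) (R Quot I)" for n
  proof -
    interpret L: left_ideal "L n" R by (rule L(1))
    show ?thesis
    proof (rule h.S.left_idealI_closed)
      show "?C n \<subseteq> carrier (R Quot I)" using L.a_subset by auto
      show "\<zero>\<^bsub>R Quot I\<^esub> \<in> ?C n" using L.zero_closed h.hom_zero by (metis imageI)
      fix a assume "a \<in> ?C n"
      then obtain x where x: "x \<in> L n" "a = I +> x" by blast
      have xc: "x \<in> carrier R" using x L.a_subset by blast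
      show "b \<otimes>\<^bsub>R Quot I\<^esub> a \<in> ?C n" if b: "b \<in> carrier (R Quot I)" for b
      proof -
        obtain y where y: "y \<in> carrier R" "b = I +> y" using b by (auto simp: rcos_carrier)
        have "b \<otimes>\<^bsub>R Quot I\<^esub> a = I +> (y \<otimes> x)" using x xc y by simp
        then show ?thesis using L.left_closed[OF x(1) y(1)] by blast
      qed
      fix b assume "b \<in> ?C n"
      then obtain y where y: "y \<in> L n" "b = I +> y" by blast
      then have "a \<oplus>\<^bsub>R Quot I\<^esub> b = I +> (x \<oplus> y)" using x xc L.a_subset by auto
      then show "a \<oplus>\<^bsub>R Quot I\<^esub> b \<in> ?C n" using L.a_closed[OF x(1) y(1)] by blast
    qed
  qed
  then obtain N where N: "\<And>n. n \<ge> N \<Longrightarrow> ?C n = ?C N"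
    using N.left_acc[of ?C] L(3) by blast
  have "L n = L N" if n: "n \<ge> N" for n
  proof
    show "L N \<subseteq> L n" using n L(3) by (rule lift_Suc_mono_le[rotated]) 
    interpret L: left_ideal "L N" R by (rule L(1))
    interpret Ln: left_ideal "L n" R by (rule L(1))
    show "L n \<subseteq> L N"
    proof
      fix x assume x: "x \<in> L n"
      then obtain y where y: "y \<in> L N" "I +> x = I +> y" using N[OF n] by blast
      have c: "x \<in> carrier R" "y \<in> carrier R" using x y L.a_subset Ln.a_subset by auto
      then have "x \<ominus> y \<in> L N" using rcos_eq_iff y L(2) by blast
      then have "(x \<ominus> y) \<oplus> y \<in> L N" using y L.a_closed by blast
      moreover have "(x \<ominus> y) \<oplus> y = x" using c by algebra
      ultimately show "x \<in> L N" by simp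
    qed
  qed
  then show ?thesis by blast
qed

section \<open>Left linear endomorphisms of the group ring\<close>

context group_ring_setup
begin

abbreviation const :: "'a \<Rightarrow> 'g \<Rightarrow> 'a" where "const r \<equiv> single r \<one>\<^bsub>G\<^esub>"

lemma const_mult_apply:
  "\<lbrakk>r \<in> carrier R; v \<in> carrier RG; x \<in> carrier G\<rbrakk> \<Longrightarrow> (const r \<otimes>\<^bsub>RG\<^esub> v) x = r \<otimes> v x"
  by (simp add: single_mult_apply)

lemma single_eq_const_mult:
  "\<lbrakk>r \<in> carrier R; g \<in> carrier G\<rbrakk> \<Longrightarrow> single r g = const r \<otimes>\<^bsub>RG\<^esub> single \<one> g"
  by (simp add: single_mult_single)

sublocale const: ring_hom_ring R RG const
  by (rule ring_hom_ringI2[OF ring_axioms RG.ring_axioms], rule ring_hom_memI)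
    (auto simp: single_add single_mult_single one_eq_single)

lemma minus_apply:
  "\<lbrakk>f \<in> carrier RG; k \<in> carrier RG; x \<in> carrier G\<rbrakk> \<Longrightarrow> (f \<ominus>\<^bsub>RG\<^esub> k) x = f x \<ominus> k x"
  by (simp add: RG.minus_eq minus_eq RG_add_apply uminus_apply)

text \<open>Scalars act through \<open>const\<close> on the left: these are the endomorphisms of
  \<open>RG\<close> as a free left \<open>R\<close>-module on \<open>G\<close>, which for finite
  \<open>G\<close> are matrices over \<open>R\<close>.\<close>

definition lin :: "(('g \<Rightarrow> 'a) \<Rightarrow> ('g \<Rightarrow> 'a)) \<Rightarrow> bool"
  where "lin \<phi> \<longleftrightarrow> (\<forall>v\<in>carrier RG. \<phi> v \<in> carrier RG) \<and>
    (\<forall>v\<in>carrier RG. \<forall>w\<in>carrier RG. \<phi> (v \<oplus>\<^bsub>RG\<^esub> w) = \<phi> v \<oplus>\<^bsub>RG\<^esub> \<phi> w) \<and>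
    (\<forall>r\<in>carrier R. \<forall>v\<in>carrier RG. \<phi> (const r \<otimes>\<^bsub>RG\<^esub> v) = const r \<otimes>\<^bsub>RG\<^esub> \<phi> v)"

lemma lin_closed: "lin \<phi> \<Longrightarrow> v \<in> carrier RG \<Longrightarrow> \<phi> v \<in> carrier RG"
  by (simp add: lin_def)

lemma lin_add: "\<lbrakk>lin \<phi>; v \<in> carrier RG; w \<in> carrier RG\<rbrakk> \<Longrightarrow> \<phi> (v \<oplus>\<^bsub>RG\<^esub> w) = \<phi> v \<oplus>\<^bsub>RG\<^esub> \<phi> w"
  by (simp add: lin_def)

lemma lin_scale: "\<lbrakk>lin \<phi>; r \<in> carrier R; v \<in> carrier RG\<rbrakk> \<Longrightarrow> \<phi> (const r \<otimes>\<^bsub>RG\<^esub> v) = const r \<otimes>\<^bsub>RG\<^esub> \<phi> v"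
  by (simp add: lin_def)

lemma lin_zero:
  assumes "lin \<phi>"
  shows "\<phi> \<zero>\<^bsub>RG\<^esub> = \<zero>\<^bsub>RG\<^esub>"
  using lin_scale[OF assms zero_closed RG.zero_closed] lin_closed[OF assms RG.zero_closed] by simp

lemma lin_minus:
  assumes l: "lin \<phi>" and v: "v \<in> carrier RG" "w \<in> carrier RG"
  shows "\<phi> (v \<ominus>\<^bsub>RG\<^esub> w) = \<phi> v \<ominus>\<^bsub>RG\<^esub> \<phi> w"
proof -
  have c: "\<phi> v \<in> carrier RG" "\<phi> w \<in> carrier RG" "\<phi> (v \<ominus>\<^bsub>RG\<^esub> w) \<in> carrier RG" using l v by (auto intro: lin_closed)
  have "(v \<ominus>\<^bsub>RG\<^esub> w) \<oplus>\<^bsub>RG\<^esub> w = v" using v by (simp add: RG.minus_eq RG.a_assoc RG.l_neg)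
  then have "\<phi> v = \<phi> (v \<ominus>\<^bsub>RG\<^esub> w) \<oplus>\<^bsub>RG\<^esub> \<phi> w" using lin_add[OF l, of "v \<ominus>\<^bsub>RG\<^esub> w" w] v by simp
  then show ?thesis using c by (simp add: RG.minus_eq RG.a_assoc RG.r_neg)
qed

lemma lin_comp: "\<lbrakk>lin \<phi>; lin \<psi>\<rbrakk> \<Longrightarrow> lin (\<lambda>v. \<phi> (\<psi> v))"
  by (simp add: lin_def)

lemma lin_plus: "\<lbrakk>lin \<phi>; lin \<psi>\<rbrakk> \<Longrightarrow> lin (\<lambda>v. \<phi> v \<oplus>\<^bsub>RG\<^esub> \<psi> v)"
  by (simp add: lin_def RG.r_distr RG.a_ac)

lemma lin_diff:
  assumes "lin \<phi>" "lin \<psi>"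
  shows "lin (\<lambda>v. \<phi> v \<ominus>\<^bsub>RG\<^esub> \<psi> v)"
  using assms by (simp add: lin_def RG.r_distr_minus RG.minus_eq RG.a_ac RG.minus_add RG.r_distr RG.r_minus)

lemma lin_ident: "lin (\<lambda>v. v)"
  by (simp add: lin_def)

text \<open>The matrix whose only entry is \<open>c\<close>, in row \<open>j\<close> and column
  \<open>i\<close>; it serves to clear a single entry of another matrix.\<close>

lemma lin_coordinate:
  assumes "c \<in> carrier R" "i \<in> carrier G" "j \<in> carrier G"
  shows "lin (\<lambda>v. single (v j \<otimes> c) i)"
  using assms RG_D(1)
  by (auto simp: lin_def RG_add_apply const_mult_apply l_distr single_add single_mult_single m_assoc)

lemma lin_right_mult: "a \<in> carrier RG \<Longrightarrow> lin (\<lambda>v. v \<otimes>\<^bsub>RG\<^esub> a)"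
  by (simp add: lin_def RG.l_distr RG.m_assoc)

lemma lin_single: "\<lbrakk>lin \<phi>; r \<in> carrier R; g \<in> carrier G\<rbrakk> \<Longrightarrow> \<phi> (single r g) = const r \<otimes>\<^bsub>RG\<^esub> \<phi> (single \<one> g)"
  using lin_scale[of \<phi> r "single \<one> g"] single_eq_const_mult[of r g] by simp

definition reg_map :: "(('g \<Rightarrow> 'a) \<Rightarrow> ('g \<Rightarrow> 'a)) \<Rightarrow> bool"
  where "reg_map \<phi> \<longleftrightarrow> (\<exists>\<psi>. lin \<psi> \<and> (\<forall>v\<in>carrier RG. \<phi> (\<psi> (\<phi> v)) = \<phi> v))"

text \<open>Put \<open>\<phi>' = \<phi> - \<phi> \<gamma> \<phi>\<close> with inner inverse
  \<open>\<delta>\<close>. Then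
  \<open>\<phi> = \<phi> \<gamma> \<phi> + \<phi>' \<delta> \<phi>'\<close> and \<open>\<phi>' =
  \<phi> (1 - \<gamma> \<phi>) = (1 - \<phi> \<gamma>) \<phi>\<close>, so \<open>\<gamma> + (1 -
  \<gamma> \<phi>) \<delta> (1 - \<phi> \<gamma>)\<close> is an inner inverse of
  \<open>\<phi>\<close>.\<close>

lemma reg_map_McCoy:
  assumes \<phi>: "lin \<phi>" and \<gamma>: "lin \<gamma>" and reg: "reg_map (\<lambda>v. \<phi> v \<ominus>\<^bsub>RG\<^esub> \<phi> (\<gamma> (\<phi> v)))"
  shows "reg_map \<phi>"
proof -
  let ?\<phi>' = "\<lambda>v. \<phi> v \<ominus>\<^bsub>RG\<^esub> \<phi> (\<gamma> (\<phi> v))"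
  obtain \<delta> where \<delta>: "lin \<delta>" "\<And>v. v \<in> carrier RG \<Longrightarrow> ?\<phi>' (\<delta> (?\<phi>' v)) = ?\<phi>' v"
    using reg by (auto simp: reg_map_def)
  let ?t = "\<lambda>w. \<delta> (w \<ominus>\<^bsub>RG\<^esub> \<phi> (\<gamma> w))"
  let ?\<psi> = "\<lambda>w. \<gamma> w \<oplus>\<^bsub>RG\<^esub> (?t w \<ominus>\<^bsub>RG\<^esub> \<gamma> (\<phi> (?t w)))"
  have t: "lin ?t" by (intro lin_comp[OF \<delta>(1)] lin_diff lin_ident lin_comp[OF \<phi> \<gamma>])
  have "lin ?\<psi>" by (intro lin_plus[OF \<gamma>] lin_diff t lin_comp[OF \<gamma>] lin_comp[OF \<phi>])
  moreover have "\<phi> (?\<psi> (\<phi> v)) = \<phi> v" if v: "v \<in> carrier RG" for v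
  proof -
    have c: "\<phi> v \<in> carrier RG" "\<gamma> (\<phi> v) \<in> carrier RG" "?t (\<phi> v) \<in> carrier RG" "\<phi> (\<gamma> (\<phi> v)) \<in> carrier RG"
      using v \<phi> \<gamma> t by (auto intro: lin_closed)
    have "\<phi> (?\<psi> (\<phi> v)) = \<phi> (\<gamma> (\<phi> v)) \<oplus>\<^bsub>RG\<^esub> ?\<phi>' (?t (\<phi> v))"
      using c \<phi> \<gamma> by (simp add: lin_add lin_minus lin_closed)
    also have "?\<phi>' (?t (\<phi> v)) = ?\<phi>' v" using \<delta>(2)[OF v] .
    also have "\<phi> (\<gamma> (\<phi> v)) \<oplus>\<^bsub>RG\<^esub> ?\<phi>' v = \<phi> v"
      using c RG.a_assoc[of "\<phi> (\<gamma> (\<phi> v))" "\<ominus>\<^bsub>RG\<^esub> \<phi> (\<gamma> (\<phi> v))" "\<phi> v"]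
      by (simp add: RG.minus_eq RG.a_comm[of "\<phi> v"] RG.r_neg flip: RG.a_assoc)
    finally show ?thesis .
  qed
  ultimately show ?thesis unfolding reg_map_def by blast
qed

lemma lin_eq_zero:
  assumes \<phi>: "lin \<phi>" and z: "\<And>g. g \<in> carrier G \<Longrightarrow> \<phi> (single \<one> g) = \<zero>\<^bsub>RG\<^esub>" and v: "v \<in> carrier RG"
  shows "\<phi> v = \<zero>\<^bsub>RG\<^esub>"
  using v
proof (induction rule: sum_of_singles_induct)
  case zero
  then show ?case by (rule lin_zero[OF \<phi>])
next
  case (add a b)
  then show ?case using lin_add[OF \<phi>] by simp
next
  case (single g)
  then show ?case using lin_single[OF \<phi>] z RG_D(1)[OF v] by simp
qed

end

locale finite_group_ring_setup = group_ring_setup R G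
  for R :: "('a, 'm) ring_scheme" (structure) and G :: "('g, 'n) monoid_scheme" +
  assumes finite_group: "finite (carrier G)"
begin

text \<open>View \<open>\<phi>\<close> as the matrix with entries \<open>\<phi>(k)(l)\<close>. By McCoy's lemma one may kill the entries of a
  row one after the other without touching rows and entries that are already zero.\<close>

lemma reg_map_rows:
  assumes reg: "vn_regular_ring R" and K: "finite K" "K \<subseteq> carrier G" and \<phi>: "lin \<phi>"
    and z: "\<And>k. k \<in> carrier G - K \<Longrightarrow> \<phi> (single \<one> k) = \<zero>\<^bsub>RG\<^esub>"
  shows "reg_map \<phi>"
  using K \<phi> z
proof (induction K arbitrary: \<phi> rule: finite_induct)
  case empty
  then have "\<phi> v = \<zero>\<^bsub>RG\<^esub>" if "v \<in> carrier RG" for v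
    using lin_eq_zero[OF empty(2) _ that] empty(3) by blast
  then show ?case using lin_ident lin_closed[OF empty(2)] unfolding reg_map_def by (intro exI[of _ "\<lambda>v. v"]) auto
next
  case (insert i K)
  interpret V: vn_regular_ring R by (rule reg)
  have i: "i \<in> carrier G" and K: "K \<subseteq> carrier G" using insert by auto
  \<comment> \<open>The inner induction runs over the columns in which row \<open>i\<close> may be
    nonzero; once the row has vanished, the outer hypothesis takes over.\<close>
  have "reg_map \<phi>" if "finite L" "L \<subseteq> carrier G" "lin \<phi>" "\<And>l. l \<in> carrier G - L \<Longrightarrow> \<phi> (single \<one> i) l = \<zero>"
    "\<And>k. k \<in> carrier G - insert i K \<Longrightarrow> \<phi> (single \<one> k) = \<zero>\<^bsub>RG\<^esub>" for L \<phi>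
    using that
  proof (induction L arbitrary: \<phi> rule: finite_induct)
    case empty
    have "\<phi> (single \<one> i) = \<zero>\<^bsub>RG\<^esub>"
      by (rule RG_ext) (use empty i lin_closed in \<open>auto simp: zero_apply\<close>)
    then show ?case using empty K by (intro insert.IH) auto
  next
    case (insert j L)
    have j: "j \<in> carrier G" using insert by auto
    have c: "\<phi> v x \<in> carrier R" if "v \<in> carrier RG" "x \<in> carrier G" for v x
      using RG_D(1)[OF lin_closed[OF insert.prems(2) that(1)] that(2)] .
    obtain c where c': "c \<in> carrier R" "\<phi> (single \<one> i) j \<otimes> c \<otimes> \<phi> (single \<one> i) j = \<phi> (single \<one> i) j"
      using V.vn_regular c[of "single \<one> i" j] i j by auto
    \<comment> \<open>As \<open>c\<close> is an inner inverse of the entry at row \<open>i\<close>,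
      column \<open>j\<close>, the correction cancels that entry. Every other entry of row
      \<open>i\<close> changes by a left multiple of itself, so zeros stay zero.\<close>
    let ?\<gamma> = "\<lambda>v. single (v j \<otimes> c) i"
    let ?\<phi>' = "\<lambda>v. \<phi> v \<ominus>\<^bsub>RG\<^esub> \<phi> (?\<gamma> (\<phi> v))"
    have \<gamma>: "lin ?\<gamma>" using c' i j by (intro lin_coordinate)
    have \<phi>: "lin \<phi>" by (rule insert.prems)
    have eq: "?\<phi>' v x = \<phi> v x \<ominus> \<phi> v j \<otimes> c \<otimes> \<phi> (single \<one> i) x" if v: "v \<in> carrier RG" and x: "x \<in> carrier G" for v x
    proof -
      have r: "\<phi> v j \<otimes> c \<in> carrier R" using c[OF v j] c' by simp
      have s: "single \<one> i \<in> carrier RG" using i by simp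
      show ?thesis
        using lin_closed[OF \<phi> v] lin_closed[OF \<phi> s] r x i lin_single[OF \<phi> r i]
        by (simp add: minus_apply const_mult_apply)
    qed
    have zero: "?\<phi>' v = \<zero>\<^bsub>RG\<^esub>" if v: "v \<in> carrier RG" "\<phi> v = \<zero>\<^bsub>RG\<^esub>" for v
      using lin_zero[OF \<gamma>] lin_zero[OF \<phi>] v(2) by (simp only: RG.minus_zero_eq RG.zero_closed)
    have "reg_map ?\<phi>'"
    proof (rule insert.IH)
      show "L \<subseteq> carrier G" using insert.prems by auto
      show "lin ?\<phi>'" by (intro lin_diff lin_comp[OF \<phi>] lin_comp[OF \<gamma>] \<phi>)
      fix l assume l: "l \<in> carrier G - L"
      show "?\<phi>' (single \<one> i) l = \<zero>"
      proof (cases "l = j")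
        case True
        then show ?thesis using eq[of "single \<one> i" l] i l c' c by simp
      next
        case False
        then have "\<phi> (single \<one> i) l = \<zero>" using insert.prems(3) l by simp
        then show ?thesis using eq[of "single \<one> i" l] i j l c' c by simp
      qed
    next
      fix k assume k: "k \<in> carrier G - insert i K"
      show "?\<phi>' (single \<one> k) = \<zero>\<^bsub>RG\<^esub>" by (rule zero) (use k insert.prems(4) in auto)
    qed
    then show ?case by (rule reg_map_McCoy[OF \<phi> \<gamma>])
  qed
  from this[OF finite_group order_refl insert.prems(2)] insert.prems(3) show ?case by blast
qed

text \<open>Right multiplication by \<open>a\<close> has an \<open>R\<close>-linear inner inverse
  \<open>\<psi>\<close>. Its sum \<open>F\<close> over all group translates is linear over
  \<open>RG\<close>, hence right multiplication by the value of \<open>F\<close> at one, and this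
  value is an inner inverse of \<open>a\<close> up to the factor
  \<open>card (carrier G)\<close>.\<close>

lemma vn_regular_group_ring:
  assumes reg: "vn_regular_ring R" and unit: "[card (carrier G)] \<cdot> \<one> \<in> Units R"
  shows "vn_regular_ring RG"
proof unfold_locales
  fix a assume a: "a \<in> carrier RG"
  let ?n = "card (carrier G)"
  have ra: "lin (\<lambda>v. v \<otimes>\<^bsub>RG\<^esub> a)" using a by (rule lin_right_mult)
  have "reg_map (\<lambda>v. v \<otimes>\<^bsub>RG\<^esub> a)" by (rule reg_map_rows[OF reg finite_group order_refl ra]) auto
  then obtain \<psi> where \<psi>: "lin \<psi>" "\<And>v. v \<in> carrier RG \<Longrightarrow> \<psi> (v \<otimes>\<^bsub>RG\<^esub> a) \<otimes>\<^bsub>RG\<^esub> a = v \<otimes>\<^bsub>RG\<^esub> a"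
    by (auto simp: reg_map_def)
  define F where "F v = (\<Oplus>\<^bsub>RG\<^esub>g\<in>carrier G. single \<one> (inv\<^bsub>G\<^esub> g) \<otimes>\<^bsub>RG\<^esub> \<psi> (single \<one> g \<otimes>\<^bsub>RG\<^esub> v))" for v
  have term_closed: "single \<one> (inv\<^bsub>G\<^esub> g) \<otimes>\<^bsub>RG\<^esub> \<psi> (single \<one> g \<otimes>\<^bsub>RG\<^esub> v) \<in> carrier RG"
    if "g \<in> carrier G" "v \<in> carrier RG" for g v using that lin_closed[OF \<psi>(1)] by simp
  have Fc: "F v \<in> carrier RG" if "v \<in> carrier RG" for v
    unfolding F_def using term_closed that by (intro RG.finsum_closed) auto
  define T where "T g = single \<one> (inv\<^bsub>G\<^esub> g) \<otimes>\<^bsub>RG\<^esub> \<psi> (single \<one> g)" for g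
  have T: "T g \<in> carrier RG" if "g \<in> carrier G" for g using that lin_closed[OF \<psi>(1)] by (simp add: T_def)
  have F1: "F \<one>\<^bsub>RG\<^esub> = (\<Oplus>\<^bsub>RG\<^esub>g\<in>carrier G. T g)"
    unfolding F_def by (rule RG.finsum_cong') (use T in \<open>auto simp: T_def\<close>)
  have Flin: "F v = v \<otimes>\<^bsub>RG\<^esub> F \<one>\<^bsub>RG\<^esub>" if v: "v \<in> carrier RG" for v
    using v
  proof (induction rule: sum_of_singles_induct)
    case zero
    have "F \<zero>\<^bsub>RG\<^esub> = \<zero>\<^bsub>RG\<^esub>" unfolding F_def
      by (rule RG.add.finprod_one_eqI) (simp add: lin_zero[OF \<psi>(1)])
    then show ?case using Fc by simp
  next
    case (add v w)
    have "F (v \<oplus>\<^bsub>RG\<^esub> w) = (\<Oplus>\<^bsub>RG\<^esub>g\<in>carrier G. single \<one> (inv\<^bsub>G\<^esub> g) \<otimes>\<^bsub>RG\<^esub> \<psi> (single \<one> g \<otimes>\<^bsub>RG\<^esub> v) \<oplus>\<^bsub>RG\<^esub>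
        single \<one> (inv\<^bsub>G\<^esub> g) \<otimes>\<^bsub>RG\<^esub> \<psi> (single \<one> g \<otimes>\<^bsub>RG\<^esub> w))"
      unfolding F_def
      by (rule RG.finsum_cong') (use add(1,2) term_closed lin_closed[OF \<psi>(1)] in \<open>auto simp: RG.r_distr lin_add[OF \<psi>(1)]\<close>)
    also have "\<dots> = F v \<oplus>\<^bsub>RG\<^esub> F w" unfolding F_def using add(1,2) term_closed by (intro RG.finsum_addf) auto
    finally show ?case using add Fc by (simp add: RG.l_distr)
  next
    case (single k)
    let ?s = "single (v k) k"
    have s: "?s \<in> carrier RG" "v k \<in> carrier R" using single RG_D(1)[OF v] by auto
    have inj: "inj_on (\<lambda>g. g \<otimes>\<^bsub>G\<^esub> k) (carrier G)" using single by (auto intro!: inj_onI)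
    have "F ?s = (\<Oplus>\<^bsub>RG\<^esub>g\<in>carrier G. ?s \<otimes>\<^bsub>RG\<^esub> T (g \<otimes>\<^bsub>G\<^esub> k))"
      unfolding F_def
    proof (rule RG.finsum_cong')
      fix g assume g: "g \<in> carrier G"
      have gk: "g \<otimes>\<^bsub>G\<^esub> k \<in> carrier G" and p: "\<psi> (single \<one> (g \<otimes>\<^bsub>G\<^esub> k)) \<in> carrier RG"
        using g single lin_closed[OF \<psi>(1)] by auto
      have "single \<one> (inv\<^bsub>G\<^esub> g) \<otimes>\<^bsub>RG\<^esub> \<psi> (single \<one> g \<otimes>\<^bsub>RG\<^esub> ?s)
          = single \<one> (inv\<^bsub>G\<^esub> g) \<otimes>\<^bsub>RG\<^esub> (const (v k) \<otimes>\<^bsub>RG\<^esub> \<psi> (single \<one> (g \<otimes>\<^bsub>G\<^esub> k)))"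
        using g single s gk by (simp add: single_mult_single lin_single[OF \<psi>(1), of "v k"])
      also have "\<dots> = single (v k) (inv\<^bsub>G\<^esub> g) \<otimes>\<^bsub>RG\<^esub> \<psi> (single \<one> (g \<otimes>\<^bsub>G\<^esub> k))"
        using g s p by (simp add: single_mult_single flip: RG.m_assoc)
      also have "\<dots> = ?s \<otimes>\<^bsub>RG\<^esub> T (g \<otimes>\<^bsub>G\<^esub> k)"
        using g s p single by (simp add: T_def single_mult_single G.inv_mult_group flip: RG.m_assoc G.m_assoc)
      finally show "single \<one> (inv\<^bsub>G\<^esub> g) \<otimes>\<^bsub>RG\<^esub> \<psi> (single \<one> g \<otimes>\<^bsub>RG\<^esub> ?s) = ?s \<otimes>\<^bsub>RG\<^esub> T (g \<otimes>\<^bsub>G\<^esub> k)" .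
    qed (use s T single in auto)
    also have "\<dots> = ?s \<otimes>\<^bsub>RG\<^esub> (\<Oplus>\<^bsub>RG\<^esub>g\<in>carrier G. T (g \<otimes>\<^bsub>G\<^esub> k))"
      using s T single finite_group by (intro RG.finsum_rdistr[symmetric]) auto
    \<comment> \<open>Translation by \<open>k\<close> permutes the finite group, so the sum does not
      depend on \<open>k\<close>; this is where averaging creates linearity over group
      elements.\<close>
    also have "(\<Oplus>\<^bsub>RG\<^esub>g\<in>carrier G. T (g \<otimes>\<^bsub>G\<^esub> k)) = (\<Oplus>\<^bsub>RG\<^esub>g\<in>(\<lambda>g. g \<otimes>\<^bsub>G\<^esub> k) ` carrier G. T g)"
      by (rule RG.finsum_reindex[symmetric]) (use T single inj in auto)
    also have "(\<lambda>g. g \<otimes>\<^bsub>G\<^esub> k) ` carrier G = carrier G"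
      by (rule endo_inj_surj[OF finite_group _ inj]) (use single in auto)
    finally show ?case by (simp only: F1)
  qed
  have "a \<otimes>\<^bsub>RG\<^esub> F \<one>\<^bsub>RG\<^esub> \<otimes>\<^bsub>RG\<^esub> a = F a \<otimes>\<^bsub>RG\<^esub> a" using Flin[OF a] by simp
  also have "\<dots> = (\<Oplus>\<^bsub>RG\<^esub>g\<in>carrier G. single \<one> (inv\<^bsub>G\<^esub> g) \<otimes>\<^bsub>RG\<^esub> \<psi> (single \<one> g \<otimes>\<^bsub>RG\<^esub> a) \<otimes>\<^bsub>RG\<^esub> a)"
    unfolding F_def using a finite_group term_closed by (intro RG.finsum_ldistr) auto
  also have "\<dots> = (\<Oplus>\<^bsub>RG\<^esub>g\<in>carrier G. a)"
  proof (rule RG.finsum_cong')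
    fix g assume g: "g \<in> carrier G"
    have "\<psi> (single \<one> g \<otimes>\<^bsub>RG\<^esub> a) \<otimes>\<^bsub>RG\<^esub> a = single \<one> g \<otimes>\<^bsub>RG\<^esub> a" using \<psi>(2) g by simp
    then have "single \<one> (inv\<^bsub>G\<^esub> g) \<otimes>\<^bsub>RG\<^esub> \<psi> (single \<one> g \<otimes>\<^bsub>RG\<^esub> a) \<otimes>\<^bsub>RG\<^esub> a
        = single \<one> (inv\<^bsub>G\<^esub> g) \<otimes>\<^bsub>RG\<^esub> (single \<one> g \<otimes>\<^bsub>RG\<^esub> a)"
      using g a lin_closed[OF \<psi>(1), of "single \<one> g \<otimes>\<^bsub>RG\<^esub> a"] by (simp add: RG.m_assoc)
    also have "\<dots> = a" using g a by (simp add: single_mult_single flip: RG.m_assoc one_eq_single)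
    finally show "single \<one> (inv\<^bsub>G\<^esub> g) \<otimes>\<^bsub>RG\<^esub> \<psi> (single \<one> g \<otimes>\<^bsub>RG\<^esub> a) \<otimes>\<^bsub>RG\<^esub> a = a" .
  qed (use a in auto)
  also have "\<dots> = [?n] \<cdot>\<^bsub>RG\<^esub> a" using a by (intro RG.add.finprod_const) auto
  finally have aFa: "a \<otimes>\<^bsub>RG\<^esub> F \<one>\<^bsub>RG\<^esub> \<otimes>\<^bsub>RG\<^esub> a = [?n] \<cdot>\<^bsub>RG\<^esub> a" .
  obtain u where u: "u \<in> carrier R" "([?n] \<cdot> \<one>) \<otimes> u = \<one>" "u \<otimes> ([?n] \<cdot> \<one>) = \<one>"
    using unit by (auto simp: Units_def)
  let ?w = "const u" and ?N = "[?n] \<cdot>\<^bsub>RG\<^esub> \<one>\<^bsub>RG\<^esub>"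
  have const_mult: "const ([m] \<cdot> r) = [m] \<cdot>\<^bsub>RG\<^esub> const r" if "r \<in> carrier R" for m :: nat and r
    by (induction m) (use that in simp_all)
  have w: "?w \<in> carrier RG" "?N \<in> carrier RG" using u by auto
  have N: "?N = const ([?n] \<cdot> \<one>)" using const_mult[OF one_closed] by simp
  have wN: "?w \<otimes>\<^bsub>RG\<^esub> ?N = \<one>\<^bsub>RG\<^esub>" "?N \<otimes>\<^bsub>RG\<^esub> ?w = \<one>\<^bsub>RG\<^esub>"
    unfolding N using u by (simp_all flip: const.hom_mult)
  have Na: "?N \<otimes>\<^bsub>RG\<^esub> a = a \<otimes>\<^bsub>RG\<^esub> ?N" using RG.nat_multiple_eq[OF a, of ?n] by simp
  have wa: "?w \<otimes>\<^bsub>RG\<^esub> a = a \<otimes>\<^bsub>RG\<^esub> ?w"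
    using Na wN w a by (metis RG.m_assoc RG.m_closed RG.l_one RG.r_one)
  have F: "F \<one>\<^bsub>RG\<^esub> \<in> carrier RG" using Fc by simp
  have "a \<otimes>\<^bsub>RG\<^esub> (?w \<otimes>\<^bsub>RG\<^esub> F \<one>\<^bsub>RG\<^esub>) \<otimes>\<^bsub>RG\<^esub> a = ?w \<otimes>\<^bsub>RG\<^esub> (a \<otimes>\<^bsub>RG\<^esub> F \<one>\<^bsub>RG\<^esub> \<otimes>\<^bsub>RG\<^esub> a)"
    using wa w a F by (metis RG.m_assoc RG.m_closed)
  also have "\<dots> = a" unfolding aFa RG.nat_multiple_eq(1)[OF a] using wN w a by (simp flip: RG.m_assoc)
  finally show "\<exists>b\<in>carrier RG. a \<otimes>\<^bsub>RG\<^esub> b \<otimes>\<^bsub>RG\<^esub> a = a" using w F by blast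
qed

end

section \<open>Finite groups: orthogonal families, and reduction of locally finite groups\<close>

text \<open>Cauchy's theorem: Sylow's theorem with exponent \<open>1\<close> provides a subgroup of
  order \<open>p\<close>, and a nontrivial element of it has order \<open>p\<close>.\<close>

lemma (in group) ex_element_of_prime_order:
  assumes fin: "finite (carrier G)" and p: "Factorial_Ring.prime p" "p dvd order G"
  shows "\<exists>g\<in>carrier G. ord g = p"
proof -
  obtain m where "order G = p ^ 1 * m" using p by auto
  then obtain K where K: "subgroup K G" "card K = p"
    using sylow_thm[OF p(1) group_axioms _ fin, of 1 m] by auto
  interpret K: subgroup K G by (rule K(1))
  interpret KG: group "G\<lparr>carrier := K\<rparr>" using K(1) by (rule subgroup_imp_group)
  have "K \<noteq> {\<one>}" using K(2) p(1) by auto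
  then obtain g where g: "g \<in> K" "g \<noteq> \<one>" using K.one_closed by blast
  have gc: "g \<in> carrier G" using g by simp
  have "g [^]\<^bsub>G\<lparr>carrier := K\<rparr>\<^esub> p = \<one>" using KG.pow_order_eq_1[of g] g K(2) by (simp add: order_def)
  then have "g [^] p = \<one>" using nat_pow_consistent by metis
  then have "ord g dvd p" using gc pow_eq_id by blast
  moreover have "ord g \<noteq> 1" using g gc ord_eq_1 by blast
  ultimately show ?thesis using gc p(1) prime_nat_iff by blast
qed

text \<open>The order of a finite group need not be the order of one of its elements, but its prime
  divisors are; invertibility is therefore assembled prime by prime.\<close>

lemma (in ring) nat_multiple_unit:
  fixes n :: nat
  assumes "n > 0" and "\<And>p. Factorial_Ring.prime p \<Longrightarrow> p dvd n \<Longrightarrow> [p] \<cdot> \<one> \<in> Units R"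
  shows "[n] \<cdot> \<one> \<in> Units R"
  using assms
proof (induction n rule: less_induct)
  case (less n)
  show ?case
  proof (cases "n = 1")
    case False
    then obtain p where p: "Factorial_Ring.prime p" "p dvd n" using prime_factor_nat by blast
    then obtain m where m: "n = p * m" by blast
    have "m > 0" using m less.prems(1) by (cases m) auto
    moreover from this have "m < n" using m prime_gt_1_nat[OF p(1)] by simp
    ultimately have "m > 0" "m < n" .
    then have "[m] \<cdot> \<one> \<in> Units R" using less.prems(2) m less.IH[of m] by (metis dvd_mult)
    moreover have "[p] \<cdot> \<one> \<in> Units R" using less.prems(2) p by blast
    moreover have "[n] \<cdot> \<one> = ([p] \<cdot> \<one>) \<otimes> ([m] \<cdot> \<one>)"
      using nat_multiple_eq(1)[of "[m] \<cdot> \<one>" p] add.nat_pow_pow[of \<one> p m] unfolding m by (simp add: mult.commute[of p m])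
    ultimately show ?thesis by simp
  qed simp
qed

section \<open>Contraction of prime ideals to the coefficient ring\<close>

context group_ring_setup
begin

lemma coefficients_in_imp_mem:
  assumes P: "ideal P RG" and f: "f \<in> carrier RG" and c: "\<And>g. g \<in> carrier G \<Longrightarrow> const (f g) \<in> P"
  shows "f \<in> P"
  using f
proof (induction rule: sum_of_singles_induct)
  case zero
  then show ?case using P by (simp add: ideal_def additive_subgroup.zero_closed)
next
  case (add a b)
  then show ?case using P by (simp add: ideal_def additive_subgroup.a_closed)
next
  case (single g)
  then have "single (f g) g = const (f g) \<otimes>\<^bsub>RG\<^esub> single \<one> g"
    using RG_D(1)[OF f] by (intro single_eq_const_mult)
  then show ?case using ideal.I_r_closed[OF P c[OF single], of "single \<one> g"] single by simp
qed

lemma coefficient_ideal: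
  assumes "ideal I R"
  shows "ideal {f \<in> carrier RG. \<forall>g\<in>carrier G. f g \<in> I} RG" (is "ideal ?J RG")
proof -
  interpret I: ideal I R by (rule assms)
  show ?thesis
  proof (rule RG.idealI_closed)
    show "\<zero>\<^bsub>RG\<^esub> \<in> ?J" by (simp add: zero_apply I.zero_closed)
  next
    fix a b assume "a \<in> ?J" "b \<in> ?J"
    then show "a \<oplus>\<^bsub>RG\<^esub> b \<in> ?J" by (simp add: RG_add_apply I.a_closed)
  next
    fix a x assume a: "a \<in> ?J" and x: "x \<in> carrier RG"
    then have ac: "a \<in> carrier RG" by simp
    note ca = RG_D[OF ac] and cx = RG_D[OF x]
    have "(x \<otimes>\<^bsub>RG\<^esub> a) y \<in> I" if "y \<in> carrier G" for y
      unfolding RG_mult_eq[OF x ac cx(2) order_refl cx(4) that]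
      using a cx that by (intro I.finsum_mem) (auto intro!: I.I_l_closed simp: gr_support_def)
    then show "x \<otimes>\<^bsub>RG\<^esub> a \<in> ?J" using ac x by simp
    have "(a \<otimes>\<^bsub>RG\<^esub> x) y \<in> I" if "y \<in> carrier G" for y
      unfolding RG_mult_eq[OF ac x ca(2) order_refl ca(4) that]
      using a ca(2) cx that by (intro I.finsum_mem) (auto intro!: I.I_r_closed simp: gr_support_def)
    then show "a \<otimes>\<^bsub>RG\<^esub> x \<in> ?J" using ac x by simp
  qed auto
qed

text \<open>Extend \<open>I\<close> and \<open>J\<close> to the ideals of \<open>RG\<close> with
  coefficients in them. The coefficients of a product lie in the contraction, so the product of the
  extensions lies in \<open>P\<close>, and primeness of \<open>P\<close> decides between
  them.\<close>

lemma nc_prime_contraction: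
  assumes "nc_prime_ideal P RG"
  shows "nc_prime_ideal {r \<in> carrier R. const r \<in> P} R" (is "nc_prime_ideal ?Q R")
proof -
  interpret P: nc_prime_ideal P RG by (rule assms)
  have Q: "ideal ?Q R" by (rule const.ideal_vimage[OF P.is_ideal])
  show ?thesis
  proof (intro nc_prime_ideal.intro Q nc_prime_ideal_axioms.intro)
    show "?Q \<noteq> carrier R"
    proof
      assume "?Q = carrier R"
      then have "const \<one> \<in> P" using one_closed by blast
      then have "\<one>\<^bsub>RG\<^esub> \<in> P" by simp
      then show False using P.one_imp_carrier P.proper by blast
    qed
    fix I J assume I: "ideal I R" and J: "ideal J R" and IJ: "I \<cdot> J \<subseteq> ?Q"
    interpret I: ideal I R by (rule I)
    interpret J: ideal J R by (rule J)
    let ?I = "{f \<in> carrier RG. \<forall>g\<in>carrier G. f g \<in> I}" and ?J = "{f \<in> carrier RG. \<forall>g\<in>carrier G. f g \<in> J}"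
    have "x \<in> P" if "x \<in> ?I \<cdot>\<^bsub>RG\<^esub> ?J" for x
      using that
    proof (induction rule: ideal_prod.induct)
      case (prod f k)
      then have fk: "f \<in> carrier RG" "k \<in> carrier RG" by auto
      note cf = RG_D[OF fk(1)]
      have "(f \<otimes>\<^bsub>RG\<^esub> k) y \<in> ?Q" if y: "y \<in> carrier G" for y
        unfolding RG_mult_eq[OF fk cf(2) order_refl cf(4) y]
      proof (rule ideal.finsum_mem[OF Q cf(2)])
        fix g assume "g \<in> gr_support R G f"
        then have g: "g \<in> carrier G" using cf by blast
        then have "f g \<otimes> k (inv\<^bsub>G\<^esub> g \<otimes>\<^bsub>G\<^esub> y) \<in> I \<cdot> J" using prod y by (intro ideal_prod.prod) auto
        then show "f g \<otimes> k (inv\<^bsub>G\<^esub> g \<otimes>\<^bsub>G\<^esub> y) \<in> ?Q" using IJ by blast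
      qed
      then have "const ((f \<otimes>\<^bsub>RG\<^esub> k) y) \<in> P" if "y \<in> carrier G" for y using that by blast
      then show ?case by (rule coefficients_in_imp_mem[OF P.is_ideal RG.m_closed[OF fk]])
    next
      case (sum a b)
      then show ?case by (simp add: P.a_closed)
    qed
    then have "?I \<subseteq> P \<or> ?J \<subseteq> P" using P.prime[OF coefficient_ideal[OF I] coefficient_ideal[OF J]] by blast
    moreover have "K \<subseteq> ?Q"
      if K: "ideal K R" and sub: "{f \<in> carrier RG. \<forall>g\<in>carrier G. f g \<in> K} \<subseteq> P" for K
    proof
      fix r assume r: "r \<in> K"
      then have rc: "r \<in> carrier R" by (rule ideal.Icarr[OF K])
      have "\<zero> \<in> K" using K by (simp add: ideal_def additive_subgroup.zero_closed)
      then have "const r \<in> {f \<in> carrier RG. \<forall>g\<in>carrier G. f g \<in> K}" using r rc by (simp add: single_apply)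
      then show "r \<in> ?Q" using sub rc by blast
    qed
    ultimately show "I \<subseteq> ?Q \<or> J \<subseteq> ?Q" using I J by blast
  qed
qed

end

section \<open>Chain condition above a prime ideal of the group ring\<close>

context finite_group_ring_setup
begin

text \<open>Modulo \<open>P\<close> the group ring is a finitely generated left module over the
  noetherian ring \<open>R Quot ?Q\<close>. The induction enlarges the set of permitted group
  elements one by one, as in the proof that finite free modules are noetherian.\<close>

lemma left_acc_containing_prime:
  assumes P: "nc_prime_ideal P RG" and N: "\<And>Q. nc_prime_ideal Q R \<Longrightarrow> lr_noetherian_ring (R Quot Q)"
    and L: "\<And>n::nat. left_ideal (L n) RG" "\<And>n. P \<subseteq> L n" "\<And>n. L n \<subseteq> L (Suc n)"
  shows "\<exists>N. \<forall>n\<ge>N. L n \<subseteq> L N"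
proof -
  interpret P: nc_prime_ideal P RG by (rule P)
  let ?Q = "{r \<in> carrier R. const r \<in> P}"
  have Q: "nc_prime_ideal ?Q R" by (rule nc_prime_contraction[OF P])
  then have Qi: "ideal ?Q R" by (rule nc_prime_ideal.axioms)
  have mono: "L m \<subseteq> L n" if "m \<le> n" for m n using that L(3) by (rule lift_Suc_mono_le[rotated])
  have Lc: "f \<in> carrier RG" if "f \<in> L n" for f n
    using L(1)[of n] that by (auto simp: left_ideal_def dest: additive_subgroup.a_Hcarr)
  have "\<exists>N. \<forall>n\<ge>N. \<forall>f\<in>L n. (\<forall>x\<in>carrier G - A. f x = \<zero>) \<longrightarrow> f \<in> L N"
    if "finite A" "A \<subseteq> carrier G" for A
    using that
  proof (induction A rule: finite_induct)
    case empty
    have "f \<in> L 0" if "f \<in> L n" "\<forall>x\<in>carrier G. f x = \<zero>" for f n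
    proof -
      have "f = \<zero>\<^bsub>RG\<^esub>" by (rule RG_ext[OF Lc[OF that(1)]]) (use that in \<open>auto simp: zero_apply\<close>)
      then show ?thesis using L(1)[of 0] by (simp add: left_ideal_def additive_subgroup.zero_closed)
    qed
    then show ?case by auto
  next
    case (insert g A)
    have g: "g \<in> carrier G" and A: "A \<subseteq> carrier G" using insert.prems by auto
    obtain N1 where N1: "\<And>n f. \<lbrakk>n \<ge> N1; f \<in> L n; \<forall>x\<in>carrier G - A. f x = \<zero>\<rbrakk> \<Longrightarrow> f \<in> L N1"
      using insert.IH[OF A] by blast
    define M where "M n = {f \<in> L n. \<forall>x\<in>carrier G - insert g A. f x = \<zero>}" for n
    \<comment> \<open>The coefficients at the new element \<open>g\<close> form left ideals of
      \<open>R\<close> above the contraction of \<open>P\<close>, so this chain becomes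
      stationary.\<close>
    define C where "C n = (\<lambda>f. f g) ` M n" for n
    have "left_ideal (C n) R" for n
    proof (rule left_idealI_closed)
      interpret Ln: left_ideal "L n" RG by (rule L(1))
      show "C n \<subseteq> carrier R" by (auto simp: C_def M_def intro: RG_D(1)[OF Lc g])
      have "\<zero>\<^bsub>RG\<^esub> \<in> M n" using Ln.zero_closed by (simp add: M_def zero_apply)
      then show "\<zero> \<in> C n" unfolding C_def using g zero_apply by (metis imageI)
      fix a assume "a \<in> C n"
      then obtain f where f: "f \<in> M n" "a = f g" by (auto simp: C_def)
      have fc: "f \<in> carrier RG" "f \<in> L n" using f(1) Lc[of f n] by (simp_all add: M_def)
      show "r \<otimes> a \<in> C n" if r: "r \<in> carrier R" for r
      proof -
        have "const r \<otimes>\<^bsub>RG\<^esub> f \<in> L n" using Ln.left_closed[OF fc(2)] r by simp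
        moreover have "(const r \<otimes>\<^bsub>RG\<^esub> f) x = \<zero>" if x: "x \<in> carrier G - insert g A" for x
          using const_mult_apply[OF r fc(1), of x] x f(1) r unfolding M_def by simp
        ultimately have "const r \<otimes>\<^bsub>RG\<^esub> f \<in> M n" by (simp add: M_def)
        moreover have "r \<otimes> a = (const r \<otimes>\<^bsub>RG\<^esub> f) g" using f r fc g by (simp add: const_mult_apply)
        ultimately show ?thesis unfolding C_def by blast
      qed
      fix b assume "b \<in> C n"
      then obtain k where k: "k \<in> M n" "b = k g" by (auto simp: C_def)
      have "f \<oplus>\<^bsub>RG\<^esub> k \<in> M n" using f k by (auto simp: M_def RG_add_apply Ln.a_closed)
      moreover have "a \<oplus> b = (f \<oplus>\<^bsub>RG\<^esub> k) g" using f k g by (simp add: RG_add_apply)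
      ultimately show "a \<oplus> b \<in> C n" unfolding C_def by blast
    qed
    moreover have "?Q \<subseteq> C n" for n
    proof
      fix q assume q: "q \<in> ?Q"
      then have "single q g = const q \<otimes>\<^bsub>RG\<^esub> single \<one> g" using g by (intro single_eq_const_mult) auto
      then have "single q g \<in> P" using q g P.I_r_closed[of "const q" "single \<one> g"] by simp
      then have "single q g \<in> M n" using L(2)[of n] by (auto simp: M_def single_apply)
      moreover have "q = single q g g" using g by (simp add: single_apply)
      ultimately show "q \<in> C n" unfolding C_def by blast
    qed
    moreover have "C n \<subseteq> C (Suc n)" for n using L(3)[of n] by (auto simp: C_def M_def)
    ultimately obtain N2 where N2: "\<And>n. n \<ge> N2 \<Longrightarrow> C n = C N2"
      using ideal.left_acc_containing[OF Qi N[OF Q], of C] by blast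
    \<comment> \<open>Beyond \<open>N2\<close> some \<open>k\<close> in \<open>L N0\<close> has the
      same coefficient at \<open>g\<close> as \<open>f\<close>; the difference is supported on
      \<open>A\<close> and is caught by \<open>N1\<close>.\<close>
    define N0 where "N0 = max N1 N2"
    have "f \<in> L N0" if n: "n \<ge> N0" and f: "f \<in> L n" "\<forall>x\<in>carrier G - insert g A. f x = \<zero>" for n f
    proof -
      interpret Ln: left_ideal "L n" RG by (rule L(1))
      interpret L0: left_ideal "L N0" RG by (rule L(1))
      have "f g \<in> C n" using f by (auto simp: C_def M_def)
      then have "f g \<in> C N0" using N2[of n] N2[of N0] n by (auto simp: N0_def)
      then obtain k where k: "k \<in> L N0" "\<forall>x\<in>carrier G - insert g A. k x = \<zero>" "f g = k g"
        by (auto simp: C_def M_def)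
      have fc: "f \<in> carrier RG" "k \<in> carrier RG" using f k Lc by auto
      have "k \<in> L n" using k mono[OF n] by blast
      then have "f \<ominus>\<^bsub>RG\<^esub> k \<in> L n" using f Ln.a_closed Ln.a_inv_closed by (simp add: RG.minus_eq)
      moreover have "\<forall>x\<in>carrier G - A. (f \<ominus>\<^bsub>RG\<^esub> k) x = \<zero>"
      proof
        fix x assume x: "x \<in> carrier G - A"
        have "f x = k x" using x f k by (cases "x = g") auto
        then show "(f \<ominus>\<^bsub>RG\<^esub> k) x = \<zero>" using x fc RG_D(1)[of k x] by (simp add: minus_apply)
      qed
      ultimately have "f \<ominus>\<^bsub>RG\<^esub> k \<in> L N1" using N1[of n] n by (simp add: N0_def)
      then have "f \<ominus>\<^bsub>RG\<^esub> k \<in> L N0" using mono[of N1 N0] by (auto simp: N0_def)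
      then have "(f \<ominus>\<^bsub>RG\<^esub> k) \<oplus>\<^bsub>RG\<^esub> k \<in> L N0" using k L0.a_closed by blast
      then show ?thesis using fc by (simp add: RG.minus_eq RG.a_assoc RG.l_neg)
    qed
    then show ?case by blast
  qed
  from this[OF finite_group order_refl] show ?thesis by blast
qed

text \<open>The left annihilators modulo \<open>P\<close> of the tails of \<open>h\<close> form an
  ascending chain \<open>L\<close>. Orthogonality puts \<open>h N0\<close> into
  \<open>L (Suc N0)\<close>; if the chain is stationary at \<open>N0\<close>, then
  \<open>h N0\<close> annihilates itself modulo \<open>P\<close>, and idempotence puts it into
  \<open>P\<close>.\<close>

lemma orth_finite_group_ring:
  assumes reg: "vn_regular_ring R" and unit: "[card (carrier G)] \<cdot> \<one> \<in> Units R"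
    and N: "\<And>Q. nc_prime_ideal Q R \<Longrightarrow> lr_noetherian_ring (R Quot Q)"
  shows "orth_finite_vn_regular_ring RG"
proof (intro orth_finite_vn_regular_ring.intro vn_regular_group_ring reg unit orth_finite_vn_regular_ring_axioms.intro)
  fix P and h :: "nat \<Rightarrow> 'g \<Rightarrow> 'a"
  assume P: "nc_prime_ideal P RG" and h: "\<And>n. h n \<in> carrier RG" "\<And>n. h n \<otimes>\<^bsub>RG\<^esub> h n \<ominus>\<^bsub>RG\<^esub> h n \<in> P"
    "\<And>m n. m \<noteq> n \<Longrightarrow> h m \<otimes>\<^bsub>RG\<^esub> h n \<in> P"
  interpret P: nc_prime_ideal P RG by (rule P)
  define L where "L n = {t \<in> carrier RG. \<forall>m\<ge>n. t \<otimes>\<^bsub>RG\<^esub> h m \<in> P}" for n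
  have "left_ideal (L n) RG" for n
  proof (rule RG.left_idealI_closed)
    fix a x assume a: "a \<in> L n" and x: "x \<in> carrier RG"
    then have "x \<otimes>\<^bsub>RG\<^esub> a \<otimes>\<^bsub>RG\<^esub> h m \<in> P" if "m \<ge> n" for m
      using P.I_l_closed[of "a \<otimes>\<^bsub>RG\<^esub> h m" x] that h(1) by (simp add: L_def RG.m_assoc)
    then show "x \<otimes>\<^bsub>RG\<^esub> a \<in> L n" using a x by (simp add: L_def)
  qed (use h(1) P.zero_closed P.a_closed in \<open>auto simp: L_def RG.l_distr\<close>)
  moreover have "P \<subseteq> L n" for n using h(1) P.Icarr P.I_r_closed by (auto simp: L_def)
  moreover have "L n \<subseteq> L (Suc n)" for n by (auto simp: L_def)
  ultimately obtain N0 where N0: "\<And>n. n \<ge> N0 \<Longrightarrow> L n \<subseteq> L N0"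
    using left_acc_containing_prime[OF P N, of L] by blast
  have "h N0 \<in> L (Suc N0)" using h(1,3) by (auto simp: L_def)
  then have "h N0 \<in> L N0" using N0[of "Suc N0"] by auto
  then have "h N0 \<otimes>\<^bsub>RG\<^esub> h N0 \<in> P" by (simp add: L_def)
  then have "h N0 \<otimes>\<^bsub>RG\<^esub> h N0 \<oplus>\<^bsub>RG\<^esub> \<ominus>\<^bsub>RG\<^esub> (h N0 \<otimes>\<^bsub>RG\<^esub> h N0 \<ominus>\<^bsub>RG\<^esub> h N0) \<in> P"
    using h(2)[of N0] P.a_closed P.a_inv_closed by blast
  moreover have "x \<oplus>\<^bsub>RG\<^esub> \<ominus>\<^bsub>RG\<^esub> (x \<ominus>\<^bsub>RG\<^esub> y) = y" if "x \<in> carrier RG" "y \<in> carrier RG" for x y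
    using that by (simp add: RG.minus_eq RG.minus_add RG.r_neg flip: RG.a_assoc)
  ultimately show "\<exists>n. h n \<in> P" using h(1) by (metis RG.m_closed)
qed

end

section \<open>From finite subgroups to locally finite groups\<close>

text \<open>An element of \<open>RG\<close> lies in \<open>RH\<close> for the finite subgroup \<open>H\<close> generated by its support, and
  extension by zero embeds \<open>RH\<close> into \<open>RG\<close>.\<close>

context group_ring_setup
begin

lemma extension_by_zero:
  fixes H
  defines "RH \<equiv> group_ring R (G\<lparr>carrier := H\<rparr>)"
    and "ext \<equiv> \<lambda>f. \<lambda>x\<in>carrier G. if x \<in> H then f x else \<zero>"
  assumes H: "subgroup H G"
  shows "f \<in> carrier RH \<Longrightarrow> ext f \<in> carrier RG"
    and "\<lbrakk>f \<in> carrier RH; k \<in> carrier RH\<rbrakk> \<Longrightarrow> ext (f \<otimes>\<^bsub>RH\<^esub> k) = ext f \<otimes>\<^bsub>RG\<^esub> ext k"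
    and "ext \<one>\<^bsub>RH\<^esub> = \<one>\<^bsub>RG\<^esub>"
proof -
  interpret H: subgroup H G by (rule H)
  interpret K: group_ring_setup R "G\<lparr>carrier := H\<rparr>"
    by (intro group_ring_setup.intro ring_axioms G.subgroup_imp_group H)
  note D = K.RG_D[folded RH_def, simplified]
  have Hc: "x \<in> carrier G" if "x \<in> H" for x using that H.subset by blast
  have ext_apply: "ext f x = (if x \<in> H then f x else \<zero>)" if "x \<in> carrier G" for f x
    using that by (simp add: ext_def)
  show cl: "ext f \<in> carrier RG" if "f \<in> carrier RH" for f
    by (rule RG_I[OF _ _ D(2)[OF that]])
      (use D(1)[OF that] in \<open>auto simp: ext_apply gr_support_def\<close>, simp add: ext_def)
  have supp: "gr_support R G (ext f) = gr_support R (G\<lparr>carrier := H\<rparr>) f" for f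
    using Hc by (auto simp: gr_support_def ext_apply split: if_splits)
  show "ext (f \<otimes>\<^bsub>RH\<^esub> k) = ext f \<otimes>\<^bsub>RG\<^esub> ext k" if f: "f \<in> carrier RH" and k: "k \<in> carrier RH" for f k
  proof (rule RG_ext)
    show "ext (f \<otimes>\<^bsub>RH\<^esub> k) \<in> carrier RG" using f k K.RG.m_closed unfolding RH_def[symmetric] by (intro cl)
    fix x assume x: "x \<in> carrier G"
    let ?S = "gr_support R (G\<lparr>carrier := H\<rparr>) f"
    have S: "finite ?S" "?S \<subseteq> H" using D[OF f] by auto
    have SG: "?S \<subseteq> carrier G" using S Hc by blast
    have e: "(ext f \<otimes>\<^bsub>RG\<^esub> ext k) x = (\<Oplus>g\<in>?S. ext f g \<otimes> ext k (inv\<^bsub>G\<^esub> g \<otimes>\<^bsub>G\<^esub> x))"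
      by (rule RG_mult_eq[OF cl[OF f] cl[OF k] S(1) _ SG x]) (simp add: supp)
    show "ext (f \<otimes>\<^bsub>RH\<^esub> k) x = (ext f \<otimes>\<^bsub>RG\<^esub> ext k) x"
    proof (cases "x \<in> H")
      case True
      have "ext (f \<otimes>\<^bsub>RH\<^esub> k) x = (\<Oplus>g\<in>?S. f g \<otimes> k (inv\<^bsub>G\<lparr>carrier := H\<rparr>\<^esub> g \<otimes>\<^bsub>G\<^esub> x))"
        using K.RG_mult_eq[folded RH_def, OF f k S(1) order_refl] S(2) True x by (simp add: ext_apply)
      also have "\<dots> = (\<Oplus>g\<in>?S. ext f g \<otimes> ext k (inv\<^bsub>G\<^esub> g \<otimes>\<^bsub>G\<^esub> x))"
      proof (rule finsum_cong')
        fix g assume "g \<in> ?S"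
        then have g: "g \<in> H" using S by blast
        then show "f g \<otimes> k (inv\<^bsub>G\<lparr>carrier := H\<rparr>\<^esub> g \<otimes>\<^bsub>G\<^esub> x) = ext f g \<otimes> ext k (inv\<^bsub>G\<^esub> g \<otimes>\<^bsub>G\<^esub> x)"
          using True Hc by (simp add: ext_apply G.m_inv_consistent[OF H])
      next
        show "(\<lambda>g. ext f g \<otimes> ext k (inv\<^bsub>G\<^esub> g \<otimes>\<^bsub>G\<^esub> x)) \<in> ?S \<rightarrow> carrier R"
          using RG_D(1)[OF cl[OF f]] RG_D(1)[OF cl[OF k]] SG x by (auto simp: subset_iff)
      qed simp
      finally show ?thesis using e by simp
    next
      case False
      \<comment> \<open>Outside \<open>H\<close> nothing can arise: for \<open>g\<close> in
        \<open>H\<close> and \<open>x\<close> not in \<open>H\<close>, the second factor is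
        evaluated outside \<open>H\<close>.\<close>
      have "ext f g \<otimes> ext k (inv\<^bsub>G\<^esub> g \<otimes>\<^bsub>G\<^esub> x) = \<zero>" if "g \<in> ?S" for g
      proof -
        have g: "g \<in> H" "g \<in> carrier G" using that S Hc by auto
        have "x = g \<otimes>\<^bsub>G\<^esub> (inv\<^bsub>G\<^esub> g \<otimes>\<^bsub>G\<^esub> x)" using g x by (simp add: G.m_assoc[symmetric])
        then have "inv\<^bsub>G\<^esub> g \<otimes>\<^bsub>G\<^esub> x \<notin> H" using False g H.m_closed by metis
        then show ?thesis using g x RG_D(1)[OF cl[OF f] g(2)] by (simp add: ext_apply)
      qed
      then show ?thesis using e False x by (simp add: ext_apply add.finprod_one_eqI)
    qed
  qed (use cl f k in auto)
  show "ext \<one>\<^bsub>RH\<^esub> = \<one>\<^bsub>RG\<^esub>"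
    using Hc by (auto simp: RH_def ext_def group_ring_def)
qed

text \<open>By Cauchy's theorem every prime divisor of the order of \<open>H\<close> is the order of
  an element, so that order is a unit of \<open>R\<close>. A unit inner inverse over
  \<open>H\<close> stays one after extension by zero, as products and one are preserved.\<close>

lemma unit_regular_group_ring:
  assumes "locally_finite_group G" and reg: "vn_regular_ring R"
    and unit: "\<And>g. g \<in> carrier G \<Longrightarrow> [G.ord g] \<cdot> \<one> \<in> Units R"
    and N: "\<And>Q. nc_prime_ideal Q R \<Longrightarrow> lr_noetherian_ring (R Quot Q)"
  shows "unit_regular_ring RG"
proof unfold_locales
  interpret L: locally_finite_group G by (rule assms(1))
  fix a assume a: "a \<in> carrier RG"
  define H where "H = generate G (gr_support R G a)"
  have H: "subgroup H G" "finite H" "gr_support R G a \<subseteq> H"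
    using RG_D(2,4)[OF a] G.generate_is_subgroup L.finite_generate generate.incl unfolding H_def by auto
  interpret H: subgroup H G by (rule H(1))
  let ?GH = "G\<lparr>carrier := H\<rparr>"
  interpret K: finite_group_ring_setup R ?GH
    by (intro finite_group_ring_setup.intro group_ring_setup.intro ring_axioms G.subgroup_imp_group H
        finite_group_ring_setup_axioms.intro) (simp add: H)
  have "[card (carrier ?GH)] \<cdot> \<one> \<in> Units R"
  proof (rule nat_multiple_unit)
    have "H \<noteq> {}" using H.one_closed by blast
    then show "card (carrier ?GH) > 0" using H(2) card_gt_0_iff[of H] by simp
    fix p assume p: "Factorial_Ring.prime p" "p dvd card (carrier ?GH)"
    obtain g where g: "g \<in> H" "K.G.ord g = p"
      using K.G.ex_element_of_prime_order[OF K.finite_group p(1)] p(2) by (auto simp: order_def)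
    have gc: "g \<in> carrier G" using g by simp
    have "generate ?GH {g} = generate G {g}" using G.generate_consistent[OF _ H(1)] g by simp
    then have "G.ord g = p" using g G.generate_pow_card[OF gc] K.G.generate_pow_card[of g] by simp
    then show "[p] \<cdot> \<one> \<in> Units R" using unit[OF gc] by simp
  qed
  then interpret U: unit_regular_ring K.RG
    using orth_finite_vn_regular_ring.is_unit_regular[OF K.orth_finite_group_ring[OF reg _ N]] by blast
  define ext where "ext f = (\<lambda>x\<in>carrier G. if x \<in> H then f x else \<zero>)" for f
  note ext = extension_by_zero[OF H(1), folded ext_def]
  define b where "b = restrict a H"
  have b: "b \<in> carrier K.RG"
    by (rule K.RG_I[OF _ _ RG_D(2)[OF a]]) (use RG_D(1)[OF a] in \<open>auto simp: b_def gr_support_def\<close>)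
  have ab: "ext b = a"
    by (rule RG_ext[OF ext(1)[OF b] a]) (use H(3) in \<open>auto simp: ext_def b_def gr_support_def\<close>)
  obtain u v where u: "u \<in> carrier K.RG" "v \<in> carrier K.RG" "u \<otimes>\<^bsub>K.RG\<^esub> v = \<one>\<^bsub>K.RG\<^esub>" "v \<otimes>\<^bsub>K.RG\<^esub> u = \<one>\<^bsub>K.RG\<^esub>"
    "b = b \<otimes>\<^bsub>K.RG\<^esub> u \<otimes>\<^bsub>K.RG\<^esub> b"
    using U.unit_regular[OF b] by (auto simp: Units_def)
  have "ext u \<otimes>\<^bsub>RG\<^esub> ext v = \<one>\<^bsub>RG\<^esub>" "ext v \<otimes>\<^bsub>RG\<^esub> ext u = \<one>\<^bsub>RG\<^esub>"
    using u ext(2)[OF u(1,2)] ext(2)[OF u(2,1)] ext(3) by simp_all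
  then have "ext u \<in> Units RG" using ext(1) u by (auto simp: Units_def)
  moreover have "a = a \<otimes>\<^bsub>RG\<^esub> ext u \<otimes>\<^bsub>RG\<^esub> a"
    using arg_cong[OF u(5), of ext] ext(2)[OF K.RG.m_closed[OF b u(1)] b] ext(2)[OF b u(1)] ab by simp
  ultimately show "\<exists>u\<in>Units RG. a = a \<otimes>\<^bsub>RG\<^esub> u \<otimes>\<^bsub>RG\<^esub> a" by blast
qed

end

text \<open>The ring is taken nonzero: over the zero ring every group ring is zero and thus
  unit-regular, whatever the group.\<close>

theorem theorem4p1:
  fixes R :: "('a, 'm) ring_scheme" and G :: "('g, 'n) monoid_scheme"
  assumes "ring R" and "\<one>\<^bsub>R\<^esub> \<noteq> \<zero>\<^bsub>R\<^esub>" and "group G"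
  shows "(unit_regular_ring (group_ring R G) \<longrightarrow>
            unit_regular_ring R \<and> locally_finite_group G \<and>
            (\<forall>g\<in>carrier G. [group.ord G g] \<cdot>\<^bsub>R\<^esub> \<one>\<^bsub>R\<^esub> \<in> Units R)) \<and>
         ((\<forall>P. nc_prime_ideal P R \<longrightarrow> lr_noetherian_ring (R Quot P)) \<and>
            unit_regular_ring R \<and> locally_finite_group G \<and>
            (\<forall>g\<in>carrier G. [group.ord G g] \<cdot>\<^bsub>R\<^esub> \<one>\<^bsub>R\<^esub> \<in> Units R) \<longrightarrow>
            unit_regular_ring (group_ring R G))"
proof -
  interpret group_ring_setup R G using assms by (intro group_ring_setup.intro)
  show ?thesis
    using unit_regular_coefficients unit_regular_ring.is_vn_regular[of RG] unit_regular_ring.is_vn_regular[of R]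
      locally_finite_if_vn_regular[OF _ assms(2)] order_unit_if_vn_regular[OF _ assms(2)] unit_regular_group_ring
    by blast
qed

end
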